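(* Let $k$ be an arbitrary field, let $a=b\geq 3$ be an integer and put $p=a^2+a-1$. Let $K_{p,1}=\bigoplus_{u\in\mathbb{Z}^2}(K_{p,1})_u$ be the bidegree decomposition of the syzygy space $K_{p,1}$ of $\mathbb{P}^1\times\mathbb{P}^1$ embedded via $\mathcal{O}(a)\otimes\mathcal{O}(a)$, and put $c=a^2(a+1)/2$. Then: - $\dim_k (K_{p,1})_{(c,c)}=2$; - $\dim_k (K_{p,1})_u=1$ whenever one coordinate of $u$ equals $c$ and the other coordinate $d$ satisfies $d\neq c$ and $|d-c|<a(a+1)/2$; - $\dim_k (K_{p,1})_u=0$ for all other $u\in\mathbb{Z}^2$.
   Context: Let $R=\bigoplus_{n\geq 0}R_n$ be the homogeneous coordinate ring of $\mathbb{P}^1\times\mathbb{P}^1$ embedded by $\mathcal{O}(a)\otimes\mathcal{O}(b)$ (here with $b=a$): $R_n$ has $k$-basis $b_{n,i,j}$ with $0\leq i\leq na$, $0\leq j\leq nb$, and $b_{n,i,j}\,b_{m,i',j'}=b_{n+m,i+i',j+j'}$. Let $V=R_1$ and let $S=\mathrm{Sym}(V)$, a polynomial ring in $(a+1)(b+1)$ variables, so that $R$ is a graded $S$-module. The syzygy space $K_{p,q}$ is $\mathrm{Tor}^S_p(R,k)_{p+q}$, and can be computed as the homology at the middle place of the Koszul complex $$\bigwedge^{p+1}V\otimes R_{q-1}\to\bigwedge^{p}V\otimes R_q\to\bigwedge^{p-1}V\otimes R_{q+1},$$ with differentials $v_1\wedge\dots\wedge v_m\otimes r\mapsto\sum_{l}(-1)^l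 v_1\wedge\dots\wedge\widehat{v_l}\wedge\dots\wedge v_m\otimes v_l r$. The element $b_{n,i,j}$ is given bidegree $(i,j)\in\mathbb{Z}^2$, and bidegrees are additive in tensor and wedge products. The differentials preserve the bidegree, so $K_{p,q}$ inherits a decomposition $\bigoplus_{u\in\mathbb{Z}^2}(K_{p,q})_u$. The bidegree table of $K_{p,q}$ is the function $u\mapsto\dim_k(K_{p,q})_u$. *)

theory Defs
  imports "HOL.Vector_Spaces" "HOL-Library.Poly_Mapping" "HOL-Library.Product_Plus"
begin

section \<open>Dimension of a quotient of subspaces\<close>

context vector_space
begin

text \<open>
  \<open>X\<close> is a set of representatives in \<open>Z\<close> of a finite basis of the quotient space \<open>Z / B\<close>:
  the classes of \<open>X\<close> are linearly independent in the quotient, and they span it.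
\<close>

definition quotient_basis :: "'b set \<Rightarrow> 'b set \<Rightarrow> 'b set \<Rightarrow> bool" where
  "quotient_basis Z B X \<longleftrightarrow> finite X \<and> X \<subseteq> Z \<and>
     (\<forall>r. (\<Sum>x\<in>X. scale (r x) x) \<in> B \<longrightarrow> (\<forall>x\<in>X. r x = 0)) \<and>
     (\<forall>z\<in>Z. \<exists>r. z - (\<Sum>x\<in>X. scale (r x) x) \<in> B)"

definition quotient_dim :: "'b set \<Rightarrow> 'b set \<Rightarrow> nat" where
  "quotient_dim Z B = (THE n. \<exists>X. quotient_basis Z B X \<and> card X = n)"

lemma quotient_basis_card_le:
  assumes B: "subspace B" and X: "quotient_basis Z B X" and Y: "quotient_basis Z B Y"
  shows "card X \<le> card Y"
proof -
  obtain C where C: "C \<subseteq> B" "independent C" "span C = B"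
    using B maximal_independent_subset[of B] span_minimal span_mono span_eq_iff
    by (metis subset_antisym)
  have fX: "finite X" and fY: "finite Y" and XZ: "X \<subseteq> Z"
    using X Y by (auto simp: quotient_basis_def)
  have ind: "\<forall>x\<in>X. r x = 0" if "(\<Sum>x\<in>X. scale (r x) x) \<in> B" for r
    using X that by (auto simp: quotient_basis_def)
  have span_Y: "x \<in> span (Y \<union> C)" if x: "x \<in> X" for x
  proof -
    obtain r where r: "x - (\<Sum>y\<in>Y. scale (r y) y) \<in> B"
      using Y x XZ unfolding quotient_basis_def by blast
    have "x - (\<Sum>y\<in>Y. scale (r y) y) \<in> span (Y \<union> C)"
      using r C(3) span_mono[of C "Y \<union> C"] by blast
    moreover have "(\<Sum>y\<in>Y. scale (r y) y) \<in> span (Y \<union> C)"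
      by (intro span_sum span_scale span_base) auto
    ultimately show ?thesis
      using span_add by (metis diff_add_cancel)
  qed
  have grow: "\<exists>Y'. Y' \<subseteq> Y \<and> card Y' + card X' = card Y \<and> Y \<subseteq> span (X' \<union> Y' \<union> C)"
    if "X' \<subseteq> X" for X'
    using finite_subset[OF that fX] that
  proof (induction X' rule: finite_induct)
    case empty
    then show ?case by (intro exI[of _ Y]) (auto intro: span_base)
  next
    case (insert x X')
    then obtain Y' where Y': "Y' \<subseteq> Y" "card Y' + card X' = card Y" "Y \<subseteq> span (X' \<union> Y' \<union> C)"
      by auto
    have fY': "finite Y'" using Y' fY finite_subset by blast
    have "Y \<union> C \<subseteq> span (X' \<union> Y' \<union> C)" using Y'(3) by (auto intro: span_base)
    then have xs: "x \<in> span (Y' \<union> (X' \<union> C))"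
      using span_Y[of x] insert.prems span_minimal[OF _ subspace_span, of "Y \<union> C" "X' \<union> Y' \<union> C"]
      by (auto simp: Un_ac)
    have xn: "x \<notin> span (X' \<union> C)"
    proof
      assume "x \<in> span (X' \<union> C)"
      then obtain s t where st: "s \<in> span X'" "t \<in> span C" "x = s + t"
        by (auto simp: span_Un)
      obtain r where r: "s = (\<Sum>y\<in>X'. scale (r y) y)"
        using st(1) span_finite[OF insert.hyps(1)] by auto
      define r' where "r' y = (if y = x then 1 else if y \<in> X' then - r y else 0)" for y
      have "(\<Sum>y\<in>X. scale (r' y) y) = (\<Sum>y\<in>insert x X'. scale (r' y) y)"
        using insert.prems fX by (intro sum.mono_neutral_right) (auto simp: r'_def)
      also have "\<dots> = x + (\<Sum>y\<in>X'. scale (r' y) y)"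
        using insert.hyps by (simp add: r'_def)
      also have "(\<Sum>y\<in>X'. scale (r' y) y) = (\<Sum>y\<in>X'. - scale (r y) y)"
        using insert.hyps by (intro sum.cong) (auto simp: r'_def)
      also have "x + \<dots> = t" using st(3) r by (simp add: sum_negf)
      finally have "\<forall>x\<in>X. r' x = 0" using ind st(2) C(3) by auto
      then show False using insert.prems by (auto simp: r'_def)
    qed
    have "\<exists>y\<in>Y''. y \<in> span (insert x ((Y'' - {y}) \<union> (X' \<union> C)))"
      if "finite Y''" "x \<in> span (Y'' \<union> (X' \<union> C))" for Y''
      using that
    proof (induction Y'' rule: finite_induct)
      case empty
      then show ?case using xn by simp
    next
      case (insert y Y'')
      show ?case
      proof (cases "x \<in> span (Y'' \<union> (X' \<union> C))")
        case True
        then obtain z where z: "z \<in> Y''" "z \<in> span (insert x ((Y'' - {z}) \<union> (X' \<union> C)))"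
          using insert by auto
        have "insert x ((Y'' - {z}) \<union> (X' \<union> C))
              \<subseteq> insert x ((insert y Y'' - {z}) \<union> (X' \<union> C))" by auto
        then show ?thesis using z span_mono by blast
      next
        case False
        have "y \<in> span (insert x (Y'' \<union> (X' \<union> C)))"
          using in_span_insert[of x y "Y'' \<union> (X' \<union> C)"] insert.prems False by simp
        then show ?thesis using insert.hyps by auto
      qed
    qed
    from this[OF fY' xs] obtain y where
      y: "y \<in> Y'" "y \<in> span (insert x ((Y' - {y}) \<union> (X' \<union> C)))" by blast
    let ?T = "span (insert x X' \<union> (Y' - {y}) \<union> C)"
    have "y \<in> ?T" using y(2) by (simp add: Un_ac)
    then have "X' \<union> Y' \<union> C \<subseteq> ?T" by (auto intro: span_base)
    then have "Y \<subseteq> ?T" using Y'(3) span_minimal[OF _ subspace_span] by blast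
    moreover have "card (Y' - {y}) + card (insert x X') = card Y"
      using y(1) fY' insert.hyps Y'(2) card_Suc_Diff1[OF fY' y(1)] by simp
    ultimately show ?case using Y'(1) by (intro exI[of _ "Y' - {y}"]) auto
  qed
  from grow[of X] show ?thesis by auto
qed

lemma quotient_dim_eqI:
  assumes "subspace B" "quotient_basis Z B X"
  shows "quotient_dim Z B = card X"
  unfolding quotient_dim_def
  using assms quotient_basis_card_le[OF assms(1)] by (intro the_equality) (auto intro!: antisym)

end

definition pm_scale :: "'k::field \<Rightarrow> ('x \<Rightarrow>\<^sub>0 'k) \<Rightarrow> 'x \<Rightarrow>\<^sub>0 'k" where
  "pm_scale r f = Poly_Mapping.map ((*) r) f"

lemma lookup_pm_scale [simp]: "Poly_Mapping.lookup (pm_scale r f) x = r * Poly_Mapping.lookup f x"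
  by (simp add: pm_scale_def Poly_Mapping.map.rep_eq when_def)

lemma pm_scale_single: "pm_scale r (Poly_Mapping.single x c) = Poly_Mapping.single x (r * c)"
  by (rule poly_mapping_eqI) (simp add: lookup_single when_def)

global_interpretation pm: vector_space pm_scale
  by unfold_locales (auto intro!: poly_mapping_eqI simp: lookup_add algebra_simps)

section \<open>The bigraded Koszul complex\<close>

text \<open>
  In a fixed degree \<open>n\<close>, the basis element \<open>b\<^bsub>n,i,j\<^esub>\<close> of \<open>R\<^sub>n\<close> is represented by \<open>(i, j)\<close>, so
  that multiplication of basis elements is addition of pairs. All indices are integers, so
  that \<open>R\<^sub>n\<close> and the exterior powers vanish in negative degrees.
\<close>

definition R_basis :: "int \<Rightarrow> int \<Rightarrow> int \<Rightarrow> (int \<times> int) set" where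
  "R_basis a b n = (if n < 0 then {} else {0..n * a} \<times> {0..n * b})"

text \<open>
  We order the basis of \<open>V = R\<^sub>1\<close> lexicographically. The pair \<open>(S, m)\<close> stands for
  \<open>v\<^sub>1 \<and> \<dots> \<and> v\<^sub>p \<otimes> m\<close>, where \<open>v\<^sub>1 < \<dots> < v\<^sub>p\<close> are the elements of \<open>S\<close>; the space
  \<open>\<And>\<^sup>p V \<otimes> R\<^sub>q\<close> is the free vector space on these pairs.
\<close>

type_synonym tensor = "(int \<times> int) set \<times> (int \<times> int)"

definition koszul_basis :: "int \<Rightarrow> int \<Rightarrow> int \<Rightarrow> int \<Rightarrow> tensor set" where
  "koszul_basis a b p q =
     {(S, m). S \<subseteq> R_basis a b 1 \<and> int (card S) = p \<and> m \<in> R_basis a b q}"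

definition bidegree :: "tensor \<Rightarrow> int \<times> int" where
  "bidegree = (\<lambda>(S, m). (\<Sum>s\<in>S. s) + m)"

definition koszul_space ::
    "int \<Rightarrow> int \<Rightarrow> int \<Rightarrow> int \<Rightarrow> int \<times> int \<Rightarrow> (tensor \<Rightarrow>\<^sub>0 'k::field) set" where
  "koszul_space a b p q u =
     {f. Poly_Mapping.keys f \<subseteq> {x \<in> koszul_basis a b p q. bidegree x = u}}"

definition lex_le :: "int \<times> int \<Rightarrow> int \<times> int \<Rightarrow> bool" where
  "lex_le = (\<lambda>(i, j) (i', j'). i < i' \<or> i = i' \<and> j \<le> j')"

text \<open>The 1-based index \<open>l\<close> of \<open>s = v\<^sub>l\<close> in the increasing enumeration of \<open>S\<close>.\<close>

definition position :: "(int \<times> int) set \<Rightarrow> int \<times> int \<Rightarrow> nat" where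
  "position S s = card {t \<in> S. lex_le t s}"

definition koszul_diff :: "(tensor \<Rightarrow>\<^sub>0 'k::field) \<Rightarrow> tensor \<Rightarrow>\<^sub>0 'k" where
  "koszul_diff f = (\<Sum>(S, m)\<in>Poly_Mapping.keys f. pm_scale (Poly_Mapping.lookup f (S, m))
     (\<Sum>s\<in>S. Poly_Mapping.single (S - {s}, s + m) ((- 1) ^ position S s)))"

definition syzygy_cycles ::
    "int \<Rightarrow> int \<Rightarrow> int \<Rightarrow> int \<Rightarrow> int \<times> int \<Rightarrow> (tensor \<Rightarrow>\<^sub>0 'k::field) set" where
  "syzygy_cycles a b p q u = {f \<in> koszul_space a b p q u. koszul_diff f = 0}"

definition syzygy_boundaries ::
    "int \<Rightarrow> int \<Rightarrow> int \<Rightarrow> int \<Rightarrow> int \<times> int \<Rightarrow> (tensor \<Rightarrow>\<^sub>0 'k::field) set" where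
  "syzygy_boundaries a b p q u = koszul_diff ` koszul_space a b (p + 1) (q - 1) u"

text \<open>The differential squares to zero and preserves the bidegree.\<close>

definition koszul_diff_basis :: "tensor \<Rightarrow> tensor \<Rightarrow>\<^sub>0 'k::field" where
  "koszul_diff_basis = (\<lambda>(S, m).
     \<Sum>s\<in>S. Poly_Mapping.single (S - {s}, s + m) ((- 1) ^ position S s))"

lemma koszul_diff_superset:
  assumes "finite X" "Poly_Mapping.keys f \<subseteq> X"
  shows "koszul_diff f = (\<Sum>x\<in>X. pm_scale (Poly_Mapping.lookup f x) (koszul_diff_basis x))"
proof -
  have "koszul_diff f =
      (\<Sum>x\<in>Poly_Mapping.keys f. pm_scale (Poly_Mapping.lookup f x) (koszul_diff_basis x))"
    unfolding koszul_diff_def by (intro sum.cong) (auto simp: koszul_diff_basis_def)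
  also have "\<dots> = (\<Sum>x\<in>X. pm_scale (Poly_Mapping.lookup f x) (koszul_diff_basis x))"
    using assms by (intro sum.mono_neutral_left) (auto simp: in_keys_iff pm.scale_zero_left)
  finally show ?thesis .
qed

lemma koszul_diff_add: "koszul_diff (f + g) = koszul_diff f + koszul_diff g"
proof -
  let ?X = "Poly_Mapping.keys f \<union> Poly_Mapping.keys g"
  have "Poly_Mapping.keys (f + g) \<subseteq> ?X" by (rule Poly_Mapping.keys_add)
  then show ?thesis
    by (simp add: koszul_diff_superset[of ?X] lookup_add pm.scale_left_distrib sum.distrib)
qed

lemma koszul_diff_scale: "koszul_diff (pm_scale r f) = pm_scale r (koszul_diff f)"
proof -
  have "Poly_Mapping.keys (pm_scale r f) \<subseteq> Poly_Mapping.keys f" by (auto simp: in_keys_iff)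
  then show ?thesis
    by (simp add: koszul_diff_superset[of "Poly_Mapping.keys f"] pm.scale_sum_right)
qed

lemma koszul_diff_zero [simp]: "koszul_diff 0 = 0"
  by (simp add: koszul_diff_def)

lemma koszul_diff_sum: "koszul_diff (\<Sum>x\<in>A. g x) = (\<Sum>x\<in>A. koszul_diff (g x))"
  by (induction A rule: infinite_finite_induct) (simp_all add: koszul_diff_add)

lemma koszul_diff_single:
  "koszul_diff (Poly_Mapping.single x r) = pm_scale r (koszul_diff_basis x)"
  by (subst koszul_diff_superset[of "{x}"]) auto

lemma position_diff:
  assumes "finite S" "s \<in> S"
  shows "position S t = position (S - {s}) t + (if lex_le s t then 1 else 0)"
proof (cases "lex_le s t")
  case True
  have "{u \<in> S. lex_le u t} = insert s {u \<in> S - {s}. lex_le u t}" using assms True by auto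
  then show ?thesis using assms True by (simp add: position_def)
next
  case False
  have "{u \<in> S. lex_le u t} = {u \<in> S - {s}. lex_le u t}" using False by auto
  then show ?thesis using False by (simp add: position_def)
qed

lemma koszul_diff_diff_basis: "koszul_diff (koszul_diff_basis (S, m)) = (0 :: tensor \<Rightarrow>\<^sub>0 'k::field)"
proof (cases "finite S")
  case False
  then show ?thesis by (simp add: koszul_diff_basis_def)
next
  case fin: True
  define g :: "int \<times> int \<Rightarrow> int \<times> int \<Rightarrow> tensor \<Rightarrow>\<^sub>0 'k" where
    "g s t = Poly_Mapping.single (S - {s} - {t}, t + (s + m))
       ((- 1) ^ position S s * (- 1) ^ position (S - {s}) t)" for s t
  let ?lt = "\<lambda>s t. s \<noteq> t \<and> lex_le s t"
  have anti: "g s t = - g t s" if "s \<in> S" "t \<in> S" "?lt s t" for s t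
  proof -
    have "\<not> lex_le t s" using that by (auto simp: lex_le_def)
    then have "position S t = Suc (position (S - {s}) t)" "position S s = position (S - {t}) s"
      using that position_diff[OF fin, of s t] position_diff[OF fin, of t s] by auto
    moreover have "S - {s} - {t} = S - {t} - {s}" by auto
    ultimately show ?thesis
      by (simp add: g_def add_ac mult.commute flip: single_uminus)
  qed
  have "koszul_diff (koszul_diff_basis (S, m)) = (\<Sum>s\<in>S. \<Sum>t\<in>S - {s}. g s t)"
    unfolding koszul_diff_basis_def g_def prod.case koszul_diff_sum koszul_diff_single
    by (simp add: koszul_diff_basis_def pm.scale_sum_right pm_scale_single)
  also have "\<dots> = (\<Sum>s\<in>S. (\<Sum>t\<in>{t \<in> S. ?lt s t}. g s t) + (\<Sum>t\<in>{t \<in> S. ?lt t s}. g s t))"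
  proof (intro sum.cong refl)
    fix s
    have "S - {s} = {t \<in> S. ?lt s t} \<union> {t \<in> S. ?lt t s}" by (auto simp: lex_le_def)
    moreover have "{t \<in> S. ?lt s t} \<inter> {t \<in> S. ?lt t s} = {}" by (auto simp: lex_le_def)
    ultimately show "(\<Sum>t\<in>S - {s}. g s t) =
        (\<Sum>t\<in>{t \<in> S. ?lt s t}. g s t) + (\<Sum>t\<in>{t \<in> S. ?lt t s}. g s t)"
      using fin by (simp add: sum.union_disjoint)
  qed
  also have "\<dots> = (\<Sum>s\<in>S. \<Sum>t\<in>{t \<in> S. ?lt s t}. g s t) + (\<Sum>t\<in>S. \<Sum>s\<in>{s \<in> S. ?lt t s}. g s t)"
    using sum.swap_restrict[OF fin fin, of "\<lambda>s t. g s t" "\<lambda>s t. ?lt t s"]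
    by (simp add: sum.distrib)
  also have "(\<Sum>s\<in>S. \<Sum>t\<in>{t \<in> S. ?lt s t}. g s t) = - (\<Sum>s\<in>S. \<Sum>t\<in>{t \<in> S. ?lt s t}. g t s)"
    unfolding sum_negf[symmetric] by (intro sum.cong refl) (use anti in auto)
  finally show ?thesis by simp
qed

lemma koszul_diff_diff: "koszul_diff (koszul_diff f) = 0"
proof -
  have "koszul_diff f =
      (\<Sum>x\<in>Poly_Mapping.keys f. pm_scale (Poly_Mapping.lookup f x) (koszul_diff_basis x))"
    by (rule koszul_diff_superset) auto
  then show ?thesis
    by (simp add: koszul_diff_sum koszul_diff_scale)
       (auto intro!: sum.neutral simp: koszul_diff_diff_basis)
qed

lemma subspace_koszul_space: "pm.subspace (koszul_space a b p q u)"
  unfolding pm.subspace_def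
proof (intro conjI ballI allI)
  fix f g :: "tensor \<Rightarrow>\<^sub>0 'a" and r
  assume f: "f \<in> koszul_space a b p q u"
  have "Poly_Mapping.keys (pm_scale r f) \<subseteq> Poly_Mapping.keys f" by (auto simp: in_keys_iff)
  then show "pm_scale r f \<in> koszul_space a b p q u" using f by (auto simp: koszul_space_def)
  assume g: "g \<in> koszul_space a b p q u"
  show "f + g \<in> koszul_space a b p q u"
    using f g Poly_Mapping.keys_add[of f g] unfolding koszul_space_def by blast
qed (simp add: koszul_space_def)

lemma koszul_diff_space:
  assumes "f \<in> koszul_space a b p q u"
  shows "koszul_diff f \<in> koszul_space a b (p - 1) (q + 1) u"
proof -
  let ?W = "koszul_space a b (p - 1) (q + 1) u"
  note W = subspace_koszul_space[of a b "p - 1" "q + 1" u]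
  have "Poly_Mapping.single (S - {s}, s + m) r \<in> ?W"
    if S: "(S, m) \<in> Poly_Mapping.keys f" and s: "s \<in> S" for S s m r
  proof -
    have *: "S \<subseteq> R_basis a b 1" "int (card S) = p" "m \<in> R_basis a b q" "\<Sum>S + m = u"
      using S assms by (auto simp: koszul_space_def koszul_basis_def bidegree_def)
    have fin: "finite S" using *(1) by (rule finite_subset) (simp add: R_basis_def)
    have "s + m \<in> R_basis a b (q + 1)"
      using *(1,3) s by (force simp: R_basis_def algebra_simps split: if_splits)
    moreover have "int (card (S - {s})) = p - 1"
      using *(2) card_Suc_Diff1[OF fin s] by linarith
    moreover have "\<Sum>(S - {s}) + (s + m) = u"
      using *(4) sum.remove[OF fin s, of "\<lambda>x. x"] by (simp add: add_ac)
    ultimately have "(S - {s}, s + m) \<in> koszul_basis a b (p - 1) (q + 1)"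
      "bidegree (S - {s}, s + m) = u"
      using *(1) by (auto simp: koszul_basis_def bidegree_def)
    then show ?thesis by (auto simp: koszul_space_def)
  qed
  then show ?thesis
    unfolding koszul_diff_def
    by (auto intro!: pm.subspace_sum[OF W] pm.subspace_scale[OF W])
qed

lemma syzygy_boundaries_subset: "syzygy_boundaries a b p q u \<subseteq> syzygy_cycles a b p q u"
  using koszul_diff_space[of _ a b "p + 1" "q - 1" u]
  by (auto simp: syzygy_boundaries_def syzygy_cycles_def koszul_diff_diff)

text \<open>
  The dimension of \<open>(K\<^bsub>p,q\<^esub>)\<^sub>u\<close>. The differential preserves the bidegree, so this space is the
  homology of the strand of bidegree \<open>u\<close> of the Koszul complex.
\<close>

definition syzygy_dim ::
    "'k::field itself \<Rightarrow> int \<Rightarrow> int \<Rightarrow> int \<Rightarrow> int \<Rightarrow> int \<times> int \<Rightarrow> nat" where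
  "syzygy_dim _ a b p q u = pm.quotient_dim
     (syzygy_cycles a b p q u :: (tensor \<Rightarrow>\<^sub>0 'k) set) (syzygy_boundaries a b p q u)"

end

theory Submission
  imports Defs "HOL-Library.Multiset"
begin

text \<open>
  Replacing a set \<open>S\<close> of points of the grid by its complement, with \<open>a + 2\<close> points in the middle
  of the complex, turns a cycle into an alternating function \<open>f\<close> on lists of points which is closed
  under the simplicial coboundary and which is supported on lists whose sum lies in the window
  \<open>w + [0, a] \<times> [0, a]\<close>; it turns a boundary into a coboundary of a function supported on lists
  with sum \<open>w\<close>. A closed function is determined by its values on lists of \<open>a + 1\<close> differences of
  points, and these values vanish unless \<open>w\<close> is in the range of the possible sums.

  The window in the second coordinate shows that the value of \<open>f\<close> on a horizontal edge of length
  \<open>a\<close> and on \<open>a\<close> unit vertical edges does not change when one of the vertical edges moves to the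
  next column and another one moves back. For \<open>a \<ge> 3\<close> all these values therefore agree up to sign
  with a single one, and they vanish unless the vertical edges occupy each height once, that is,
  unless \<open>w\<close> lies on a certain horizontal line. If these values vanish, and also those with the
  coordinates exchanged, then \<open>f\<close> is a coboundary of the required kind. Conversely, the two scrolls
  swept out by the rows and by the columns provide cycles on which the two values are nonzero.
\<close>

section \<open>Alternating functions and their coboundary\<close>

text \<open>The potential is forced. If \<open>f\<close> is the coboundary of \<open>g\<close> and
  \<open>g\<close> lives on lists with sum \<open>w\<close>, take a list \<open>T\<close> with sum
  \<open>w\<close> and a grid point \<open>q\<close> not in \<open>T\<close>: all terms of the
  coboundary at \<open>q # T\<close> other than \<open>g T\<close> have a wrong sum, so
  \<open>f (q # T) = g T\<close>. The obstacle is therefore to show that \<open>f (q # T)\<close>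
  does not depend on \<open>q\<close>. This is hardest when \<open>T\<close> meets every column,
  since then \<open>q\<close> has no free column to slide in.

  The bound a >= 3 serves two purposes. The column sums allowed beside a long edge fill an open
  interval with a - 1 integers, and moving vertical edges one at a time needs at least two of them.
  The comparison of points above and below a point of \<open>T\<close> needs an inner row that is
  met at most once.

  On edges the windows become sharp: closedness lets the base point of a list of differences sit at
  either end of the grid, and this shrinks a window of width a to the single value
  \<open>w\<close>.\<close>

definition alternating :: "('x list \<Rightarrow> 'k::field) \<Rightarrow> bool" where
  "alternating f \<longleftrightarrow> (\<forall>xs x ys. f (xs @ x # x # ys) = 0) \<and>
     (\<forall>xs x y ys. f (xs @ x # y # ys) = - f (xs @ y # x # ys))"

text \<open>The first premise is separate because in characteristic 2 the sign rule alone does not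
  force it.\<close>

lemma alternatingI:
  assumes "\<And>xs x ys. f (xs @ x # x # ys) = 0"
    and "\<And>xs x y ys. f (xs @ x # y # ys) = - f (xs @ y # x # ys)"
  shows "alternating f"
  using assms unfolding alternating_def by blast

lemma alternating_eq_0: "alternating f \<Longrightarrow> f (xs @ x # x # ys) = 0"
  by (simp add: alternating_def)

lemma alternating_swap: "alternating f \<Longrightarrow> f (xs @ x # y # ys) = - f (xs @ y # x # ys)"
  unfolding alternating_def by blast

lemma alternating_append: "alternating f \<Longrightarrow> alternating (\<lambda>ys. f (xs @ ys))"
  unfolding alternating_def by (metis append.assoc)

lemma alternating_Cons: "alternating f \<Longrightarrow> alternating (\<lambda>ys. f (x # ys))"
  using alternating_append[of f "[x]"] by simp

lemma alternating_diff:
  assumes f: "alternating f" and g: "alternating g"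
  shows "alternating (\<lambda>xs. f xs - g xs)"
proof (rule alternatingI)
  show "f (xs @ x # x # ys) - g (xs @ x # x # ys) = 0" for xs x ys
    by (simp add: alternating_eq_0[OF f] alternating_eq_0[OF g])
  show "f (xs @ x # y # ys) - g (xs @ x # y # ys) =
      - (f (xs @ y # x # ys) - g (xs @ y # x # ys))" for xs x y ys
    using alternating_swap[OF f, of xs x y ys] alternating_swap[OF g, of xs x y ys] by simp
qed

lemma alternating_to_front:
  "alternating f \<Longrightarrow> f (xs @ x # ys) = (- 1) ^ length xs * f (x # xs @ ys)"
proof (induction xs arbitrary: ys rule: rev_induct)
  case (snoc z zs)
  have "f ((zs @ [z]) @ x # ys) = - f (zs @ x # z # ys)"
    using alternating_swap[OF snoc.prems, of zs z x ys] by simp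
  then show ?case using snoc.IH[OF snoc.prems, of "z # ys"] by simp
qed simp

lemma alternating_repeat:
  assumes "alternating f" "x \<in> set xs"
  shows "f (x # xs) = 0"
proof -
  obtain as bs where "xs = as @ x # bs" using assms(2) by (meson split_list)
  then show ?thesis
    using alternating_to_front[OF alternating_Cons[OF assms(1), of x], of as x bs]
      alternating_eq_0[OF assms(1), of "[]" x "as @ bs"] by simp
qed

lemma alternating_not_distinct: "alternating f \<Longrightarrow> \<not> distinct xs \<Longrightarrow> f xs = 0"
proof (induction xs arbitrary: f)
  case (Cons x xs)
  then show ?case using alternating_repeat[of f x xs] alternating_Cons[of f x] by auto
qed simp

text \<open>The sign is chosen before \<open>f\<close>, so that several alternating functions can be
  compared along the same permutation.\<close>

lemma alternating_permute:
  assumes "mset xs = mset ys"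
  shows "\<exists>s::'k::field. s * s = 1 \<and> (\<forall>f. alternating f \<longrightarrow> f xs = s * f ys)"
  using assms
proof (induction xs arbitrary: ys)
  case Nil
  then show ?case by (intro exI[of _ 1]) simp
next
  case (Cons x xs)
  have "x \<in> set ys" using mset_eq_setD[OF Cons.prems] by auto
  then obtain as bs where ys: "ys = as @ x # bs" by (meson split_list)
  then have "mset xs = mset (as @ bs)" using Cons.prems by simp
  then obtain s :: 'k where s: "s * s = 1" "\<And>f. alternating f \<Longrightarrow> f xs = s * f (as @ bs)"
    using Cons.IH by blast
  define e :: 'k where "e = (- 1) ^ length as"
  have e: "e * e = 1" unfolding e_def by (simp flip: power_add)
  have "f (x # xs) = s * e * f ys" if f: "alternating f" for f
  proof -
    have "f (x # xs) = s * (e * e) * f (x # as @ bs)"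
      using s(2)[OF alternating_Cons[OF f, of x]] e by simp
    also have "\<dots> = s * e * f ys"
      using alternating_to_front[OF f, of as x bs] by (simp add: ys e_def mult.assoc)
    finally show ?thesis .
  qed
  moreover have "s * e * (s * e) = (s * s) * (e * e)" by (simp only: mult_ac)
  ultimately show ?case using s(1) e by (intro exI[of _ "s * e"]) simp
qed

lemma alternating_permute_0:
  assumes "alternating (f :: 'x list \<Rightarrow> 'k::field)" "mset xs = mset ys" "f ys = 0"
  shows "f xs = 0"
  using alternating_permute[OF assms(2), where 'k = 'k] assms by auto

text \<open>The sum over l of (-1)^l times the value of \<open>f\<close> with entry l deleted,
  counted from 0; on the empty list it is the empty sum.\<close>

fun cobd :: "('x list \<Rightarrow> 'k::field) \<Rightarrow> 'x list \<Rightarrow> 'k" where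
  "cobd f [] = 0"
| "cobd f (x # xs) = f xs - cobd (\<lambda>ys. f (x # ys)) xs"

lemma cobd_cong:
  assumes "\<And>ys. set ys \<subseteq> set xs \<Longrightarrow> Suc (length ys) = length xs \<Longrightarrow> f ys = g ys"
  shows "cobd f xs = cobd g xs"
  using assms
proof (induction xs arbitrary: f g)
  case (Cons x xs)
  have "cobd (\<lambda>ys. f (x # ys)) xs = cobd (\<lambda>ys. g (x # ys)) xs"
    by (rule Cons.IH) (rule Cons.prems, auto)
  moreover have "f xs = g xs" by (rule Cons.prems) auto
  ultimately show ?case by simp
qed simp

lemma cobd_0 [simp]: "cobd (\<lambda>_. 0) xs = 0"
  by (induction xs) auto

lemma cobd_diff: "cobd (\<lambda>ys. f ys - g ys) xs = cobd f xs - cobd g xs"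
  by (induction xs arbitrary: f g) auto

lemma cobd_uminus: "cobd (\<lambda>ys. - f ys) xs = - cobd f xs"
  by (induction xs arbitrary: f) auto

lemma cobd_cobd: "cobd (cobd f) xs = 0"
proof (induction xs arbitrary: f)
  case (Cons x xs)
  have "(\<lambda>ys. cobd f (x # ys)) = (\<lambda>ys. f ys - cobd (\<lambda>ys. f (x # ys)) ys)" by simp
  then show ?case using Cons.IH[of "\<lambda>ys. f (x # ys)"] by (simp add: cobd_diff)
qed simp

lemma alternating_cobd:
  assumes "alternating f"
  shows "alternating (cobd f)"
proof (rule alternatingI)
  show "cobd f (xs @ x # x # ys) = 0" for xs x ys
    using assms
  proof (induction xs arbitrary: f)
    case Nil
    then have "(\<lambda>zs. f (x # x # zs)) = (\<lambda>_. 0)"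
      using alternating_eq_0[of f "[]" x] by auto
    then show ?case by simp
  next
    case (Cons z zs)
    then show ?case using alternating_eq_0[of f zs x ys] by (simp add: alternating_Cons)
  qed
  show "cobd f (xs @ x # y # ys) = - cobd f (xs @ y # x # ys)" for xs x y ys
    using assms
  proof (induction xs arbitrary: f)
    case Nil
    then have "(\<lambda>zs. f (x # y # zs)) = (\<lambda>zs. - f (y # x # zs))"
      using alternating_swap[of f "[]" x y] by auto
    then have "cobd (\<lambda>zs. f (x # y # zs)) ys = - cobd (\<lambda>zs. f (y # x # zs)) ys"
      by (simp add: cobd_uminus)
    then show ?case by simp
  next
    case (Cons z zs)
    then show ?case
      using alternating_swap[of f zs x y ys] Cons.IH[of "\<lambda>ys. f (z # ys)"]
      by (simp add: alternating_Cons)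
  qed
qed

text \<open>
  A pair \<open>(p, q)\<close> of vertices stands for the vector \<open>v\<^sub>q - v\<^sub>p\<close>, and \<open>on_edges f\<close> is the
  multilinear extension of \<open>f\<close> to such vectors.
\<close>

fun on_edges :: "('x list \<Rightarrow> 'k::field) \<Rightarrow> ('x \<times> 'x) list \<Rightarrow> 'k" where
  "on_edges f [] = f []"
| "on_edges f ((p, q) # es) = on_edges (\<lambda>ts. f (q # ts) - f (p # ts)) es"

definition endpoint :: "'x \<Rightarrow> 'x \<times> 'x \<Rightarrow> bool" where
  "endpoint t e \<longleftrightarrow> t = fst e \<or> t = snd e"

lemma endpoint_fst [simp]: "endpoint p (p, q)" and endpoint_snd [simp]: "endpoint q (p, q)"
  by (simp_all add: endpoint_def)

lemma on_edges_cong: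
  assumes "\<And>ts. list_all2 endpoint ts es \<Longrightarrow> f ts = g ts"
  shows "on_edges f es = on_edges g es"
  using assms
proof (induction es arbitrary: f g)
  case (Cons e es)
  obtain p q where e: "e = (p, q)" by fastforce
  have "f (q # ts) - f (p # ts) = g (q # ts) - g (p # ts)" if "list_all2 endpoint ts es" for ts
  proof -
    have "f (q # ts) = g (q # ts)" "f (p # ts) = g (p # ts)"
      using that by (auto intro: Cons.prems simp: e)
    then show ?thesis by simp
  qed
  then show ?case unfolding e on_edges.simps by (rule Cons.IH)
qed simp

lemma on_edges_0 [simp]: "on_edges (\<lambda>_. 0) es = 0"
  by (induction es) auto

lemma on_edges_diff: "on_edges (\<lambda>ts. f ts - g ts) es = on_edges f es - on_edges g es"
proof (induction es arbitrary: f g)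
  case (Cons e es)
  obtain p q where e: "e = (p, q)" by fastforce
  show ?case
    using Cons.IH[of "\<lambda>ts. f (q # ts) - f (p # ts)" "\<lambda>ts. g (q # ts) - g (p # ts)"]
    by (simp add: e algebra_simps)
qed simp

lemma on_edges_uminus: "on_edges (\<lambda>ts. - f ts) es = - on_edges f es"
  using on_edges_diff[of "\<lambda>_. 0" f es] by simp

lemma on_edges_add: "on_edges (\<lambda>ts. f ts + g ts) es = on_edges f es + on_edges g es"
  using on_edges_diff[of f "\<lambda>ts. - g ts" es] by (simp add: on_edges_uminus)

lemma on_edges_scale: "on_edges (\<lambda>ts. c * f ts) es = c * on_edges f es"
proof (induction es arbitrary: f)
  case (Cons e es)
  then show ?case
    by (cases e) (simp flip: right_diff_distrib)
qed simp

lemma on_edges_Cons: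
  "on_edges f ((p, q) # es) = on_edges (\<lambda>ts. f (q # ts)) es - on_edges (\<lambda>ts. f (p # ts)) es"
  by (simp add: on_edges_diff)

lemma on_edges_append:
  "on_edges f (es @ es') = on_edges (\<lambda>ts. on_edges (\<lambda>ts'. f (ts @ ts')) es') es"
  by (induction f es rule: on_edges.induct) (simp_all add: on_edges_diff)

lemma on_edges_split:
  "on_edges f (xs @ (p, r) # ys) = on_edges f (xs @ (p, q) # ys) + on_edges f (xs @ (q, r) # ys)"
  by (simp add: on_edges_append on_edges_Cons on_edges_diff del: on_edges.simps(2))

lemma alternating_on_edges:
  assumes "alternating f"
  shows "alternating (on_edges f)"
proof (rule alternatingI)
  have z: "f (p # p # ts) = 0" if "alternating f" for f :: "'a list \<Rightarrow> 'b" and p ts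
    using alternating_eq_0[OF that, of "[]"] by simp
  have sw: "f (p # q # ts) = - f (q # p # ts)"
    if "alternating f" for f :: "'a list \<Rightarrow> 'b" and p q ts
    using alternating_swap[OF that, of "[]" p q ts] by simp
  have step: "alternating (\<lambda>ts. f (q # ts) - f (p # ts))"
    if "alternating f" for f :: "'a list \<Rightarrow> 'b" and p q
    using that by (intro alternating_diff alternating_Cons)
  show "on_edges f (xs @ e # e # ys) = 0" for xs e ys
    using assms
  proof (induction xs arbitrary: f)
    case Nil
    obtain p q where e: "e = (p, q)" by fastforce
    have "(\<lambda>ts. f (q # q # ts) - f (p # q # ts) - (f (q # p # ts) - f (p # p # ts))) = (\<lambda>_. 0)"
      by (simp add: z[OF Nil] sw[OF Nil, of q p])
    then show ?case by (simp add: e)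
  next
    case (Cons e' xs)
    then show ?case by (cases e') (simp add: step)
  qed
  show "on_edges f (xs @ e # e' # ys) = - on_edges f (xs @ e' # e # ys)" for xs e e' ys
    using assms
  proof (induction xs arbitrary: f)
    case Nil
    obtain p q p' q' where e: "e = (p, q)" "e' = (p', q')" by fastforce
    have "(\<lambda>ts. f (q # q' # ts) - f (p # q' # ts) - (f (q # p' # ts) - f (p # p' # ts))) =
      (\<lambda>ts. - (f (q' # q # ts) - f (p' # q # ts) - (f (q' # p # ts) - f (p' # p # ts))))"
      by (rule ext) (simp only: sw[OF Nil, of q q'] sw[OF Nil, of p q'] sw[OF Nil, of q p']
        sw[OF Nil, of p p'], simp)
    then show ?case by (simp only: e append_Nil on_edges.simps on_edges_uminus)
  next
    case (Cons e'' xs)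
    then show ?case by (cases e'') (simp add: step)
  qed
qed

text \<open>\<open>cobd f\<close> is the wedge product of \<open>f\<close> with the functional that
  adds up the coefficients of the vertices, and this functional is 0 on differences of
  vertices.\<close>

lemma on_edges_cobd: "on_edges (cobd f) es = 0"
proof (induction es arbitrary: f)
  case (Cons e es)
  obtain p q where e: "e = (p, q)" by fastforce
  have "on_edges (cobd f) (e # es) =
      on_edges (\<lambda>ts. - (cobd (\<lambda>ys. f (q # ys)) ts) - - (cobd (\<lambda>ys. f (p # ys)) ts)) es"
    by (simp add: e algebra_simps)
  also have "\<dots> = 0"
    using Cons.IH by (subst on_edges_diff) (simp add: on_edges_uminus)
  finally show ?case .
qed simp

fun path_edges :: "'x \<Rightarrow> 'x list \<Rightarrow> ('x \<times> 'x) list" where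
  "path_edges p [] = []"
| "path_edges p (q # qs) = (p, q) # path_edges q qs"

text \<open>Subtracting from each vertex its predecessor only adds terms that repeat a
  vertex.\<close>

lemma on_edges_path:
  assumes "alternating f"
  shows "on_edges (\<lambda>ts. f (p # ps @ ts)) es = on_edges (\<lambda>ts. f (p # ts)) (path_edges p ps @ es)"
  using assms
proof (induction ps arbitrary: f p)
  case (Cons q ps)
  have "f (p # p # ts) = 0" for ts using alternating_eq_0[OF Cons.prems, of "[]"] by simp
  then show ?case using Cons.IH[OF alternating_Cons[OF Cons.prems], of p q] by simp
qed simp

lemma length_path_edges [simp]: "length (path_edges p ps) = length ps"
  by (induction ps arbitrary: p) auto

lemma path_edges_append: "path_edges p (ps @ q # qs) = path_edges p ps @ (last (p # ps), q) # path_edges q qs"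
  by (induction ps arbitrary: p) auto

lemma set_path_edges: "set (path_edges p ps) \<subseteq> set (p # ps) \<times> set (p # ps)"
  by (induction ps arbitrary: p) auto

section \<open>Strands of the Koszul complex\<close>

type_synonym pt = "int \<times> int"

definition grid :: "nat \<Rightarrow> pt set" where
  "grid a = {0..int a} \<times> {0..int a}"

lemma mem_grid [simp]:
  "(i, j) \<in> grid a \<longleftrightarrow> 0 \<le> i \<and> i \<le> int a \<and> 0 \<le> j \<and> j \<le> int a"
  by (auto simp: grid_def)

lemma grid_bounds:
  "p \<in> grid a \<Longrightarrow> 0 \<le> fst p \<and> fst p \<le> int a \<and> 0 \<le> snd p \<and> snd p \<le> int a"
  by (auto simp: grid_def)

definition sum1 :: "pt list \<Rightarrow> int" where "sum1 ts = sum_list (map fst ts)"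
definition sum2 :: "pt list \<Rightarrow> int" where "sum2 ts = sum_list (map snd ts)"

lemma sum1_simps [simp]: "sum1 [] = 0" "sum1 (t # ts) = fst t + sum1 ts"
    "sum1 (ts @ ts') = sum1 ts + sum1 ts'"
  and sum2_simps [simp]: "sum2 [] = 0" "sum2 (t # ts) = snd t + sum2 ts"
    "sum2 (ts @ ts') = sum2 ts + sum2 ts'"
  by (simp_all add: sum1_def sum2_def)

definition lo1 :: "pt \<times> pt \<Rightarrow> int" where "lo1 e = min (fst (fst e)) (fst (snd e))"
definition hi1 :: "pt \<times> pt \<Rightarrow> int" where "hi1 e = max (fst (fst e)) (fst (snd e))"
definition lo2 :: "pt \<times> pt \<Rightarrow> int" where "lo2 e = min (snd (fst e)) (snd (snd e))"
definition hi2 :: "pt \<times> pt \<Rightarrow> int" where "hi2 e = max (snd (fst e)) (snd (snd e))"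

abbreviation Lo1 where "Lo1 es \<equiv> sum_list (map lo1 es)"
abbreviation Hi1 where "Hi1 es \<equiv> sum_list (map hi1 es)"
abbreviation Lo2 where "Lo2 es \<equiv> sum_list (map lo2 es)"
abbreviation Hi2 where "Hi2 es \<equiv> sum_list (map hi2 es)"

lemma endpoints_bounds:
  assumes "list_all2 endpoint ts es"
  shows "Lo1 es \<le> sum1 ts" "sum1 ts \<le> Hi1 es" "Lo2 es \<le> sum2 ts" "sum2 ts \<le> Hi2 es"
proof -
  have "Lo1 es \<le> sum1 ts \<and> sum1 ts \<le> Hi1 es \<and> Lo2 es \<le> sum2 ts \<and> sum2 ts \<le> Hi2 es"
    using assms
  proof (induction rule: list_all2_induct)
    case (Cons t ts e es)
    then show ?case by (auto simp: endpoint_def lo1_def hi1_def lo2_def hi2_def)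
  qed simp
  then show "Lo1 es \<le> sum1 ts" "sum1 ts \<le> Hi1 es" "Lo2 es \<le> sum2 ts" "sum2 ts \<le> Hi2 es"
    by auto
qed

lemma endpoints_subset:
  assumes "list_all2 endpoint ts es" "set es \<subseteq> A \<times> A"
  shows "set ts \<subseteq> A"
  using assms by (induction rule: list_all2_induct) (auto simp: endpoint_def)

definition vertical :: "pt \<times> pt \<Rightarrow> bool" where
  "vertical e \<longleftrightarrow> fst (fst e) = fst (snd e)"

definition unit_vertical :: "pt \<times> pt \<Rightarrow> bool" where
  "unit_vertical e \<longleftrightarrow> fst (fst e) = fst (snd e) \<and> snd (snd e) = snd (fst e) + 1"

definition horizontal :: "pt \<times> pt \<Rightarrow> bool" where
  "horizontal e \<longleftrightarrow> snd (fst e) = snd (snd e)"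

text \<open>
  Every edge is a sum of unit vertical edges and of a horizontal one, all of which stay within
  the range of columns of the given edge.
\<close>

definition piece :: "nat \<Rightarrow> pt \<times> pt \<Rightarrow> pt \<times> pt \<Rightarrow> bool" where
  "piece a e' e \<longleftrightarrow> e' \<in> grid a \<times> grid a \<and> (unit_vertical e' \<or> horizontal e') \<and>
     lo1 e \<le> lo1 e' \<and> hi1 e' \<le> hi1 e"

lemma additive_column_0:
  fixes \<phi> :: "pt \<Rightarrow> pt \<Rightarrow> 'k::field"
  assumes add: "\<And>p q r. \<phi> p r = \<phi> p q + \<phi> q r"
    and unit: "\<And>j. 0 \<le> j \<Longrightarrow> j < int a \<Longrightarrow> \<phi> (i, j) (i, j + 1) = 0"
    and "0 \<le> j" "j \<le> int a" "0 \<le> j'" "j' \<le> int a"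
  shows "\<phi> (i, j) (i, j') = 0"
proof -
  have base: "\<phi> (i, 0) (i, int m) = 0" if "int m \<le> int a" for m
    using that
  proof (induction m)
    case 0
    show ?case using add[of "(i, 0)" "(i, 0)" "(i, 0)"] unfolding of_nat_0
      by (metis add_cancel_right_right)
  next
    case (Suc m)
    then show ?case using add[of "(i, 0)" "(i, int (Suc m))" "(i, int m)"] unit[of "int m"]
      by (simp add: add.commute)
  qed
  have "\<phi> (i, 0) (i, j) = 0" "\<phi> (i, 0) (i, j') = 0"
    using base[of "nat j"] base[of "nat j'"] assms by auto
  then show ?thesis using add[of "(i, 0)" "(i, j')" "(i, j)"] by simp
qed

lemma on_edges_pieces_0:
  assumes es: "set es \<subseteq> grid a \<times> grid a"
    and pieces: "\<And>es'. list_all2 (piece a) es' es \<Longrightarrow> on_edges f (xs @ es') = 0"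
  shows "on_edges f (xs @ es) = 0"
  using assms
proof (induction es arbitrary: xs)
  case (Cons e es)
  obtain i j i' j' where e: "e = ((i, j), (i', j'))" by (metis surj_pair)
  have ij: "0 \<le> i" "i \<le> int a" "0 \<le> j" "j \<le> int a"
    "0 \<le> i'" "i' \<le> int a" "0 \<le> j'" "j' \<le> int a"
    using Cons.prems(1) by (auto simp: e)
  have IH: "on_edges f (xs @ e' # es) = 0" if e': "piece a e' e" for e'
  proof -
    have "on_edges f ((xs @ [e']) @ es) = 0"
      using Cons.prems e' by (intro Cons.IH) (auto dest: Cons.prems(2)[of "e' # _"])
    then show ?thesis by simp
  qed
  define \<phi> where "\<phi> p q = on_edges f (xs @ (p, q) # es)" for p q
  have add: "\<phi> p r = \<phi> p q + \<phi> q r" for p q r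
    unfolding \<phi>_def by (rule on_edges_split)
  have "\<phi> (i, j) (i, j') = 0"
  proof (rule additive_column_0[of \<phi>, OF add])
    show "\<phi> (i, k) (i, k + 1) = 0" if "0 \<le> k" "k < int a" for k
      unfolding \<phi>_def using that ij
      by (intro IH) (auto simp: piece_def e unit_vertical_def lo1_def hi1_def)
  qed (use ij in auto)
  moreover have "\<phi> (i, j') (i', j') = 0"
    unfolding \<phi>_def using ij
    by (intro IH) (auto simp: piece_def e horizontal_def lo1_def hi1_def)
  ultimately show ?case using add[of "(i, j)" "(i', j')" "(i, j')"] by (simp add: \<phi>_def e)
qed (use assms in auto)

lemma pieces_bounds:
  assumes "list_all2 (piece a) es' es"
  shows "Lo1 es \<le> Lo1 es'" "Hi1 es' \<le> Hi1 es" "set es' \<subseteq> grid a \<times> grid a"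
    "\<forall>e\<in>set es'. unit_vertical e \<or> horizontal e"
proof -
  have "Lo1 es \<le> Lo1 es' \<and> Hi1 es' \<le> Hi1 es \<and> set es' \<subseteq> grid a \<times> grid a \<and>
    (\<forall>e\<in>set es'. unit_vertical e \<or> horizontal e)"
    using assms by (induction rule: list_all2_induct) (auto simp: piece_def)
  then show "Lo1 es \<le> Lo1 es'" "Hi1 es' \<le> Hi1 es" "set es' \<subseteq> grid a \<times> grid a"
    "\<forall>e\<in>set es'. unit_vertical e \<or> horizontal e" by auto
qed

section \<open>The form on edges and its windows\<close>

definition edge_form :: "(pt list \<Rightarrow> 'k::field) \<Rightarrow> (pt \<times> pt) list \<Rightarrow> 'k" where
  "edge_form f es = on_edges (\<lambda>ts. f ((0, 0) # ts)) es"

definition long_edge :: "nat \<Rightarrow> int \<Rightarrow> pt \<times> pt" where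
  "long_edge a y = ((0, y), (int a, y))"

text \<open>The two strict bounds are those under which the long edge may change its row at no cost
  (\<open>long_edge_row\<close>) and under which coboundaries of the required kind are invisible
  (\<open>long_edge_form_0\<close>).\<close>

definition long_edge_free :: "nat \<Rightarrow> int \<Rightarrow> (pt list \<Rightarrow> 'k::field) \<Rightarrow> bool" where
  "long_edge_free a w f \<longleftrightarrow> (\<forall>es. set es \<subseteq> grid a \<times> grid a \<longrightarrow> length es = a \<longrightarrow>
     w - int a < Lo1 es \<longrightarrow> Hi1 es < w \<longrightarrow> (\<forall>e\<in>set es. unit_vertical e) \<longrightarrow>
     edge_form f (long_edge a 0 # es) = 0)"

locale strand =
  fixes a :: nat and w1 w2 :: int and f :: "pt list \<Rightarrow> 'k::field"
  assumes a: "a \<ge> 3"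
    and alt: "alternating f"
    and closed: "set ts \<subseteq> grid a \<Longrightarrow> cobd f ts = 0"
    and window: "set ts \<subseteq> grid a \<Longrightarrow> f ts \<noteq> 0 \<Longrightarrow>
      length ts = a + 2 \<and> sum1 ts - w1 \<in> {0..int a} \<and> sum2 ts - w2 \<in> {0..int a}"
begin

abbreviation F :: "(pt \<times> pt) list \<Rightarrow> 'k" where
  "F \<equiv> edge_form f"

lemma alternating_F: "alternating F"
  unfolding edge_form_def by (intro alternating_on_edges alternating_Cons alt)

lemma F_split: "F (xs @ (p, r) # ys) = F (xs @ (p, q) # ys) + F (xs @ (q, r) # ys)"
  unfolding edge_form_def by (rule on_edges_split)

text \<open>On lists in the grid a closed \<open>f\<close> is the coboundary of its contraction with
  the point (0, 0), as for a cone.\<close>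

lemma on_edges_f_0:
  assumes "set es \<subseteq> grid a \<times> grid a"
  shows "on_edges f es = 0"
proof -
  have "on_edges f es = on_edges (cobd (\<lambda>ts. f ((0, 0) # ts))) es"
  proof (rule on_edges_cong)
    fix ts assume "list_all2 endpoint ts es"
    then have "set ((0, 0) # ts) \<subseteq> grid a" using endpoints_subset assms by auto
    from closed[OF this] show "f ts = cobd (\<lambda>ts. f ((0, 0) # ts)) ts" by simp
  qed
  then show ?thesis by (simp add: on_edges_cobd)
qed

text \<open>Two base points differ by one more edge, and \<open>f\<close> vanishes on lists that
  consist of edges only.\<close>

lemma F_base:
  assumes "p \<in> grid a" "set es \<subseteq> grid a \<times> grid a"
  shows "F es = on_edges (\<lambda>ts. f (p # ts)) es"
  using on_edges_f_0[of "((0, 0), p) # es"] assms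
  by (simp add: edge_form_def on_edges_Cons del: on_edges.simps(2))

lemma F_window1:
  assumes "set es \<subseteq> grid a \<times> grid a" "Hi1 es < w1 \<or> w1 < Lo1 es"
  shows "F es = 0"
proof -
  \<comment> \<open>A base point in column 0 leaves all sums below the window, one in column a lifts
    all of them above it.\<close>
  define p :: pt where "p = (if Hi1 es < w1 then (0, 0) else (int a, 0))"
  have p: "p \<in> grid a" by (simp add: p_def)
  have "F es = on_edges (\<lambda>_. 0) es" unfolding F_base[OF p assms(1)]
  proof (rule on_edges_cong, rule ccontr)
    fix ts assume ts: "list_all2 endpoint ts es" and "f (p # ts) \<noteq> 0"
    then have "sum1 (p # ts) - w1 \<in> {0..int a}"
      using window[of "p # ts"] endpoints_subset[OF ts assms(1)] p by simp
    then show False using endpoints_bounds[OF ts] assms(2)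
      by (auto simp: p_def split: if_splits)
  qed
  then show ?thesis by simp
qed

lemma F_window2:
  assumes "set es \<subseteq> grid a \<times> grid a" "Hi2 es < w2 \<or> w2 < Lo2 es"
  shows "F es = 0"
proof -
  define p :: pt where "p = (if Hi2 es < w2 then (0, 0) else (0, int a))"
  have p: "p \<in> grid a" by (simp add: p_def)
  have "F es = on_edges (\<lambda>_. 0) es" unfolding F_base[OF p assms(1)]
  proof (rule on_edges_cong, rule ccontr)
    fix ts assume ts: "list_all2 endpoint ts es" and "f (p # ts) \<noteq> 0"
    then have "sum2 (p # ts) - w2 \<in> {0..int a}"
      using window[of "p # ts"] endpoints_subset[OF ts assms(1)] p by simp
    then show False using endpoints_bounds[OF ts] assms(2)
      by (auto simp: p_def split: if_splits)
  qed
  then show ?thesis by simp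
qed

text \<open>The two rows are joined by vertical edges in columns 0 and a. The first keeps the range
  of sums below \<open>w1\<close>, the second puts it above.\<close>

lemma long_edge_row:
  assumes es: "set es \<subseteq> grid a \<times> grid a" and x: "w1 - int a < Lo1 es" "Hi1 es < w1"
    and y: "0 \<le> y" "y \<le> int a"
  shows "F (long_edge a y # es) = F (long_edge a 0 # es)"
proof -
  have "F (((0, y), (0, 0)) # es) = 0" "F (((int a, 0), (int a, y)) # es) = 0"
    by (rule F_window1; use es x y in \<open>simp add: lo1_def hi1_def\<close>)+
  then show ?thesis
    using F_split[of "[]" "(0, y)" "(int a, y)" es "(0, 0)"]
      F_split[of "[]" "(0, 0)" "(int a, y)" es "(int a, 0)"]
    by (simp add: long_edge_def)
qed

text \<open>The upper bound is read off with the long edge in row 0, the lower one with the long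
  edge in row a. Together they force the other edges to span a total height of at least a.\<close>

lemma F_long_edge_window2:
  assumes es: "set es \<subseteq> grid a \<times> grid a" and x: "w1 - int a < Lo1 es" "Hi1 es < w1"
    and nz: "F (long_edge a 0 # es) \<noteq> 0"
  shows "Lo2 es + int a \<le> w2" "w2 \<le> Hi2 es"
proof -
  have "w2 \<le> Hi2 (long_edge a 0 # es)"
    by (rule ccontr) (use nz F_window2[of "long_edge a 0 # es"] es in \<open>auto simp: long_edge_def\<close>)
  then show "w2 \<le> Hi2 es" by (simp add: long_edge_def hi2_def)
  have nz: "F (long_edge a (int a) # es) \<noteq> 0" using long_edge_row[OF es x, of "int a"] nz by simp
  have "Lo2 (long_edge a (int a) # es) \<le> w2"
    by (rule ccontr)
      (use nz F_window2[of "long_edge a (int a) # es"] es in \<open>auto simp: long_edge_def\<close>)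
  then show "Lo2 es + int a \<le> w2" by (simp add: long_edge_def lo2_def)
qed

lemma spread_units:
  assumes "\<forall>e\<in>set es. unit_vertical e \<or> horizontal e"
  shows "Hi2 es \<le> Lo2 es + int (length es)"
    "\<exists>e\<in>set es. horizontal e \<Longrightarrow> Hi2 es < Lo2 es + int (length es)"
proof -
  have "Hi2 es \<le> Lo2 es + int (length es) \<and>
    ((\<exists>e\<in>set es. horizontal e) \<longrightarrow> Hi2 es < Lo2 es + int (length es))"
    using assms
    by (induction es) (auto simp: unit_vertical_def horizontal_def lo2_def hi2_def)
  then show "Hi2 es \<le> Lo2 es + int (length es)"
    "\<exists>e\<in>set es. horizontal e \<Longrightarrow> Hi2 es < Lo2 es + int (length es)" by auto
qed

text \<open>Of the a edges each has height at most 1 and one has height 0, so they cannot span the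
  height a.\<close>

lemma F_long_edge_horizontal:
  assumes es: "set es \<subseteq> grid a \<times> grid a" "length es = a" "w1 - int a < Lo1 es" "Hi1 es < w1"
    and "\<forall>e\<in>set es. unit_vertical e \<or> horizontal e" "\<exists>e\<in>set es. horizontal e"
  shows "F (long_edge a 0 # es) = 0"
  using F_long_edge_window2[OF es(1,3,4)] spread_units(2)[OF assms(5,6)] es(2)
  by (rule_tac ccontr) auto

lemma F_long_edge_0:
  assumes "long_edge_free a w1 f"
    and es: "set es \<subseteq> grid a \<times> grid a" "length es = a" "w1 - int a < Lo1 es" "Hi1 es < w1"
  shows "F (long_edge a 0 # es) = 0"
proof -
  have "on_edges (\<lambda>ts. f ((0, 0) # ts)) ([long_edge a 0] @ es) = 0"
  proof (rule on_edges_pieces_0[OF es(1)])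
    fix es' assume es': "list_all2 (piece a) es' es"
    note b = pieces_bounds[OF es']
    have l: "length es' = a" using es' es(2) list_all2_lengthD by metis
    have "F (long_edge a 0 # es') = 0"
    proof (cases "\<exists>e\<in>set es'. horizontal e")
      case True
      show ?thesis by (rule F_long_edge_horizontal) (use b l True es in auto)
    next
      case False
      then have "\<forall>e\<in>set es'. unit_vertical e" using b(4) by auto
      then show ?thesis using assms(1) b l es unfolding long_edge_free_def by auto
    qed
    then show "on_edges (\<lambda>ts. f ((0, 0) # ts)) ([long_edge a 0] @ es') = 0" by (simp add: edge_form_def)
  qed
  then show ?thesis by (simp add: edge_form_def)
qed

end

section \<open>Vanishing in the absence of long edges\<close>

lemma alternating_append_right: "alternating f \<Longrightarrow> alternating (\<lambda>xs. f (xs @ ys))"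
  unfolding alternating_def by (metis append.assoc append_Cons)

lemma cobd_map: "cobd (\<lambda>ts. f (map h ts)) ts = cobd f (map h ts)"
  by (induction ts arbitrary: f) auto

lemma on_edges_map: "on_edges (\<lambda>ts. f (map h ts)) es = on_edges f (map (map_prod h h) es)"
proof (induction es arbitrary: f)
  case (Cons e es)
  show ?case
    using Cons.IH[of "\<lambda>ts. f (h (snd e) # ts) - f (h (fst e) # ts)"] by (cases e) simp
qed simp

text \<open>Along a sorted path the left ends are all points but the last, the right ends all points
  but the first.\<close>

lemma sorted_path_bounds:
  assumes "sorted (map fst (p # ps))"
  shows "Lo1 (path_edges p ps) = sum1 (p # ps) - fst (last (p # ps))" "Hi1 (path_edges p ps) = sum1 ps"
proof -
  have "Lo1 (path_edges p ps) = sum1 (p # ps) - fst (last (p # ps)) \<and> Hi1 (path_edges p ps) = sum1 ps"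
    using assms by (induction ps arbitrary: p) (auto simp: lo1_def hi1_def)
  then show "Lo1 (path_edges p ps) = sum1 (p # ps) - fst (last (p # ps))"
    "Hi1 (path_edges p ps) = sum1 ps" by auto
qed

lemma vertical_bounds: "\<forall>e\<in>set D. vertical e \<Longrightarrow> Hi1 D = Lo1 D"
  by (induction D) (auto simp: vertical_def lo1_def hi1_def)

lemma vertical_endpoints:
  assumes "list_all2 endpoint ts D" "\<forall>e\<in>set D. vertical e"
  shows "map fst ts = map lo1 D"
  using assms by (induction rule: list_all2_induct) (auto simp: vertical_def lo1_def endpoint_def)

lemma additive_path_0:
  fixes \<phi> :: "pt \<Rightarrow> pt \<Rightarrow> 'k::field"
  assumes add: "\<And>p q r. \<phi> p r = \<phi> p q + \<phi> q r"
    and "\<And>p q. (p, q) \<in> set (path_edges p0 ps) \<Longrightarrow> \<phi> p q = 0"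
  shows "\<phi> p0 (last (p0 # ps)) = 0"
  using assms(2)
proof (induction ps arbitrary: p0)
  case Nil
  show ?case using add[of p0 p0 p0] by (metis add_cancel_right_right last.simps)
next
  case (Cons p ps)
  then show ?case using add[of p0 "last (p # ps)" p] by simp
qed

lemma swap_grid: "set ts \<subseteq> grid a \<Longrightarrow> set (map prod.swap ts) \<subseteq> grid a"
  by (auto simp: grid_def)

lemma sum_swap: "sum1 (map prod.swap ts) = sum2 ts" "sum2 (map prod.swap ts) = sum1 ts"
  by (simp_all add: sum1_def sum2_def comp_def)

context strand
begin

lemma strand_swap: "strand a w2 w1 (\<lambda>ts. f (map prod.swap ts))"
proof
  show "a \<ge> 3" by (rule a)
  show "alternating (\<lambda>ts. f (map prod.swap ts))"
    by (rule alternatingI)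
      (simp add: alternating_eq_0[OF alt], unfold map_append list.map, rule alternating_swap[OF alt])
  show "cobd (\<lambda>ts. f (map prod.swap ts)) ts = 0" if "set ts \<subseteq> grid a" for ts
    unfolding cobd_map by (rule closed[OF swap_grid[OF that]])
  show "length ts = a + 2 \<and> sum1 ts - w2 \<in> {0..int a} \<and> sum2 ts - w1 \<in> {0..int a}"
    if "set ts \<subseteq> grid a" "f (map prod.swap ts) \<noteq> 0" for ts
    using window[OF swap_grid[OF that(1)] that(2)] by (simp add: sum_swap)
qed

text \<open>A coboundary of a function living on first sum \<open>w1\<close> can be nonzero at a
  list only if deleting some entry restores that sum, and this entry lies in column \<open>n\<close>
  below. The proof walks through \<open>P\<close> by increasing column: the one edge that jumps over
  column \<open>n\<close> completes to a long edge.\<close>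

lemma long_edge_free_f_0:
  assumes free: "long_edge_free a w1 f"
    and P: "set P \<subseteq> grid a" and D: "set D \<subseteq> grid a \<times> grid a" "\<forall>e\<in>set D. vertical e"
    and len: "length P + length D = a + 2"
    and n: "sum1 P + Lo1 D - w1 \<notin> fst ` set P"
  shows "on_edges (\<lambda>ts. f (P @ ts)) D = 0"
proof -
  define n where "n = sum1 P + Lo1 D - w1"
  define A where "A = sort_key fst (filter (\<lambda>p. fst p < n) P)"
  define B where "B = sort_key fst (filter (\<lambda>p. \<not> fst p < n) P)"
  have m: "mset P = mset (A @ B)" by (simp add: A_def B_def)
  have A: "\<forall>p\<in>set A. fst p < n" "sorted (map fst A)" by (auto simp: A_def)
  have "n < fst p" if "p \<in> set P" "\<not> fst p < n" for p
    using that n by (metis image_eqI linorder_neqE n_def)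
  then have B: "\<forall>p\<in>set B. n < fst p" "sorted (map fst B)" by (auto simp: B_def)
  have gr: "set A \<subseteq> grid a" "set B \<subseteq> grid a" using P by (auto simp: A_def B_def)
  have "sum1 P = sum1 (A @ B)"
    unfolding sum1_def using m by (metis mset_map sum_mset_sum_list)
  then have n': "n = sum1 A + sum1 B + Lo1 D - w1" by (simp add: n_def)
  have len': "length A + length B + length D = a + 2"
    using len m by (metis mset_eq_length length_append)
  have HD: "Hi1 D = Lo1 D" by (rule vertical_bounds[OF D(2)])
  have sub: "set (path_edges p ps) \<subseteq> grid a \<times> grid a" if "set (p # ps) \<subseteq> grid a" for p ps
    using set_path_edges[of p ps] that by blast
  have conv: "on_edges (\<lambda>ts. f ((p # ps) @ ts)) D = F (path_edges p ps @ D)"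
    if "set (p # ps) \<subseteq> grid a" for p ps
    using on_edges_path[OF alt, of p ps D] F_base[of p "path_edges p ps @ D"] sub[OF that] that D(1)
    by simp
  have "on_edges (\<lambda>ts. f ((A @ B) @ ts)) D = 0"
  proof (cases "A = [] \<or> B = []")
    \<comment> \<open>All points lie on one side of column \<open>n\<close>, which puts the whole
      range of sums of the sorted path on one side of \<open>w1\<close>.\<close>
    case True
    define C where "C = A @ B"
    show ?thesis
    proof (cases C)
      case Nil
      then show ?thesis using on_edges_f_0[OF D(1)] by (simp add: C_def)
    next
      case (Cons p ps)
      have s: "sorted (map fst (p # ps))" and g: "set (p # ps) \<subseteq> grid a"
        using True A(2) B(2) gr Cons unfolding C_def by (metis append_Nil append_Nil2)+
      have "n = sum1 (p # ps) + Lo1 D - w1" using n' Cons by (auto simp: C_def simp flip: Cons)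
      moreover have "last (p # ps) \<in> set C" "p \<in> set C"
        using Cons last_in_set[of C] by simp_all
      then have "(fst (last (p # ps)) < n \<and> fst p < n) \<or> (n < fst (last (p # ps)) \<and> n < fst p)"
        using True A(1) B(1) by (auto simp: C_def simp del: last.simps)
      ultimately have "Hi1 (path_edges p ps @ D) < w1 \<or> w1 < Lo1 (path_edges p ps @ D)"
        using sorted_path_bounds[OF s] HD by (auto simp del: last.simps)
      then have "F (path_edges p ps @ D) = 0" using sub[OF g] D(1) by (intro F_window1) auto
      then show ?thesis using conv[OF g] Cons by (simp add: C_def)
    qed
  next
    case False
    then obtain p ps q qs where pq: "A = p # ps" "B = q # qs" by (meson neq_Nil_conv)
    let ?l = "last (p # ps)" and ?r = "last (q # qs)"
    define es where "es = path_edges p ps @ path_edges q qs @ D"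
    define \<phi> where "\<phi> u v = F ((u, v) # es)" for u v
    have add: "\<phi> u v = \<phi> u z + \<phi> z v" for u v z
      using F_split[of "[]" u v es z] by (simp add: \<phi>_def)
    have es: "set es \<subseteq> grid a \<times> grid a" using sub[of p ps] sub[of q qs] gr pq D(1)
      by (auto simp: es_def)
    have lr: "?l \<in> set A" "?r \<in> set B" "p \<in> set A" "q \<in> set B"
      using pq last_in_set[of A] last_in_set[of B] by simp_all
    then have gl: "?l \<in> grid a" "?r \<in> grid a" "p \<in> grid a" "q \<in> grid a" using gr by auto
    have ineq: "fst ?l < n" "fst p < n" "n < fst ?r" "n < fst q" using lr A(1) B(1) by auto
    have Lo: "Lo1 es = n + w1 - fst ?l - fst ?r" and Hi: "Hi1 es = n + w1 - fst p - fst q"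
      using sorted_path_bounds[of p ps] sorted_path_bounds[of q qs] A(2) B(2) pq n' HD
      by (simp_all add: es_def del: last.simps)
    have z: "\<phi> u v = 0" if "(u, v) \<in> set (path_edges p ps) \<or> (u, v) \<in> set (path_edges q qs)" for u v
      unfolding \<phi>_def using that by (intro alternating_repeat[OF alternating_F])
        (auto simp: es_def)
    \<comment> \<open>The jump from \<open>?l\<close> to \<open>q\<close> is the long edge minus
      four pieces. The two outer pieces fall outside the window, the two inner ones are sums of
      edges already present in \<open>es\<close>.\<close>
    have "\<phi> (0, 0) (int a, 0) = 0"
      unfolding \<phi>_def using F_long_edge_0[OF free es] Lo Hi ineq grid_bounds[OF gl(2)]
        grid_bounds[OF gl(3)] len' pq by (simp add: long_edge_def es_def del: last.simps)
    moreover have "\<phi> (0, 0) p = 0"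
      unfolding \<phi>_def by (rule F_window1)
        (use es gl Hi ineq grid_bounds[OF gl(3)] in \<open>auto simp: hi1_def\<close>)
    moreover have "\<phi> ?r (int a, 0) = 0"
      unfolding \<phi>_def by (rule F_window1)
        (use es gl Lo ineq grid_bounds[OF gl(2)] in \<open>auto simp: lo1_def\<close>)
    moreover have "\<phi> p ?l = 0" by (rule additive_path_0[OF add]) (use z in blast)
    moreover have "\<phi> q ?r = 0" by (rule additive_path_0[OF add]) (use z in blast)
    ultimately have "\<phi> ?l q = 0"
      using add[of "(0, 0)" "(int a, 0)" p] add[of p "(int a, 0)" ?l] add[of ?l "(int a, 0)" q]
        add[of q "(int a, 0)" ?r] by (simp del: last.simps)
    then have "F (path_edges p ps @ (?l, q) # path_edges q qs @ D) = 0"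
      using alternating_to_front[OF alternating_F, of "path_edges p ps"]
      by (simp add: \<phi>_def es_def del: last.simps)
    then show ?thesis
      using conv[of p "ps @ q # qs"] gr pq by (simp add: path_edges_append del: last.simps)
  qed
  moreover obtain s :: 'k where
    s: "\<And>h. alternating h \<Longrightarrow> h P = s * h (A @ B)"
    using alternating_permute[OF m, where 'k = 'k] by blast
  have "f (P @ ts) = s * f ((A @ B) @ ts)" for ts
    using s[OF alternating_append_right[OF alt]] by simp
  ultimately show ?thesis by (simp add: on_edges_scale)
qed

lemma f_append_one: "f (R @ [p]) = (- 1) ^ length R * f (p # R)"
  using alternating_to_front[OF alt, of R p "[]"] by simp

lemma f_append_two: "f (R @ [p, q]) = f (p # q # R)"
proof -
  have "f (R @ [p, q]) = (- 1) ^ length R * f ((p # R) @ [q])"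
    using alternating_to_front[OF alt, of R p "[q]"] by simp
  also have "\<dots> = (- 1) ^ length R * (- 1) ^ Suc (length R) * f (q # p # R)"
    using f_append_one[of "p # R" q] by simp
  also have "\<dots> = - f (q # p # R)"
    by (simp flip: power_add mult_2)
  also have "\<dots> = f (p # q # R)" using alternating_swap[OF alt, of "[]" q p R] by simp
  finally show ?thesis .
qed

text \<open>The single vertical edge lies in column \<open>i\<close>, which is also the critical
  column, and \<open>T\<close> avoids it.\<close>

lemma f_column_free:
  assumes "long_edge_free a w1 f" "set T \<subseteq> grid a" "length T = a + 1" "sum1 T = w1"
    and "(i, j) \<in> grid a" "(i, j') \<in> grid a" "i \<notin> fst ` set T"
  shows "f ((i, j) # T) = f ((i, j') # T)"
  using long_edge_free_f_0[of T "[((i, j), (i, j'))]"] assms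
  by (simp add: vertical_def lo1_def f_append_one)

lemma f_zero_if_column_free:
  assumes "long_edge_free a w1 f" "set T \<subseteq> grid a" "sum1 T - w1 \<notin> fst ` set T"
  shows "f T = 0"
proof (cases "length T = a + 2")
  case True
  then show ?thesis using long_edge_free_f_0[of T "[]"] assms by simp
next
  case False
  then show ?thesis using window[of T] assms by blast
qed

end

section \<open>Reduction to lists with one slanted edge\<close>

context strand
begin

definition slanted :: "(pt \<times> pt) list \<Rightarrow> nat" where
  "slanted es = length (filter (\<lambda>e. \<not> vertical e) es)"

lemma slanted_simps [simp]: "slanted [] = 0"
  "slanted (e # es) = (if vertical e then 0 else 1) + slanted es"
  "slanted (es @ es') = slanted es + slanted es'"
  by (simp_all add: slanted_def)

definition to_row :: "int \<Rightarrow> pt \<times> pt \<Rightarrow> pt \<times> pt" where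
  "to_row y e = (if vertical e then e else ((fst (fst e), y), (fst (snd e), y)))"

lemma slanted_pieces: "list_all2 (piece a) es' es \<Longrightarrow> slanted es' \<le> slanted es"
  by (induction rule: list_all2_induct) (auto simp: piece_def vertical_def lo1_def hi1_def)

text \<open>Each slanted edge opens a gap of a between the two placements, each other edge closes it
  by at most 1. Among a + 1 edges two slanted ones keep the gap positive; with only one it may close
  completely.\<close>

lemma to_row_bounds:
  assumes "\<forall>e\<in>set es. unit_vertical e \<or> horizontal e"
  shows "Hi2 (map (to_row 0) es) + int a * int (slanted es) \<le>
    Lo2 (map (to_row (int a)) es) + int (length es) - int (slanted es)"
  using assms
  by (induction es)
    (auto simp: to_row_def vertical_def unit_vertical_def horizontal_def lo2_def hi2_def
      algebra_simps)

lemma set_to_row: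
  "set es \<subseteq> grid a \<times> grid a \<Longrightarrow> 0 \<le> y \<Longrightarrow> y \<le> int a \<Longrightarrow>
    set (map (to_row y) es) \<subseteq> grid a \<times> grid a"
  by (auto simp: to_row_def grid_def)

text \<open>
  An alternating form on edges obeying the windows vanishes once it vanishes on lists of edges
  of which at most one is not vertical: with two or more slanted edges, which may be moved to any
  row, the window in the second coordinate excludes row \<open>0\<close> or row \<open>a\<close>.
\<close>

lemma F_0_if_slanted:
  assumes V: "\<And>e D. e \<in> grid a \<times> grid a \<Longrightarrow> set D \<subseteq> grid a \<times> grid a \<Longrightarrow>
      \<forall>e\<in>set D. vertical e \<Longrightarrow> length D = a \<Longrightarrow> F (e # D) = 0"
    and es: "set es \<subseteq> grid a \<times> grid a" "length es = a + 1"
  shows "F es = 0"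
proof -
  have "F es = 0" if "slanted es \<le> Suc c" "set es \<subseteq> grid a \<times> grid a" "length es = a + 1" for c es
    using that
  proof (induction c arbitrary: es)
    case 0
    show ?case
    proof (cases "\<exists>e\<in>set es. \<not> vertical e")
      case True
      then obtain e xs ys where es: "es = xs @ e # ys" "\<not> vertical e" by (metis split_list)
      then have "slanted xs = 0" "slanted ys = 0" using 0 by auto
      then have "\<forall>e\<in>set (xs @ ys). vertical e"
        by (auto simp: slanted_def filter_empty_conv)
      then have "F (e # xs @ ys) = 0" using 0 es by (intro V) auto
      then show ?thesis using alternating_to_front[OF alternating_F, of xs e ys] es by simp
    next
      case False
      obtain e D where "es = e # D" using 0 by (cases es) auto
      then show ?thesis using 0 False by (auto intro!: V)
    qed
  next
    case (Suc c)
    \<comment> \<open>The rectangle between the two rows has vertical sides. Replacing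
      \<open>e\<close> by such a side leaves one slanted edge fewer, so these terms vanish by
      induction.\<close>
    have single: "F (xs @ to_row y e # ys) = F (xs @ e # ys)"
      if "slanted (xs @ e # ys) \<le> Suc (Suc c)" "set (xs @ e # ys) \<subseteq> grid a \<times> grid a"
        "length (xs @ e # ys) = a + 1" "0 \<le> y" "y \<le> int a" "unit_vertical e \<or> horizontal e"
      for xs e ys y
    proof (cases "vertical e")
      case False
      note shape = that(6)
      obtain i i' j where e: "e = ((i, j), (i', j))"
        using False shape by (metis horizontal_def unit_vertical_def vertical_def prod.collapse)
      have "F (xs @ ((i, j), (i, y)) # ys) = 0" "F (xs @ ((i', y), (i', j)) # ys) = 0"
        by (rule Suc.IH; use that False in \<open>simp add: e vertical_def\<close>)+
      then show ?thesis
        using False F_split[of xs "(i, j)" "(i', j)" ys "(i, y)"]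
          F_split[of xs "(i, y)" "(i', j)" ys "(i', y)"] by (simp add: e to_row_def)
    qed (simp add: to_row_def)
    have slanted_row: "vertical (to_row y e) = vertical e" for y e
      by (auto simp: to_row_def vertical_def)
    have move: "F (xs @ map (to_row y) ys) = F (xs @ ys)"
      if "slanted (xs @ ys) \<le> Suc (Suc c)" "set (xs @ ys) \<subseteq> grid a \<times> grid a"
        "length (xs @ ys) = a + 1" "0 \<le> y" "y \<le> int a" "\<forall>e\<in>set ys. unit_vertical e \<or> horizontal e"
      for xs ys y
      using that
    proof (induction ys arbitrary: xs)
      case (Cons e ys)
      have "set (map (to_row y) [e]) \<subseteq> grid a \<times> grid a"
        by (rule set_to_row) (use Cons.prems in auto)
      then have "F ((xs @ [to_row y e]) @ map (to_row y) ys) = F ((xs @ [to_row y e]) @ ys)"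
        by (intro Cons.IH) (use Cons.prems slanted_row[of y e] in \<open>simp_all split: if_splits\<close>)
      then show ?case using single[of xs e ys y] Cons.prems by simp
    qed simp
    have "on_edges (\<lambda>ts. f ((0, 0) # ts)) ([] @ es) = 0"
    proof (rule on_edges_pieces_0[OF Suc.prems(2)])
      fix es' assume es': "list_all2 (piece a) es' es"
      note b = pieces_bounds[OF es']
      have l: "length es' = a + 1" using es' Suc.prems(3) list_all2_lengthD by metis
      have le: "slanted es' \<le> Suc (Suc c)" using slanted_pieces[OF es'] Suc.prems(1) by linarith
      have "F es' = 0"
      proof (cases "slanted es' \<le> Suc c")
        case True
        then show ?thesis by (rule Suc.IH) (use b l in auto)
      next
        case False
        then have "int (slanted es') \<ge> 2" by linarith
        then have "int a * 2 + 2 \<le> int a * int (slanted es') + int (slanted es')"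
          by (intro add_mono mult_left_mono) auto
        then have "Hi2 (map (to_row 0) es') < Lo2 (map (to_row (int a)) es')"
          using to_row_bounds[OF b(4)] l a by linarith
        then consider "Hi2 (map (to_row 0) es') < w2" | "w2 < Lo2 (map (to_row (int a)) es')"
          by linarith
        then show ?thesis
        proof cases
          case 1
          then have "F (map (to_row 0) es') = 0" using b(3) by (intro F_window2 set_to_row) auto
          then show ?thesis using move[of "[]" es' 0] le b l by simp
        next
          case 2
          then have "F (map (to_row (int a)) es') = 0"
            using b(3) by (intro F_window2 set_to_row) auto
          then show ?thesis using move[of "[]" es' "int a"] le b l by simp
        qed
      qed
      then show "on_edges (\<lambda>ts. f ((0, 0) # ts)) ([] @ es') = 0" by (simp add: edge_form_def)
    qed
    then show ?case by (simp add: edge_form_def)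
  qed
  from this[of es "slanted es"] show ?thesis using es by simp
qed

lemma f_0_if_F_0:
  assumes "\<And>es. set es \<subseteq> grid a \<times> grid a \<Longrightarrow> length es = a + 1 \<Longrightarrow> F es = 0"
    and ts: "set ts \<subseteq> grid a"
  shows "f ts = 0"
proof (cases "length ts = a + 2")
  case True
  then obtain t ts' where t: "ts = t # ts'" by (cases ts) auto
  have sub: "set (path_edges t ts') \<subseteq> grid a \<times> grid a" using set_path_edges[of t ts'] ts t by auto
  have "f ts = on_edges (\<lambda>ts. f (t # ts)) (path_edges t ts')"
    using on_edges_path[OF alt, of t ts' "[]"] by (simp add: t)
  also have "\<dots> = F (path_edges t ts')" using F_base[of t "path_edges t ts'"] sub ts t by simp
  also have "\<dots> = 0" using assms(1)[of "path_edges t ts'"] sub True t by simp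
  finally show ?thesis .
next
  case False
  then show ?thesis using window[OF ts] by blast
qed

end

section \<open>Strands without long edges\<close>

text \<open>The counterpart of the exterior power of degree p + 1 tensored with \<open>R_0\<close>:
  as \<open>R_0\<close> lives in bidegree 0, the window is a single point.\<close>

definition exact_form :: "nat \<Rightarrow> int \<Rightarrow> int \<Rightarrow> (pt list \<Rightarrow> 'k::field) \<Rightarrow> bool" where
  "exact_form a w1 w2 g \<longleftrightarrow> alternating g \<and> (\<forall>ts. set ts \<subseteq> grid a \<longrightarrow> g ts \<noteq> 0 \<longrightarrow>
     length ts = a + 1 \<and> sum1 ts = w1 \<and> sum2 ts = w2)"

lemma cobd_nonzero:
  assumes "cobd g ts \<noteq> 0"
  obtains xs t ys where "ts = xs @ t # ys" "g (xs @ ys) \<noteq> 0"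
proof -
  have "\<exists>xs t ys. ts = xs @ t # ys \<and> g (xs @ ys) \<noteq> 0"
    using assms
  proof (induction ts arbitrary: g)
    case (Cons t ts)
    show ?case
    proof (cases "g ts = 0")
      case True
      then have "cobd (\<lambda>ys. g (t # ys)) ts \<noteq> 0" using Cons.prems by simp
      from Cons.IH[OF this] obtain xs t' ys where "ts = xs @ t' # ys" "g (t # xs @ ys) \<noteq> 0"
        by blast
      then show ?thesis by (intro exI[of _ "t # xs"] exI[of _ t'] exI[of _ ys]) simp
    next
      case False
      then show ?thesis by (intro exI[of _ "[]"] exI[of _ t] exI[of _ ts]) simp
    qed
  qed simp
  then show ?thesis using that by blast
qed

lemma (in strand) strand_minus_cobd:
  assumes g: "exact_form a w1 w2 g"
  shows "strand a w1 w2 (\<lambda>ts. f ts - cobd g ts)"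
proof
  show "a \<ge> 3" by (rule a)
  show "alternating (\<lambda>ts. f ts - cobd g ts)"
    using g alt by (intro alternating_diff alternating_cobd) (auto simp: exact_form_def)
  show "cobd (\<lambda>ts. f ts - cobd g ts) ts = 0" if "set ts \<subseteq> grid a" for ts
    using closed[OF that] by (simp add: cobd_diff cobd_cobd)
  fix ts assume ts: "set ts \<subseteq> grid a" and nz: "f ts - cobd g ts \<noteq> 0"
  show "length ts = a + 2 \<and> sum1 ts - w1 \<in> {0..int a} \<and> sum2 ts - w2 \<in> {0..int a}"
  proof (cases "f ts = 0")
    case True
    then obtain xs t ys where t: "ts = xs @ t # ys" "g (xs @ ys) \<noteq> 0"
      using nz by (auto elim: cobd_nonzero)
    have "set (xs @ ys) \<subseteq> grid a" using ts t(1) by simp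
    then have "length (xs @ ys) = a + 1" "sum1 (xs @ ys) = w1" "sum2 (xs @ ys) = w2"
      using g t(2) unfolding exact_form_def by blast+
    then show ?thesis using grid_bounds[of t a] t ts by auto
  next
    case False
    then show ?thesis by (rule window[OF ts])
  qed
qed

section \<open>Strands without long edges in either direction\<close>

locale balanced_strand = strand a w1 w2 f
  for a :: nat and w1 w2 :: int and f :: "pt list \<Rightarrow> 'k::field" +
  assumes free1: "long_edge_free a w1 f"
    and free2: "long_edge_free a w2 (\<lambda>ts. f (map prod.swap ts))"
begin

sublocale swapped: strand a w2 w1 "\<lambda>ts. f (map prod.swap ts)"
  by (rule strand_swap)

lemma balanced_strand_swap: "balanced_strand a w2 w1 (\<lambda>ts. f (map prod.swap ts))"
proof
  show "long_edge_free a w2 (\<lambda>ts. f (map prod.swap ts))" by (rule free2)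
  have "(\<lambda>ts. f (map prod.swap (map prod.swap ts))) = f" by (simp add: comp_def)
  then show "long_edge_free a w1 (\<lambda>ts. f (map prod.swap (map prod.swap ts)))"
    using free1 by simp
qed

lemma swap_facts:
  "set ts \<subseteq> grid a \<Longrightarrow> set (map prod.swap ts) \<subseteq> grid a"
  "sum1 (map prod.swap ts) = sum2 ts" "sum2 (map prod.swap ts) = sum1 ts"
  "fst ` set (map prod.swap ts) = snd ` set ts"
  "map prod.swap (map prod.swap ts) = ts"
  by (force simp: sum1_def sum2_def comp_def image_image grid_def)+

lemma f_row_free:
  assumes "set T \<subseteq> grid a" "length T = a + 1" "sum2 T = w2"
    and "(i, j) \<in> grid a" "(i', j) \<in> grid a" "j \<notin> snd ` set T"
  shows "f ((i, j) # T) = f ((i', j) # T)"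
proof -
  have "f (map prod.swap ((j, i) # map prod.swap T)) =
      f (map prod.swap ((j, i') # map prod.swap T))"
    by (rule swapped.f_column_free[OF free2])
      (use assms swap_facts[of T] in \<open>simp_all del: set_map map_map\<close>)
  then show ?thesis using swap_facts(5)[of T] by (simp del: map_map)
qed

lemma f_zero_if_row_free:
  assumes "set T \<subseteq> grid a" "sum2 T - w2 \<notin> snd ` set T"
  shows "f T = 0"
proof -
  have "f (map prod.swap (map prod.swap T)) = 0"
    by (rule swapped.f_zero_if_column_free[OF free2])
      (use assms swap_facts[of T] in \<open>simp_all del: set_map map_map\<close>)
  then show ?thesis by (simp only: swap_facts(5))
qed

text \<open>The assumption on the row says that \<open>sum2 T = w2\<close>, so \<open>p\<close>
  slides freely along its row. Since \<open>sum1 T\<close> is not \<open>w1\<close>, one end of the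
  row is outside the window.\<close>

lemma f_zero_if_row_single:
  assumes U: "set (p # T) \<subseteq> grid a" "length T = a + 1"
    and row: "sum2 (p # T) - w2 = snd p" "snd p \<notin> snd ` set T"
    and x: "sum1 (p # T) - w1 \<noteq> fst p"
  shows "f (p # T) = 0"
proof -
  define p' :: pt where "p' = (if sum1 (p # T) - w1 < fst p then (0, snd p) else (int a, snd p))"
  have b: "0 \<le> snd p" "snd p \<le> int a" "0 \<le> fst p" "fst p \<le> int a"
    using U(1) grid_bounds[of p a] by auto
  have "f (p # T) = f (p' # T)"
    using f_row_free[of T "fst p" "snd p" "fst p'"] assms b by (auto simp: p'_def)
  also have "f (p' # T) = 0"
  proof (rule ccontr)
    assume "f (p' # T) \<noteq> 0"
    moreover have "set (p' # T) \<subseteq> grid a" using U b by (auto simp: p'_def)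
    ultimately have "sum1 (p' # T) - w1 \<in> {0..int a}" using window by blast
    then show False using x by (auto simp: p'_def split: if_splits)
  qed
  finally show ?thesis .
qed

text \<open>
  In the following, \<open>R\<close> has exactly one point in each column other than \<open>i\<close>; then \<open>f\<close> is, as a
  function of two points in column \<open>i\<close>, a difference of values of a function which is constant
  below and above the row \<open>w2 - sum2 R\<close>.
\<close>

definition transversal_except :: "int \<Rightarrow> pt list \<Rightarrow> bool" where
  "transversal_except i R \<longleftrightarrow> set R \<subseteq> grid a \<and> length R = a \<and> 0 \<le> i \<and> i \<le> int a \<and>
     fst ` set R = {0..int a} - {i} \<and> sum1 R + i = w1"

lemma pair_additive:
  assumes R: "transversal_except i R"
    and "0 \<le> y" "y \<le> int a" "0 \<le> y'" "y' \<le> int a" "0 \<le> y''" "y'' \<le> int a"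
  shows "f ((i, y) # (i, y'') # R) = f ((i, y) # (i, y') # R) + f ((i, y') # (i, y'') # R)"
proof -
  let ?D = "[((i, y'), (i, y)), ((i, y'), (i, y''))]"
  \<comment> \<open>Both edges lie in column \<open>i\<close>, and the critical column is
    \<open>sum1 R + 2 * i - w1 = i\<close>, where \<open>R\<close> has no point.\<close>
  have "on_edges (\<lambda>ts. f (R @ ts)) ?D = 0"
    by (rule long_edge_free_f_0[OF free1])
      (use assms in \<open>auto simp: transversal_except_def vertical_def lo1_def\<close>)
  moreover have "f (R @ [(i, y'), (i, y')]) = 0"
    using alternating_eq_0[OF alt, of R "(i, y')" "[]"] by simp
  moreover have "f ((i, y) # (i, y') # R) = - f ((i, y') # (i, y) # R)"
    using alternating_swap[OF alt, of "[]" "(i, y)" "(i, y')" R] by simp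
  ultimately show ?thesis by (simp add: f_append_two algebra_simps)
qed

lemma pair_window:
  assumes R: "transversal_except i R" and y: "0 \<le> y" "y \<le> int a" "0 \<le> y'" "y' \<le> int a"
    and nz: "f ((i, y) # (i, y') # R) \<noteq> 0"
  shows "0 \<le> y + y' + sum2 R - w2" "y + y' + sum2 R - w2 \<le> int a"
proof -
  have "set ((i, y) # (i, y') # R) \<subseteq> grid a" using R y by (auto simp: transversal_except_def)
  from window[OF this nz] show "0 \<le> y + y' + sum2 R - w2" "y + y' + sum2 R - w2 \<le> int a" by auto
qed

text \<open>Both points can be compared with the bottom or with the top of the column, and the
  window excludes these pairs.\<close>

lemma pair_same_side:
  assumes R: "transversal_except i R" and y: "0 \<le> y" "y \<le> int a" "0 \<le> y'" "y' \<le> int a"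
    and side: "(y < w2 - sum2 R \<and> y' < w2 - sum2 R) \<or> (w2 - sum2 R < y \<and> w2 - sum2 R < y')"
  shows "f ((i, y) # (i, y') # R) = 0"
proof -
  define m where "m = (if y < w2 - sum2 R then 0 else int a)"
  have m: "0 \<le> m" "m \<le> int a" by (auto simp: m_def)
  have "f ((i, y) # (i, m) # R) = 0"
  proof (rule ccontr)
    assume "f ((i, y) # (i, m) # R) \<noteq> 0"
    from pair_window[OF R y(1,2) m this] side show False by (auto simp: m_def split: if_splits)
  qed
  moreover have "f ((i, m) # (i, y') # R) = 0"
  proof (rule ccontr)
    assume "f ((i, m) # (i, y') # R) \<noteq> 0"
    from pair_window[OF R m y(3,4) this] side show False by (auto simp: m_def split: if_splits)
  qed
  ultimately show ?thesis using pair_additive[OF R y(1,2) m y(3,4)] by simp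
qed

text \<open>Pigeonhole principle, as \<open>a - 1 > a / 2\<close> for \<open>a \<ge> 3\<close>.\<close>

lemma sparse_row:
  assumes "length R = a"
  shows "\<exists>r. 1 \<le> r \<and> r \<le> int a - 1 \<and>
    (r \<notin> snd ` set R \<or> (\<exists>p R'. mset R = mset (p # R') \<and> snd p = r \<and> r \<notin> snd ` set R'))"
proof (rule ccontr)
  assume contra: "\<not> ?thesis"
  have two: "2 \<le> length (filter (\<lambda>p. snd p = r) R)" if r: "r \<in> {1..int a - 1}" for r
  proof -
    have "r \<in> snd ` set R" using contra r by auto
    then obtain xs p ys where p: "R = xs @ p # ys" "snd p = r" by (metis imageE split_list)
    have "mset R = mset (p # xs @ ys)" using p by simp
    then have "r \<in> snd ` set (xs @ ys)" using contra r p by fastforce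
    then have "filter (\<lambda>p. snd p = r) (xs @ ys) \<noteq> []" by (auto simp: filter_empty_conv)
    then have "1 \<le> length (filter (\<lambda>p. snd p = r) (xs @ ys))" by (simp add: Suc_leI del: filter_append)
    then show ?thesis using p by simp
  qed
  have "(\<Sum>r\<in>{1..int a - 1}. 2) \<le> (\<Sum>r\<in>{1..int a - 1}. length (filter (\<lambda>p. snd p = r) R))"
    by (intro sum_mono two) auto
  also have "\<dots> \<le> length R"
  proof (induction R)
    case (Cons p R)
    have "(\<Sum>r\<in>{1..int a - 1}. length (filter (\<lambda>q. snd q = r) (p # R))) =
        (\<Sum>r\<in>{1..int a - 1}. (if r = snd p then 1 else 0) + length (filter (\<lambda>q. snd q = r) R))"
      by (intro sum.cong) auto
    also have "\<dots> \<le> 1 + length R" unfolding sum.distrib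
      by (intro add_mono Cons.IH) (simp add: sum.delta)
    finally show ?case by simp
  qed simp
  finally show False using assms a by simp
qed

text \<open>As the values do not change on either side, one pair that straddles the critical row
  suffices. It is chosen to make the second sum exceed \<open>w2\<close> by \<open>r\<close>, a row
  that \<open>R\<close> meets at most once; then either row \<open>r\<close> is free, or its only
  point can slide along it.\<close>

lemma pair_opposite_sides:
  assumes R: "transversal_except i R" and y: "0 \<le> y" "y' \<le> int a"
    and side: "y < w2 - sum2 R" "w2 - sum2 R < y'"
  shows "f ((i, y) # (i, y') # R) = 0"
proof -
  define n where "n = w2 - sum2 R"
  have R': "set R \<subseteq> grid a" "length R = a" "0 \<le> i" "i \<le> int a" "i \<notin> fst ` set R" "sum1 R + i = w1"
    using R by (auto simp: transversal_except_def)
  obtain r where r: "1 \<le> r" "r \<le> int a - 1"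
    "r \<notin> snd ` set R \<or> (\<exists>p R'. mset R = mset (p # R') \<and> snd p = r \<and> r \<notin> snd ` set R')"
    using sparse_row[OF R'(2)] by blast
  \<comment> \<open>The heights satisfy \<open>z + z' = n + r\<close>, with \<open>z\<close> as
    small as the column allows. Because 1 <= r <= a - 1, they straddle \<open>n\<close> and both
    avoid \<open>r\<close>.\<close>
  define z where "z = max 0 (n + r - int a)"
  define z' where "z' = n + r - z"
  have z: "0 \<le> z" "z < n" "n < z'" "z' \<le> int a" "z \<noteq> r" "z' \<noteq> r"
    using r side y by (auto simp: z_def z'_def n_def)
  define c c' where "c = (i, z)" and "c' = (i, z')"
  have cg: "c \<in> grid a" "c' \<in> grid a" using z R' by (auto simp: c_def c'_def)
  have sum: "sum2 (c # c' # R) - w2 = r" "sum1 (c # c' # R) - w1 = i"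
    using R'(6) by (auto simp: c_def c'_def z'_def n_def)
  have "f (c # c' # R) = 0"
    using r(3)
  proof
    assume "r \<notin> snd ` set R"
    then show ?thesis
      by (intro f_zero_if_row_free) (use R' cg sum z in \<open>auto simp: c_def c'_def\<close>)
  next
    assume "\<exists>p R'. mset R = mset (p # R') \<and> snd p = r \<and> r \<notin> snd ` set R'"
    then obtain p Q where p: "mset R = mset (p # Q)" "snd p = r" "r \<notin> snd ` set Q" by blast
    have m: "mset (c # c' # R) = mset (p # c # c' # Q)" using p(1) by simp
    have s: "set R = set (p # Q)" "length R = length (p # Q)"
      using p(1) mset_eq_setD mset_eq_length by blast+
    have "sum1 R = sum1 (p # Q)" "sum2 R = sum2 (p # Q)"
      using p(1) unfolding sum1_def sum2_def by (metis mset_map sum_mset_sum_list)+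
    then have "f (p # c # c' # Q) = 0"
      by (intro f_zero_if_row_single) (use R' s p cg sum z in \<open>auto simp: c_def c'_def\<close>)
    then show ?thesis by (rule alternating_permute_0[OF alt m])
  qed
  then have opp: "f ((i, z) # (i, z') # R) = 0" by (simp add: c_def c'_def)
  have "f ((i, y) # (i, z) # R) = 0" "f ((i, z') # (i, y') # R) = 0"
    by (rule pair_same_side[OF R]; use y side z in \<open>simp add: n_def\<close>)+
  then show ?thesis
    using pair_additive[OF R, of y z y'] pair_additive[OF R, of z z' y'] opp y side z
    by (simp add: n_def)
qed

lemma pair_0:
  assumes R: "transversal_except i R" and y: "0 \<le> y" "y \<le> int a" "0 \<le> y'" "y' \<le> int a"
    and n: "y \<noteq> w2 - sum2 R" "y' \<noteq> w2 - sum2 R"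
  shows "f ((i, y) # (i, y') # R) = 0"
proof -
  consider "y < w2 - sum2 R" "w2 - sum2 R < y'" | "y' < w2 - sum2 R" "w2 - sum2 R < y" |
    "(y < w2 - sum2 R \<and> y' < w2 - sum2 R) \<or> (w2 - sum2 R < y \<and> w2 - sum2 R < y')"
    using n by linarith
  then show ?thesis
  proof cases
    case 1
    then show ?thesis using pair_opposite_sides[OF R] y by simp
  next
    case 2
    then have "f ((i, y') # (i, y) # R) = 0" using pair_opposite_sides[OF R] y by simp
    then show ?thesis using alternating_swap[OF alt, of "[]" "(i, y)" "(i, y')" R] by simp
  next
    case 3
    then show ?thesis by (rule pair_same_side[OF R y])
  qed
qed

section \<open>Lists with one point in each column\<close>

definition transversal :: "pt list \<Rightarrow> bool" where
  "transversal T \<longleftrightarrow> set T \<subseteq> grid a \<and> length T = a + 1 \<and> fst ` set T = {0..int a} \<and> sum1 T = w1"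

lemma transversal_distinct:
  assumes "transversal T"
  shows "distinct (map fst T)"
proof (rule card_distinct)
  have "card (set (map fst T)) = card {0..int a}" using assms by (simp add: transversal_def)
  then show "card (set (map fst T)) = length (map fst T)"
    using assms by (simp add: transversal_def)
qed

lemma transversal_same_column:
  assumes T: "transversal T" "sum2 T = w2"
    and p: "(i, y) \<in> grid a - set T" "(i, y') \<in> grid a - set T"
  shows "f ((i, y) # T) = f ((i, y') # T)"
proof -
  have "i \<in> fst ` set T" using T(1) p by (auto simp: transversal_def)
  then obtain m xs ys where T': "T = xs @ (i, m) # ys" by (metis imageE prod.collapse split_list)
  define R where "R = xs @ ys"
  have mT: "mset T = mset ((i, m) # R)" by (simp add: T' R_def)
  have fT: "fst ` set T = insert i (fst ` set R)" by (auto simp: T' R_def)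
  have iR: "i \<notin> fst ` set R" using transversal_distinct[OF T(1)] by (auto simp: T' R_def)
  have R: "transversal_except i R"
    using T(1) p iR fT unfolding transversal_def transversal_except_def by (auto simp: T' R_def)
  \<comment> \<open>The point of \<open>T\<close> in column \<open>i\<close> sits exactly at the
    critical height, so two points off \<open>T\<close> in this column avoid that height.\<close>
  have m: "m = w2 - sum2 R" using T(2) by (simp add: T' R_def)
  have mg: "(i, m) \<in> grid a" "y \<noteq> m" "y' \<noteq> m" using T(1) p by (auto simp: transversal_def T')
  have "f ((i, y) # (i, m) # R) = f ((i, y') # (i, m) # R)"
    using pair_additive[OF R, of y y' m] pair_0[OF R, of y y'] p mg m by auto
  moreover obtain s :: 'k where
    "\<And>h. alternating h \<Longrightarrow> h T = s * h ((i, m) # R)"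
    using alternating_permute[OF mT, where 'k = 'k] by blast
  then have "f (q # T) = s * f (q # (i, m) # R)" for q
    using alternating_Cons[OF alt, of q] by blast
  ultimately show ?thesis by simp
qed

end

text \<open>Within a column this is \<open>transversal_same_column\<close>. To change the column,
  use a row that misses \<open>T\<close>; if there is none, \<open>T\<close> also has one point in
  each row, and the exchanged statement allows moves along rows.\<close>

lemma (in balanced_strand) transversal_off:
  assumes T: "transversal T" "sum2 T = w2" and p: "p \<in> grid a - set T" "p' \<in> grid a - set T"
  shows "f (p # T) = f (p' # T)"
proof -
  obtain i j i' j' where pp: "p = (i, j)" "p' = (i', j')" by (metis prod.collapse)
  have Tg: "set T \<subseteq> grid a" "length T = a + 1" using T by (auto simp: transversal_def)
  have col: "f ((x, y) # T) = f ((x, y') # T)"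
    if "(x, y) \<in> grid a - set T" "(x, y') \<in> grid a - set T" for x y y'
    using transversal_same_column[OF T that] .
  show ?thesis
  proof (cases "snd ` set T = {0..int a}")
    case False
    moreover have "snd ` set T \<subseteq> {0..int a}" using Tg(1) by (auto simp: grid_def)
    ultimately have "\<exists>y\<in>{0..int a}. y \<notin> snd ` set T" by blast
    then obtain y where y: "y \<notin> snd ` set T" "0 \<le> y" "y \<le> int a" by auto
    then have off: "(x, y) \<notin> set T" for x by force
    have "f ((i, y) # T) = f ((i', y) # T)"
      by (rule f_row_free) (use Tg T p pp y in auto)
    moreover have "f ((i, j) # T) = f ((i, y) # T)" "f ((i', j') # T) = f ((i', y) # T)"
      by (rule col; use p pp y off in auto)+
    ultimately show ?thesis by (simp add: pp)
  next
    case True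
    interpret sw: balanced_strand a w2 w1 "\<lambda>ts. f (map prod.swap ts)"
      by (rule balanced_strand_swap)
    have T': "sw.transversal (map prod.swap T)"
      using T True swap_facts[of T] unfolding sw.transversal_def transversal_def
      by (simp del: set_map map_map)
    have inT: "(y, x) \<in> set (map prod.swap T) \<longleftrightarrow> (x, y) \<in> set T" for x y by force
    have row: "f ((x, y) # T) = f ((x', y) # T)"
      if "(x, y) \<in> grid a - set T" "(x', y) \<in> grid a - set T" for x x' y
      using sw.transversal_same_column[OF T', of y x x'] that T inT swap_facts[of T]
      by (simp add: transversal_def del: set_map map_map)
    have "inj_on fst (set (map prod.swap T))"
      using sw.transversal_distinct[OF T'] by (simp only: distinct_map)
    then have inj: "x = x'" if "(x, y) \<in> set T" "(x', y) \<in> set T" for x x' y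
      using that inT inj_onD[of fst _ "(y, x)" "(y, x')"] by fastforce
    show ?thesis
    proof (cases "(i, j') \<in> set T \<and> (i', j) \<in> set T")
      case True
      \<comment> \<open>The two other corners of the rectangle spanned by \<open>p\<close> and
        \<open>p'\<close> belong to \<open>T\<close>, so the walk takes a detour through a third
        column.\<close>
      obtain x where x: "0 \<le> x" "x \<le> int a" "x \<noteq> i" "x \<noteq> i'"
      proof -
        have "\<exists>x::int. 0 \<le> x \<and> x \<le> 2 \<and> x \<noteq> i \<and> x \<noteq> i'" by presburger
        then obtain x where "0 \<le> x" "x \<le> 2" "x \<noteq> i" "x \<noteq> i'" by blast
        then show ?thesis using that[of x] a by simp
      qed
      have "(x, j) \<notin> set T" "(x, j') \<notin> set T" using inj True x by blast+
      then have "f ((i, j) # T) = f ((x, j) # T)" "f ((x, j) # T) = f ((x, j') # T)"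
        "f ((x, j') # T) = f ((i', j') # T)"
        using row[of i j x] col[of x j j'] row[of x j' i'] p pp x by auto
      then show ?thesis by (simp add: pp)
    next
      case False
      then show ?thesis
        using col[of i j j'] row[of i j' i'] row[of i j i'] col[of i' j j'] p pp by auto
    qed
  qed
qed

section \<open>The potential of a balanced strand\<close>

context balanced_strand
begin

text \<open>If a column is free, the choice depends on the set of columns only, so all lists of
  endpoints of given vertical edges share one base point. If no column is free,
  \<open>transversal_off\<close> will make the choice irrelevant.\<close>

definition off_point :: "pt set \<Rightarrow> pt" where
  "off_point S = (if fst ` S = {0..int a} then (SOME p. p \<in> grid a - S)
     else (SOME i. i \<in> {0..int a} - fst ` S, 0))"

definition primitive :: "pt list \<Rightarrow> 'k" where
  "primitive ts = (if distinct ts \<and> set ts \<subseteq> grid a \<and> length ts = a + 1 \<and> sum1 ts = w1 \<and> sum2 ts = w2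
     then f (off_point (set ts) # ts) else 0)"

lemma alternating_primitive: "alternating primitive"
proof (rule alternatingI)
  fix xs ys and x y :: pt
  show "primitive (xs @ x # x # ys) = 0" by (simp add: primitive_def)
  have s: "set (xs @ y # x # ys) = set (xs @ x # y # ys)"
    "sum1 (xs @ y # x # ys) = sum1 (xs @ x # y # ys)"
    "sum2 (xs @ y # x # ys) = sum2 (xs @ x # y # ys)"
    "length (xs @ y # x # ys) = length (xs @ x # y # ys)"
    "distinct (xs @ y # x # ys) = distinct (xs @ x # y # ys)" by auto
  have "f (p # xs @ x # y # ys) = - f (p # xs @ y # x # ys)" for p
    using alternating_swap[OF alternating_Cons[OF alt, of p], of xs x y ys] by simp
  then show "primitive (xs @ x # y # ys) = - primitive (xs @ y # x # ys)"
    unfolding primitive_def s by simp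
qed

lemma exact_form_primitive: "exact_form a w1 w2 primitive"
  using alternating_primitive by (auto simp: exact_form_def primitive_def split: if_splits)

text \<open>Only the point at height \<open>n\<close> completes \<open>R\<close> to second sum
  \<open>w2\<close>. For distinct points at most one term on the right is thus nonzero, and its base
  point may be taken to be the other point.\<close>

lemma pair_eq_primitive:
  assumes R: "transversal_except i R" and y: "0 \<le> y" "y \<le> int a" "0 \<le> y'" "y' \<le> int a"
  shows "f ((i, y') # (i, y) # R) = primitive ((i, y) # R) - primitive ((i, y') # R)"
proof -
  define n where "n = w2 - sum2 R"
  have R': "set R \<subseteq> grid a" "length R = a" "0 \<le> i" "i \<le> int a" "i \<notin> fst ` set R"
    "fst ` set R = {0..int a} - {i}" "sum1 R + i = w1"
    using R by (auto simp: transversal_except_def)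
  have "card (set (map fst R)) = length (map fst R)"
    using R' by (simp add: card_Diff_singleton)
  then have dR: "distinct R" using card_distinct distinct_map by blast
  have iR: "(i, z) \<notin> set R" for z using R'(5) by force
  have prim: "primitive ((i, z) # R) = (if z = n then f ((i, z') # (i, z) # R) else 0)"
    if z: "0 \<le> z" "z \<le> int a" "0 \<le> z'" "z' \<le> int a" "z' \<noteq> z" for z z'
  proof (cases "z = n")
    case True
    define T where "T = (i, z) # R"
    have T: "transversal T" "sum2 T = w2"
      using R' z True by (auto simp: T_def transversal_def n_def)
    have off: "(i, z') \<in> grid a - set T" using R' z iR by (auto simp: T_def)
    have "off_point (set T) = (SOME p. p \<in> grid a - set T)"
      using T(1) by (simp add: off_point_def transversal_def)
    then have "off_point (set T) \<in> grid a - set T" using off by (metis someI_ex)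
    then have "f (off_point (set T) # T) = f ((i, z') # T)" by (intro transversal_off T off)
    moreover have "distinct T" using dR iR by (simp add: T_def)
    then have "primitive T = f (off_point (set T) # T)"
      using T unfolding primitive_def transversal_def by simp
    ultimately have "primitive T = f ((i, z') # T)" by simp
    then show ?thesis using True by (simp add: T_def)
  qed (simp add: primitive_def n_def)
  consider "y = y'" | "y \<noteq> y'" "y = n" | "y \<noteq> y'" "y' = n" | "y \<noteq> y'" "y \<noteq> n" "y' \<noteq> n" by blast
  then show ?thesis
  proof cases
    case 1
    then show ?thesis using alternating_eq_0[OF alt, of "[]" "(i, y)" R] by simp
  next
    case 2
    then show ?thesis using prim[of y y'] prim[of y' y] y by simp
  next
    case 3
    then show ?thesis
      using prim[of y y'] prim[of y' y] y alternating_swap[OF alt, of "[]" "(i, y')" "(i, y)" R]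
      by simp
  next
    case 4
    then show ?thesis using prim[of y y'] prim[of y' y] y pair_0[OF R y(3,4) y(1,2)]
      by (simp add: n_def)
  qed
qed

text \<open>Both sides are additive in the first edge, and the potential can be nonzero only at
  points of column \<open>r\<close>. Between two points outside this column both sides vanish, so it
  suffices to connect each point to one point outside where the two sides agree.\<close>

lemma F_eq_primitive:
  assumes D: "set D \<subseteq> grid a \<times> grid a" "\<forall>e\<in>set D. vertical e" "length D = a"
    and pq: "p \<in> grid a" "q \<in> grid a"
  shows "F ((p, q) # D) = on_edges primitive ((p, q) # D)"
proof -
  define r where "r = w1 - Lo1 D"
  define \<phi> where "\<phi> u v = F ((u, v) # D)" for u v
  define \<gamma> where "\<gamma> v = on_edges (\<lambda>ts. primitive (v # ts)) D" for v
  have add: "\<phi> u v = \<phi> u z + \<phi> z v" for u v z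
    using F_split[of "[]" u v D z] by (simp add: \<phi>_def)
  have two: "\<phi> u v = on_edges (\<lambda>ts. f (u # v # ts)) D" if "u \<in> grid a" "v \<in> grid a" for u v
  proof -
    have "f (u # u # ts) = 0" for ts using alternating_eq_0[OF alt, of "[]" u ts] by simp
    then show ?thesis using F_base[of u "(u, v) # D"] that D(1) by (simp add: \<phi>_def)
  qed
  have cols: "map fst ts = map lo1 D" "sum1 ts = Lo1 D" "set ts \<subseteq> grid a" "length ts = a"
    if "list_all2 endpoint ts D" for ts
    using vertical_endpoints[OF that D(2)] endpoints_subset[OF that D(1)] that D(3)
    by (auto simp: sum1_def list_all2_lengthD)
  have far: "\<phi> u v = 0" if "u \<in> grid a" "v \<in> grid a" "fst u \<noteq> r" "fst v \<noteq> r" for u v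
    unfolding two[OF that(1,2)] using long_edge_free_f_0[OF free1, of "[u, v]" D] that D
    by (simp add: r_def)
  have \<gamma>_far: "\<gamma> v = 0" if "fst v \<noteq> r" for v
  proof -
    have "\<gamma> v = on_edges (\<lambda>_. 0) D" unfolding \<gamma>_def
      by (rule on_edges_cong) (use that in \<open>auto simp: primitive_def cols r_def\<close>)
    then show ?thesis by simp
  qed
  have near: "\<exists>u\<in>grid a. fst u \<noteq> r \<and> \<phi> u v = \<gamma> v" if v: "v \<in> grid a" "fst v = r" for v
  proof (cases "insert r (set (map lo1 D)) = {0..int a}")
    case False
    define n where "n = (SOME i. i \<in> {0..int a} - insert r (set (map lo1 D)))"
    have "0 \<le> lo1 e \<and> lo1 e \<le> int a" if "e \<in> grid a \<times> grid a" for e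
      using that grid_bounds[of "fst e" a] grid_bounds[of "snd e" a] by (auto simp: lo1_def)
    then have "insert r (set (map lo1 D)) \<subseteq> {0..int a}"
      using v D(1) grid_bounds[OF v(1)] by auto
    then have "\<exists>i. i \<in> {0..int a} - insert r (set (map lo1 D))" using False by blast
    then have n: "n \<in> {0..int a} - insert r (set (map lo1 D))" unfolding n_def by (rule someI_ex)
    then have ng: "(n, 0) \<in> grid a" "(n, int a) \<in> grid a" by auto
    have "f ((n, 0) # v # ts) = primitive (v # ts)" if ts: "list_all2 endpoint ts D" for ts
    proof -
      have C: "fst ` set (v # ts) = insert r (set (map lo1 D))"
        using cols(1)[OF ts] v by (metis image_insert list.set(2) set_map)
      then have off: "off_point (set (v # ts)) = (n, 0)"
        using False unfolding off_point_def n_def by presburger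
      have T: "set (v # ts) \<subseteq> grid a" "length (v # ts) = a + 1" "sum1 (v # ts) = w1"
        using cols[OF ts] v by (auto simp: r_def)
      \<comment> \<open>Going from the bottom to the top of the free column raises the second sum by
        a, the width of the window. Both lists fit only if \<open>v # ts\<close> has second sum
        exactly \<open>w2\<close>.\<close>
      have "f ((n, 0) # v # ts) = 0" if "sum2 (v # ts) \<noteq> w2"
      proof (rule ccontr)
        assume nz: "f ((n, 0) # v # ts) \<noteq> 0"
        moreover have "f ((n, 0) # v # ts) = f ((n, int a) # v # ts)"
          by (rule f_column_free[OF free1 T ng]) (use C n in blast)
        ultimately have "f ((n, int a) # v # ts) \<noteq> 0" by simp
        then show False
          using window[of "(n, 0) # v # ts"] window[of "(n, int a) # v # ts"] nz T(1) ng that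
          by auto
      qed
      moreover have "f ((n, 0) # v # ts) = 0" if "\<not> distinct (v # ts)"
        using alternating_not_distinct[OF alt, of "(n, 0) # v # ts"] that by simp
      ultimately show ?thesis using T off unfolding primitive_def by auto
    qed
    then have "\<phi> (n, 0) v = \<gamma> v" unfolding two[OF ng(1) v(1)] \<gamma>_def by (rule on_edges_cong)
    then show ?thesis using ng n by (intro bexI[of _ "(n, 0)"]) auto
  next
    case True
    \<comment> \<open>No column is free, so \<open>v\<close> and the edges of \<open>D\<close>
      occupy each column once. The bottom of the column of the first vertical edge serves as base
      point, and the pair of points in that column is handled by
      \<open>pair_eq_primitive\<close>.\<close>
    obtain d D' where dD: "D = d # D'" using D(3) a by (cases D) auto
    obtain i y y' where d: "d = ((i, y), (i, y'))"
      using D(2) dD by (metis list.set_intros(1) prod.collapse vertical_def)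
    have iy: "0 \<le> i" "i \<le> int a" "0 \<le> y" "y \<le> int a" "0 \<le> y'" "y' \<le> int a"
      using D(1) by (auto simp: dD d)
    have "card (set (r # map lo1 D)) = length (r # map lo1 D)" using True D(3) by simp
    then have dist: "distinct (r # map lo1 D)" by (rule card_distinct)
    have lod: "lo1 d = i" by (simp add: d lo1_def)
    have ig: "(i, 0) \<in> grid a" using iy by simp
    have R: "transversal_except i (v # ts)" if ts: "list_all2 endpoint ts D'" for ts
    proof -
      have "list_all2 endpoint ((i, y) # ts) D" using ts by (simp add: dD d)
      note c = cols[OF this]
      have "fst ` set ts = set (map lo1 D')" using c(1) by (metis dD list.inject list.map(2) set_map)
      then have "fst ` set (v # ts) = {0..int a} - {i}"
        using True dist v(2) by (auto simp: dD lod)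
      then show ?thesis using c v iy by (auto simp: transversal_except_def r_def)
    qed
    have "f ((i, 0) # v # (i, y') # ts) - f ((i, 0) # v # (i, y) # ts) =
        primitive (v # (i, y') # ts) - primitive (v # (i, y) # ts)"
      if ts: "list_all2 endpoint ts D'" for ts
    proof -
      have "f ((i, 0) # v # (i, z) # ts) = - f ((i, 0) # (i, z) # v # ts)"
        "primitive (v # (i, z) # ts) = - primitive ((i, z) # v # ts)" for z
        using alternating_swap[OF alt, of "[(i, 0)]" v "(i, z)" ts]
          alternating_swap[OF alternating_primitive, of "[]" v "(i, z)" ts] by simp_all
      then show ?thesis
        using pair_eq_primitive[OF R[OF ts], of y 0] pair_eq_primitive[OF R[OF ts], of y' 0] iy
        by simp
    qed
    then have "\<phi> (i, 0) v = \<gamma> v"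
      unfolding two[OF ig v(1)] \<gamma>_def dD d on_edges.simps by (rule on_edges_cong)
    moreover have "i \<noteq> r" using dist by (auto simp: dD lod)
    ultimately show ?thesis using ig by (intro bexI[of _ "(i, 0)"]) auto
  qed
  have triv: "\<phi> u u = 0" for u using add[of u u u] by (metis add_cancel_right_right)
  have ex: "\<exists>u\<in>grid a. fst u \<noteq> r \<and> \<phi> u v = \<gamma> v" if "v \<in> grid a" for v
    using near[OF that] that triv[of v] \<gamma>_far[of v] by (cases "fst v = r") auto
  obtain u u' where u: "u \<in> grid a" "fst u \<noteq> r" "\<phi> u p = \<gamma> p"
    "u' \<in> grid a" "fst u' \<noteq> r" "\<phi> u' q = \<gamma> q" using ex[OF pq(1)] ex[OF pq(2)] by blast
  have "\<phi> p u = - \<gamma> p" using add[of u u p] triv[of u] u(3) by (simp add: add_eq_0_iff)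
  moreover have "\<phi> u u' = 0" using far u by blast
  ultimately have "\<phi> p q = \<gamma> q - \<gamma> p" using add[of p q u] add[of u q u'] u(6) by simp
  then show ?thesis by (simp add: \<phi>_def \<gamma>_def on_edges_Cons del: on_edges.simps)
qed

theorem balanced_imp_coboundary:
  shows "\<exists>g. exact_form a w1 w2 g \<and> (\<forall>ts. set ts \<subseteq> grid a \<longrightarrow> f ts = cobd g ts)"
proof -
  define h where "h ts = f ts - cobd primitive ts" for ts
  interpret h: strand a w1 w2 h
    unfolding h_def by (rule strand_minus_cobd[OF exact_form_primitive])
  have H: "edge_form h es = F es - on_edges primitive es" for es
  proof -
    have "edge_form h es = on_edges (\<lambda>ts. f ((0, 0) # ts) -
        (primitive ts - cobd (\<lambda>ts. primitive ((0, 0) # ts)) ts)) es"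
      by (simp add: edge_form_def h_def)
    then show ?thesis by (simp add: on_edges_diff on_edges_cobd edge_form_def)
  qed
  have "edge_form h (e # D) = 0"
    if "e \<in> grid a \<times> grid a" "set D \<subseteq> grid a \<times> grid a" "\<forall>e\<in>set D. vertical e" "length D = a"
    for e D
    using F_eq_primitive[OF that(2-4), of "fst e" "snd e"] that(1) unfolding H by auto
  from h.f_0_if_F_0[OF h.F_0_if_slanted, OF this]
  have "h ts = 0" if "set ts \<subseteq> grid a" for ts using that by blast
  then have "f ts = cobd primitive ts" if "set ts \<subseteq> grid a" for ts
    using that by (simp add: h_def)
  then show ?thesis using exact_form_primitive by blast
qed

end

section \<open>The value on the long edge\<close>

definition edges_at :: "nat \<Rightarrow> (nat \<Rightarrow> int) \<Rightarrow> (nat \<Rightarrow> int) \<Rightarrow> (pt \<times> pt) list" where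
  "edges_at a i j = map (\<lambda>l. ((i l, j l), (i l, j l + 1))) [0..<a]"

text \<open>For vertical edges the two bounds in \<open>long_edge_free\<close> concern the same
  number, which has a - 1 possible values.\<close>

definition admissible :: "nat \<Rightarrow> int \<Rightarrow> (nat \<Rightarrow> int) \<Rightarrow> bool" where
  "admissible a w i \<longleftrightarrow> (\<forall>l<a. 0 \<le> i l \<and> i l \<le> int a) \<and>
     w - int a < (\<Sum>l<a. i l) \<and> (\<Sum>l<a. i l) < w"

lemma edges_at_bounds:
  "Lo1 (edges_at a i j) = (\<Sum>l<a. i l)" "Hi1 (edges_at a i j) = (\<Sum>l<a. i l)"
  "Lo2 (edges_at a i j) = (\<Sum>l<a. j l)" "Hi2 (edges_at a i j) = (\<Sum>l<a. j l) + int a"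
  by (simp_all add: edges_at_def comp_def lo1_def hi1_def lo2_def hi2_def interv_sum_list_conv_sum_set_nat
      atLeast0LessThan sum.distrib)

lemma edges_at_grid:
  assumes "admissible a w i" "\<forall>l<a. 0 \<le> j l \<and> j l < int a"
  shows "set (edges_at a i j) \<subseteq> grid a \<times> grid a"
  using assms by (auto simp: edges_at_def admissible_def)

lemma length_edges_at [simp]: "length (edges_at a i j) = a"
  by (simp add: edges_at_def)

lemma edges_at_split:
  assumes "l < a"
  shows "edges_at a (i(l := x)) j =
    edges_at l i j @ ((x, j l), (x, j l + 1)) # map (\<lambda>l. ((i l, j l), (i l, j l + 1))) [Suc l..<a]"
proof -
  have "[0..<a] = [0..<l] @ l # [Suc l..<a]"
    using assms by (metis less_imp_le_nat upt_add_eq_append upt_conv_Cons le0 le_add_diff_inverse add_0)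
  then show ?thesis by (simp add: edges_at_def)
qed

lemma unit_vertical_edges_at: "\<forall>e\<in>set (edges_at a i j). unit_vertical e"
  by (auto simp: edges_at_def unit_vertical_def)

context strand
begin

definition strip_value :: "(nat \<Rightarrow> int) \<Rightarrow> (nat \<Rightarrow> int) \<Rightarrow> 'k" where
  "strip_value i j = F (long_edge a 0 # edges_at a i j)"

text \<open>The vertical edge sweeps out a unit square, whose two horizontal sides contribute 0 by
  \<open>F_long_edge_horizontal\<close>.\<close>

lemma strip_value_shift:
  assumes i: "admissible a w1 i" "admissible a w1 (i(l := i l + 1))" and l: "l < a"
    and j: "\<forall>l<a. 0 \<le> j l \<and> j l < int a"
  shows "strip_value i j = strip_value (i(l := i l + 1)) j"
proof -
  let ?i' = "i(l := i l + 1)"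
  define xs where "xs = edges_at l i j"
  define ys where "ys = map (\<lambda>l. ((i l, j l), (i l, j l + 1))) [Suc l..<a]"
  let ?p = "(i l, j l)" and ?p' = "(i l, j l + 1)" and ?q = "(i l + 1, j l)"
    and ?q' = "(i l + 1, j l + 1)"
  have e: "edges_at a i j = xs @ (?p, ?p') # ys" "edges_at a ?i' j = xs @ (?q, ?q') # ys"
    using edges_at_split[OF l, of i "i l" j] edges_at_split[OF l, of i "i l + 1" j]
    by (simp_all add: xs_def ys_def)
  have g: "set (xs @ (?p, ?p') # ys) \<subseteq> grid a \<times> grid a" "set (xs @ (?q, ?q') # ys) \<subseteq> grid a \<times> grid a"
    using edges_at_grid[OF i(1) j] edges_at_grid[OF i(2) j] by (simp_all only: e)
  have b: "w1 - int a < Lo1 (xs @ (?p, ?p') # ys)" "Hi1 (xs @ (?q, ?q') # ys) < w1"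
    using i edges_at_bounds[of a i j] edges_at_bounds[of a ?i' j] unfolding e admissible_def by auto
  have u: "\<forall>e\<in>set xs \<union> set ys. unit_vertical e"
    using unit_vertical_edges_at[of a i j] by (simp add: e)
  have len: "length (xs @ h # ys) = a" for h
    using length_edges_at[of a i j] unfolding e by simp
  have h: "F (long_edge a 0 # xs @ (?p, ?q) # ys) = 0" "F (long_edge a 0 # xs @ (?q', ?p') # ys) = 0"
    by (rule F_long_edge_horizontal; use g b u len in \<open>auto simp: lo1_def hi1_def horizontal_def\<close>)+
  show ?thesis
    using h F_split[of "long_edge a 0 # xs" ?p ?p' ys ?q] F_split[of "long_edge a 0 # xs" ?q ?p' ys ?q']
    unfolding strip_value_def e by simp
qed

text \<open>Unit steps towards \<open>i'\<close> can be ordered so that the column sum never leaves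
  its open interval: raise an entry while there is room above, lower one while there is room
  below.\<close>

lemma strip_value_connected:
  assumes i: "admissible a w1 i" "admissible a w1 i'" and j: "\<forall>l<a. 0 \<le> j l \<and> j l < int a"
  shows "strip_value i j = strip_value i' j"
  using i(1)
proof (induction "\<Sum>l<a. nat \<bar>i l - i' l\<bar>" arbitrary: i rule: less_induct)
  case less
  have closer: "(\<Sum>m<a. nat \<bar>(i(l := x)) m - i' m\<bar>) < (\<Sum>m<a. nat \<bar>i m - i' m\<bar>)"
    if "l < a" "nat \<bar>x - i' l\<bar> < nat \<bar>i l - i' l\<bar>" for l x
    using that by (intro sum_strict_mono_ex1) auto
  have upd: "(\<Sum>m<a. (i(l := x)) m) = (\<Sum>m<a. i m) + x - i l" if "l < a" for l x
    using that by (simp add: sum.remove[of "{..<a}" l])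
  have bnd: "0 \<le> i l" "i l \<le> int a" "0 \<le> i' l" "i' l \<le> int a" if "l < a" for l
    using that less.prems i(2) by (auto simp: admissible_def)
  consider "\<forall>l<a. i l = i' l" | l where "l < a" "i l < i' l" "(\<Sum>l<a. i l) < w1 - 1" |
    l where "l < a" "i' l < i l" "w1 - int a + 1 < (\<Sum>l<a. i l)" |
    "\<exists>l<a. i l < i' l" "\<forall>l<a. i l \<le> i' l" "w1 - 1 \<le> (\<Sum>l<a. i l)" |
    "\<exists>l<a. i' l < i l" "\<forall>l<a. i' l \<le> i l" "(\<Sum>l<a. i l) \<le> w1 - int a + 1"
  proof -
    note cases = that
    show ?thesis
    proof (cases "(\<exists>l<a. i l < i' l) \<and> (\<Sum>l<a. i l) < w1 - 1")
      case True
      then show ?thesis using cases(2) by blast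
    next
      case up: False
      show ?thesis
      proof (cases "(\<exists>l<a. i' l < i l) \<and> w1 - int a + 1 < (\<Sum>l<a. i l)")
        case True
        then show ?thesis using cases(3) by blast
      next
        case down: False
        show ?thesis
        proof (cases "\<exists>l<a. i l < i' l")
          case True
          \<comment> \<open>A sum at the upper end of the interval is strictly above the lower end
            only because a >= 3; for a = 2 no step would be possible.\<close>
          then have "w1 - int a + 1 < (\<Sum>l<a. i l)" using up a by auto
          then show ?thesis using True up down cases(4) by (meson linorder_not_less)
        next
          case False
          then show ?thesis using down cases(1,5) by (metis linorder_not_less order_antisym)
        qed
      qed
    qed
  qed
  then show ?case
  proof cases
    case 1
    then have "edges_at a i j = edges_at a i' j" by (auto simp: edges_at_def)
    then show ?thesis by (simp add: strip_value_def)
  next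
    case 2
    then have adm: "admissible a w1 (i(l := i l + 1))"
      using less.prems bnd[of l] upd[of l "i l + 1"] by (auto simp: admissible_def)
    have "strip_value (i(l := i l + 1)) j = strip_value i' j" by (rule less.hyps[OF closer adm]) (use 2 in auto)
    then show ?thesis using strip_value_shift[OF less.prems adm 2(1) j] by simp
  next
    case 3
    then have adm: "admissible a w1 (i(l := i l - 1))"
      using less.prems bnd[of l] upd[of l "i l - 1"] by (auto simp: admissible_def)
    have "strip_value (i(l := i l - 1)) j = strip_value i' j" by (rule less.hyps[OF closer adm]) (use 3 in auto)
    then show ?thesis using strip_value_shift[OF adm _ 3(1) j] less.prems by simp
  next
    case 4
    then have "(\<Sum>l<a. i l) < (\<Sum>l<a. i' l)" by (intro sum_strict_mono_ex1) auto
    then show ?thesis using 4 i(2) by (auto simp: admissible_def)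
  next
    case 5
    then have "(\<Sum>l<a. i' l) < (\<Sum>l<a. i l)" by (intro sum_strict_mono_ex1) auto
    then show ?thesis using 5 i(2) by (auto simp: admissible_def)
  qed
qed

text \<open>Two edges of equal height can be brought into a common column near their mean, where
  they coincide.\<close>

lemma strip_value_repeated:
  assumes i: "admissible a w1 i" and j: "\<forall>l<a. 0 \<le> j l \<and> j l < int a"
    and lk: "l < a" "k < a" "l \<noteq> k" "j l = j k"
  shows "strip_value i j = 0"
proof -
  define s where "s = i l + i k"
  have "(\<Sum>m<a. g m) = g l + g k + (\<Sum>m\<in>{..<a} - {l} - {k}. g m)" for g :: "nat \<Rightarrow> int"
    using lk by (simp add: sum.remove[of "{..<a}" l] sum.remove[of "{..<a} - {l}" k])
  from this[of i] this[of "i(l := x, k := x)" for x]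
  have upd: "(\<Sum>m<a. (i(l := x, k := x)) m) = (\<Sum>m<a. i m) + 2 * x - s" for x
    using lk by (simp add: s_def)
  have "0 \<le> i l" "i l \<le> int a" "0 \<le> i k" "i k \<le> int a"
    using i lk by (auto simp: admissible_def)
  then have x: "admissible a w1 (i(l := x, k := x))"
    if "x = s div 2 \<or> x = (s + 1) div 2" "w1 - int a < (\<Sum>m<a. i m) + 2 * x - s"
      "(\<Sum>m<a. i m) + 2 * x - s < w1" for x
    using i that unfolding admissible_def upd by (auto simp: s_def)
  have w: "w1 - int a < (\<Sum>m<a. i m)" "(\<Sum>m<a. i m) < w1" using i by (auto simp: admissible_def)
  \<comment> \<open>If \<open>s\<close> is odd, rounding changes the column sum by 1, down or up; as
    the interval contains at least two integers, one of the two is possible.\<close>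
  obtain x where "admissible a w1 (i(l := x, k := x))"
  proof (cases "w1 - int a < (\<Sum>m<a. i m) + 2 * (s div 2) - s")
    case True
    then show ?thesis using w(2) by (intro that[OF x[of "s div 2"]]) auto
  next
    case False
    have "2 * ((s + 1) div 2) \<le> s + 1" "s \<le> 2 * ((s + 1) div 2)"
      "(s + 1) div 2 = s div 2 \<or> 2 * ((s + 1) div 2) = s + 1" by presburger+
    then show ?thesis using False w a by (intro that[OF x[of "(s + 1) div 2"]]) auto
  qed
  then have "strip_value i j = strip_value (i(l := x, k := x)) j" by (rule strip_value_connected[OF i _ j])
  also have "edges_at a (i(l := x, k := x)) j ! l = edges_at a (i(l := x, k := x)) j ! k"
    using lk by (simp add: edges_at_def)
  then have "\<not> distinct (edges_at a (i(l := x, k := x)) j)"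
    using lk by (metis length_edges_at nth_eq_iff_index_eq)
  then have "\<not> distinct (long_edge a 0 # edges_at a (i(l := x, k := x)) j)" by simp
  then have "strip_value (i(l := x, k := x)) j = 0"
    unfolding strip_value_def by (rule alternating_not_distinct[OF alternating_F])
  finally show ?thesis .
qed

text \<open>Sorting the vertical edges by height costs only a sign, so the heights may be taken to
  be 0, ..., a - 1 in this order.\<close>

lemma strip_value_permuted:
  assumes i: "admissible a w1 i" and j: "\<forall>l<a. 0 \<le> j l \<and> j l < int a" "inj_on j {..<a}"
    and i0: "admissible a w1 i0" "strip_value i0 int = 0"
  shows "strip_value i j = 0"
proof -
  define \<pi> where "\<pi> l = nat (j l)" for l
  have inj: "inj_on \<pi> {..<a}"
    using j unfolding inj_on_def \<pi>_def by (metis lessThan_iff nat_eq_iff2)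
  have "\<pi> ` {..<a} \<subseteq> {..<a}" using j(1) by (auto simp: \<pi>_def)
  then have bij: "bij_betw \<pi> {..<a} {..<a}"
    using inj by (simp add: bij_betw_def endo_inj_surj)
  define i2 where "i2 m = i (inv_into {..<a} \<pi> m)" for m
  have i2: "i2 (\<pi> l) = i l" if "l < a" for l using inj that by (simp add: i2_def)
  have "(\<Sum>m<a. i2 m) = (\<Sum>l<a. i2 (\<pi> l))" by (rule sum.reindex_bij_betw[OF bij, symmetric])
  also have "\<dots> = (\<Sum>l<a. i l)" using i2 by simp
  finally have "admissible a w1 i2"
    using i bij_betw_inv_into[OF bij] unfolding admissible_def i2_def
    by (auto simp: bij_betw_def)
  then have z: "strip_value i2 int = 0" using strip_value_connected[of i2 i0 int] i0 by simp
  define g where "g m = ((i2 m, int m), (i2 m, int m + 1))" for m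
  have "edges_at a i j = map (g \<circ> \<pi>) [0..<a]"
    unfolding edges_at_def using i2 j(1) by (intro map_cong) (auto simp: g_def \<pi>_def)
  then have "mset (edges_at a i j) = image_mset g (image_mset \<pi> (mset [0..<a]))"
    by (simp only: mset_map multiset.map_comp)
  also have "image_mset \<pi> (mset [0..<a]) = mset [0..<a]"
    using bij inj by (simp add: image_mset_mset_set bij_betw_def atLeast0LessThan)
  also have "image_mset g (mset [0..<a]) = mset (edges_at a i2 int)"
    by (simp add: edges_at_def g_def[abs_def])
  finally have "mset (edges_at a i j) = mset (edges_at a i2 int)" .
  then have "mset (long_edge a 0 # edges_at a i j) = mset (long_edge a 0 # edges_at a i2 int)"
    by simp
  then show ?thesis using z unfolding strip_value_def by (rule alternating_permute_0[OF alternating_F])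
qed

lemma long_edge_free_if_strip_values_0:
  assumes "\<And>i j. admissible a w1 i \<Longrightarrow> \<forall>l<a. 0 \<le> j l \<and> j l < int a \<Longrightarrow> inj_on j {..<a} \<Longrightarrow> strip_value i j = 0"
  shows "long_edge_free a w1 f"
  unfolding long_edge_free_def
proof (intro allI impI)
  fix es assume es: "set es \<subseteq> grid a \<times> grid a" "length es = a" "w1 - int a < Lo1 es" "Hi1 es < w1"
    "\<forall>e\<in>set es. unit_vertical e"
  define i where "i l = fst (fst (es ! l))" for l
  define j where "j l = snd (fst (es ! l))" for l
  have el: "es ! l = ((i l, j l), (i l, j l + 1))" "(i l, j l) \<in> grid a" "(i l, j l + 1) \<in> grid a"
    if "l < a" for l
  proof -
    have "es ! l \<in> set es" using that es(2) by simp
    then have "unit_vertical (es ! l)" "es ! l \<in> grid a \<times> grid a" using es by auto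
    then show "es ! l = ((i l, j l), (i l, j l + 1))" "(i l, j l) \<in> grid a" "(i l, j l + 1) \<in> grid a"
      using grid_bounds[of "fst (es ! l)" a] grid_bounds[of "snd (es ! l)" a]
      by (auto simp: unit_vertical_def i_def j_def prod_eq_iff mem_Times_iff)
  qed
  have E: "es = edges_at a i j"
    using es(2) el by (intro nth_equalityI) (auto simp: edges_at_def)
  have i: "admissible a w1 i" using es(3,4) el(2) unfolding E edges_at_bounds admissible_def by simp
  have j: "\<forall>l<a. 0 \<le> j l \<and> j l < int a" using el(2,3) by force
  show "F (long_edge a 0 # es) = 0"
  proof (cases "inj_on j {..<a}")
    case True
    then show ?thesis using assms[OF i j] by (simp add: E strip_value_def)
  next
    case False
    then show ?thesis using strip_value_repeated[OF i j] by (auto simp: E strip_value_def inj_on_def)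
  qed
qed

lemma sum_inj:
  assumes "\<forall>l<a. 0 \<le> j l \<and> j l < int a" "inj_on j {..<a}"
  shows "2 * (\<Sum>l<a. j l) = int a * (int a - 1)"
proof -
  have "j ` {..<a} \<subseteq> {0..<int a}" using assms(1) by auto
  moreover have "card (j ` {..<a}) = card {0..<int a}" using assms(2) by (simp add: card_image)
  ultimately have "j ` {..<a} = {0..<int a}" by (intro card_subset_eq) auto
  then have "(\<Sum>l<a. j l) = \<Sum>{0..<int a}" using assms(2) by (simp add: sum.reindex[symmetric, of j "{..<a}" id, simplified])
  also have "{0..<int a} = int ` {..<a}"
    by (simp add: image_int_atLeastLessThan flip: atLeast0LessThan)
  also have "2 * \<Sum>(int ` {..<a}) = int a * (int a - 1)"
    by (simp add: sum.reindex) (induction a; simp add: algebra_simps)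
  finally show ?thesis by simp
qed

text \<open>Unit vertical edges span exactly the height a, which turns the bounds of
  \<open>F_long_edge_window2\<close> into an equality for \<open>w2\<close>. Distinct heights are 0,
  ..., a - 1, and the column sum lies between 0 and a^2.\<close>

lemma long_edge_free_off_strip:
  assumes "\<not> (2 * w2 = int a * (int a + 1) \<and> 0 < w1 \<and> w1 < int a * (int a + 1))"
  shows "long_edge_free a w1 f"
proof (rule long_edge_free_if_strip_values_0, rule ccontr)
  fix i j assume i: "admissible a w1 i" and j: "\<forall>l<a. 0 \<le> j l \<and> j l < int a" "inj_on j {..<a}"
    and "strip_value i j \<noteq> 0"
  then have nz: "F (long_edge a 0 # edges_at a i j) \<noteq> 0" by (simp add: strip_value_def)
  have b: "w1 - int a < Lo1 (edges_at a i j)" "Hi1 (edges_at a i j) < w1"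
    using i unfolding edges_at_bounds admissible_def by auto
  have "w2 = (\<Sum>l<a. j l) + int a"
    using F_long_edge_window2[OF edges_at_grid[OF i j(1)] b nz] unfolding edges_at_bounds by simp
  then have "2 * w2 = int a * (int a + 1)" using sum_inj[OF j] by (simp add: algebra_simps)
  moreover have "0 \<le> (\<Sum>l<a. i l)" using i by (intro sum_nonneg) (auto simp: admissible_def)
  moreover have "(\<Sum>l<a. i l) \<le> (\<Sum>l<a. int a)"
    using i by (intro sum_mono) (auto simp: admissible_def)
  ultimately show False using assms i by (auto simp: admissible_def algebra_simps)
qed

lemma long_edge_free_if_strip_value_0:
  assumes "admissible a w1 i0" "strip_value i0 int = 0"
  shows "long_edge_free a w1 f"
  by (rule long_edge_free_if_strip_values_0) (rule strip_value_permuted[OF _ _ _ assms])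

end

section \<open>Syzygies of the scrolls\<close>

definition total_order :: "('x \<Rightarrow> 'x \<Rightarrow> bool) \<Rightarrow> bool" where
  "total_order lt \<longleftrightarrow> (\<forall>x. \<not> lt x x) \<and> (\<forall>x y. x \<noteq> y \<longrightarrow> lt x y \<noteq> lt y x)"

text \<open>For distinct entries this is -1 to the number of inversions.\<close>

fun list_sign :: "('x \<Rightarrow> 'x \<Rightarrow> bool) \<Rightarrow> 'x list \<Rightarrow> 'k::field" where
  "list_sign lt [] = 1"
| "list_sign lt (x # xs) =
     (if x \<in> set xs then 0 else (- 1) ^ card {y \<in> set xs. lt y x} * list_sign lt xs)"

lemma list_sign_square: "distinct xs \<Longrightarrow> list_sign lt xs * list_sign lt xs = (1 :: 'k::field)"
proof (induction xs)
  case (Cons x xs)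
  let ?e = "(- 1 :: 'k) ^ card {y \<in> set xs. lt y x}"
  have "?e * ?e = 1" by (simp flip: power_add)
  moreover have "list_sign lt (x # xs) * list_sign lt (x # xs) =
      (?e * ?e) * (list_sign lt xs * list_sign lt xs)"
    using Cons.prems by (simp only: list_sign.simps distinct.simps if_False) (simp add: mult_ac)
  ultimately show ?case using Cons by simp
qed simp

lemma list_sign_not_distinct: "\<not> distinct xs \<Longrightarrow> list_sign lt xs = 0"
  by (induction xs) auto

lemma card_Collect_insert:
  assumes "finite S" "x \<notin> S"
  shows "card {y \<in> insert x S. P y} = card {y \<in> S. P y} + (if P x then 1 else 0)"
proof -
  have "{y \<in> insert x S. P y} = (if P x then insert x {y \<in> S. P y} else {y \<in> S. P y})" by auto
  then show ?thesis using assms by simp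
qed

lemma alternating_list_sign:
  assumes lt: "total_order lt"
  shows "alternating (list_sign lt :: 'x list \<Rightarrow> 'k::field)"
proof (rule alternatingI)
  fix xs ys :: "'x list" and x y
  show "list_sign lt (xs @ x # x # ys) = (0::'k)" by (rule list_sign_not_distinct) simp
  show "list_sign lt (xs @ x # y # ys) = - (list_sign lt (xs @ y # x # ys) :: 'k)"
  proof (induction xs)
    case Nil
    show ?case
    proof (cases "x = y \<or> x \<in> set ys \<or> y \<in> set ys")
      case False
      then have "card {z \<in> set (y # ys). lt z x} =
          card {z \<in> set ys. lt z x} + (if lt y x then 1 else 0)"
        "card {z \<in> set (x # ys). lt z y} = card {z \<in> set ys. lt z y} + (if lt x y then 1 else 0)"
        using card_Collect_insert[of "set ys" y "\<lambda>z. lt z x"]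
          card_Collect_insert[of "set ys" x "\<lambda>z. lt z y"] by simp_all
      moreover have "lt x y \<noteq> lt y x" using lt False unfolding total_order_def by blast
      ultimately show ?thesis using False by (auto simp: mult_ac)
    qed auto
  next
    case (Cons z xs)
    have s: "set (xs @ y # x # ys) = set (xs @ x # y # ys)" by auto
    show ?case using Cons.IH unfolding append_Cons list_sign.simps s by simp
  qed
qed

lemma list_sign_sorted:
  assumes "sorted_wrt (<) (xs :: int list)"
  shows "list_sign (<) xs = 1"
  using assms
proof (induction xs)
  case (Cons x xs)
  then have "{y \<in> set xs. y < x} = {}" "x \<notin> set xs" by auto
  then show ?case using Cons by (simp only: list_sign.simps) simp
qed simp

text \<open>This passes from lists to sets: the deleted element carries the sign of its rank, as in
  a differential on exterior powers.\<close>

lemma cobd_list_sign: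
  assumes lt: "total_order lt" and "distinct xs"
  shows "cobd (\<lambda>ys. list_sign lt ys * G (set ys)) xs =
    list_sign lt xs * (\<Sum>x\<in>set xs. (- 1) ^ card {y \<in> set xs. lt y x} * G (set xs - {x}))"
  using assms(2)
proof (induction xs arbitrary: G)
  case (Cons x xs)
  let ?c = "\<lambda>S t. card {y \<in> S. lt y t}"
  define G' where "G' S = (if x \<in> S then 0 else (- 1) ^ ?c S x) * G (insert x S)" for S
  have x: "x \<notin> set xs" "distinct xs" using Cons.prems by auto
  have "(\<lambda>ys. list_sign lt (x # ys) * G (set (x # ys))) = (\<lambda>ys. list_sign lt ys * G' (set ys))"
    by (auto simp: G'_def)
  then have "cobd (\<lambda>ys. list_sign lt ys * G (set ys)) (x # xs) =
      list_sign lt xs * G (set xs) -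
      list_sign lt xs * (\<Sum>t\<in>set xs. (- 1) ^ ?c (set xs) t * G' (set xs - {t}))"
    using Cons.IH[OF x(2), of G'] by simp
  also have "(\<Sum>t\<in>set xs. (- 1) ^ ?c (set xs) t * G' (set xs - {t})) =
      - (\<Sum>t\<in>set xs. (- 1) ^ ?c (set xs) x * ((- 1) ^ ?c (set (x # xs)) t * G (set (x # xs) - {t})))"
    unfolding sum_negf[symmetric]
  proof (rule sum.cong[OF refl])
    fix t assume t: "t \<in> set xs"
    have "set xs = insert t (set xs - {t})" using t by auto
    then have "?c (set xs) x = ?c (set xs - {t}) x + (if lt t x then 1 else 0)"
      using card_Collect_insert[of "set xs - {t}" t "\<lambda>y. lt y x"] by simp
    moreover have "?c (set (x # xs)) t = ?c (set xs) t + (if lt x t then 1 else 0)"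
      using card_Collect_insert[of "set xs" x "\<lambda>y. lt y t"] x by simp
    \<comment> \<open>Exactly one of the two ranks is shifted by the other element, which accounts
      for the single sign.\<close>
    moreover have "lt x t \<noteq> lt t x" using lt t x unfolding total_order_def by metis
    moreover have "insert x (set xs - {t}) = set (x # xs) - {t}" using t x by auto
    ultimately show "(- 1) ^ ?c (set xs) t * G' (set xs - {t}) =
        - ((- 1) ^ ?c (set xs) x * ((- 1) ^ ?c (set (x # xs)) t * G (set (x # xs) - {t})))"
      using x by (auto simp: G'_def mult_ac simp flip: power_add)
  qed
  finally have 1: "cobd (\<lambda>ys. list_sign lt ys * G (set ys)) (x # xs) =
      list_sign lt xs * (G (set xs) + (- 1) ^ ?c (set xs) x *
        (\<Sum>t\<in>set xs. (- 1) ^ ?c (set (x # xs)) t * G (set (x # xs) - {t})))"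
    by (simp add: algebra_simps sum_distrib_left)
  have "\<not> lt x x" using lt by (simp add: total_order_def)
  then have cx: "?c (set (x # xs)) x = ?c (set xs) x"
    using card_Collect_insert[of "set xs" x "\<lambda>y. lt y x"] x by simp
  have sq: "(- 1 :: 'b) ^ ?c (set xs) x * (- 1) ^ ?c (set xs) x = 1" by (simp flip: power_add)
  have "(\<Sum>t\<in>set (x # xs). (- 1) ^ ?c (set (x # xs)) t * G (set (x # xs) - {t})) =
      (- 1) ^ ?c (set (x # xs)) x * G (set (x # xs) - {x}) +
      (\<Sum>t\<in>set xs. (- 1) ^ ?c (set (x # xs)) t * G (set (x # xs) - {t}))"
    unfolding list.set(2) by (rule sum.insert[OF finite_set x(1)])
  also have "set (x # xs) - {x} = set xs" using x(1) by auto
  finally have 2: "(\<Sum>t\<in>set (x # xs). (- 1) ^ ?c (set (x # xs)) t * G (set (x # xs) - {t})) =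
      (- 1) ^ ?c (set xs) x * G (set xs) +
      (\<Sum>t\<in>set xs. (- 1) ^ ?c (set (x # xs)) t * G (set (x # xs) - {t}))"
    unfolding cx .
  have "list_sign lt (x # xs) = (- 1) ^ ?c (set xs) x * (list_sign lt xs :: 'b)" using x by simp
  then show ?case unfolding 1 2 using sq
    by (simp only: distrib_left mult.assoc mult.left_commute[of "list_sign lt xs"])
      (simp flip: mult.assoc)
qed simp

lemma edge_form_cobd: "edge_form (cobd g) es = on_edges g es"
  by (simp add: edge_form_def on_edges_diff on_edges_cobd)

lemma edge_form_swap:
  "edge_form (\<lambda>ts. f (map prod.swap ts)) es = edge_form f (map (map_prod prod.swap prod.swap) es)"
  using on_edges_map[of "\<lambda>ts. f ((0, 0) # ts)" prod.swap es] by (simp add: edge_form_def)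

lemma on_edges_single:
  assumes "\<And>ts. list_all2 endpoint ts es \<Longrightarrow> ts \<noteq> map snd es \<Longrightarrow> f ts = 0"
    and "\<forall>e\<in>set es. fst e \<noteq> snd e"
  shows "on_edges f es = f (map snd es)"
  using assms
proof (induction es arbitrary: f)
  case (Cons e es)
  obtain p q where e: "e = (p, q)" by fastforce
  have "on_edges (\<lambda>ts. f (q # ts)) es = f (q # map snd es)"
    by (rule Cons.IH) (use Cons.prems in \<open>auto simp: e\<close>)
  moreover have "on_edges (\<lambda>ts. f (p # ts)) es = on_edges (\<lambda>_. 0) es"
    by (rule on_edges_cong) (use Cons.prems in \<open>auto simp: e\<close>)
  ultimately show ?case by (simp add: e on_edges_Cons del: on_edges.simps)
qed simp

text \<open>
  The signed indicator of the sets with one point in each column, cut off at height \<open>v\<close>. Without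
  the cut its coboundary would vanish; the cut leaves in the coboundary only the sets whose height
  is in the window above \<open>v\<close>. These are the syzygies of the scroll swept out by the columns.
\<close>

definition scroll_form :: "nat \<Rightarrow> int \<Rightarrow> pt list \<Rightarrow> 'k::field" where
  "scroll_form a v ts =
     (if length ts = a + 1 \<and> sum2 ts < v then list_sign (<) (map fst ts) else 0)"

lemma alternating_scroll_form: "alternating (scroll_form a v :: pt list \<Rightarrow> 'k::field)"
proof (rule alternatingI)
  have alt: "alternating (list_sign (<) :: int list \<Rightarrow> 'k)"
    by (rule alternating_list_sign) (auto simp: total_order_def)
  fix xs ys and x y :: pt
  show "scroll_form a v (xs @ x # x # ys) = (0 :: 'k)"
    by (simp add: scroll_form_def list_sign_not_distinct)
  show "scroll_form a v (xs @ x # y # ys) = - (scroll_form a v (xs @ y # x # ys) :: 'k)"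
    using alternating_swap[OF alt, of "map fst xs" "fst x" "fst y" "map fst ys"]
    by (simp add: scroll_form_def add.left_commute)
qed

lemma scroll_form_nonzero:
  assumes "set ts \<subseteq> grid a" "scroll_form a v ts \<noteq> 0"
  shows "length ts = a + 1" "fst ` set ts = {0..int a}" "2 * sum1 ts = int a * (int a + 1)"
    "sum2 ts < v"
proof -
  show l: "length ts = a + 1" and "sum2 ts < v"
    using assms(2) by (auto simp: scroll_form_def split: if_splits)
  have d: "distinct (map fst ts)"
    using assms(2) list_sign_not_distinct by (auto simp: scroll_form_def split: if_splits)
  have "fst ` set ts \<subseteq> {0..int a}" using assms(1) by (auto simp: grid_def)
  moreover have "card (fst ` set ts) = card {0..int a}"
    using distinct_card[OF d] l by simp
  ultimately show s: "fst ` set ts = {0..int a}" by (intro card_subset_eq) auto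
  have "sum1 ts = \<Sum>{0..int a}"
    using sum_list_distinct_conv_sum_set[OF d, of id] s by (simp add: sum1_def)
  also have "{0..int a} = int ` {..a}" by (simp add: image_int_atLeastAtMost flip: atLeast0AtMost)
  also have "2 * \<Sum>(int ` {..a}) = int a * (int a + 1)"
    by (simp add: sum.reindex) (induction a; simp add: algebra_simps)
  finally show "2 * sum1 ts = int a * (int a + 1)" by simp
qed

text \<open>Among a + 2 points in a + 1 columns two, \<open>p\<close> and \<open>q\<close>, share a
  column. The terms of the coboundary that keep both vanish. The two others carry the same sign of
  columns and cancel unless the cut at \<open>v\<close> separates them.\<close>

lemma strand_scroll:
  assumes a: "a \<ge> 3" and w: "2 * w1 = int a * (int a + 1)"
  shows "strand a w1 v (cobd (scroll_form a v :: pt list \<Rightarrow> 'k::field))"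
proof
  let ?S = "scroll_form a v :: pt list \<Rightarrow> 'k"
  show "a \<ge> 3" by (rule a)
  show "alternating (cobd (?S))" by (intro alternating_cobd alternating_scroll_form)
  show "cobd (cobd (?S)) ts = 0" for ts by (rule cobd_cobd)
  fix ts assume ts: "set ts \<subseteq> grid a" and nz: "cobd (?S) ts \<noteq> 0"
  obtain xs t ys where t: "ts = xs @ t # ys" "?S (xs @ ys) \<noteq> 0"
    using cobd_nonzero[OF nz] by blast
  then have len: "length ts = a + 2" using scroll_form_nonzero[of "xs @ ys" a v] ts by auto
  have "fst ` set ts \<subseteq> {0..int a}" using ts by (auto simp: grid_def)
  then have "card (fst ` set ts) \<le> card {0..int a}" by (intro card_mono) auto
  then have "\<not> distinct (map fst ts)" using distinct_card[of "map fst ts"] len by auto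
  then obtain as bs cs x where "map fst ts = as @ [x] @ bs @ [x] @ cs"
    using not_distinct_decomp by blast
  then obtain as bs cs p q where "ts = as @ p # bs @ q # cs" "fst p = fst q"
    by (auto simp: map_eq_append_conv map_eq_Cons_conv append_eq_map_conv Cons_eq_map_conv)
  then obtain R where R: "mset ts = mset (p # q # R)" "fst p = fst q"
    by (metis mset.simps(2) mset_append union_mset_add_mset_right)
  have "set ts = set (p # q # R)" using R(1) by (rule mset_eq_setD)
  then have g: "p \<in> grid a" "q \<in> grid a" "set R \<subseteq> grid a" using ts by auto
  have S: "sum1 ts = fst p + fst q + sum1 R" "sum2 ts = snd p + snd q + sum2 R"
    using arg_cong[OF R(1), of "\<lambda>m. sum_mset (image_mset fst m)"]
      arg_cong[OF R(1), of "\<lambda>m. sum_mset (image_mset snd m)"]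
    by (simp_all add: sum1_def sum2_def sum_mset_sum_list flip: mset_map)
  have "cobd (?S) (p # q # R) \<noteq> 0"
    using alternating_permute_0[OF alternating_cobd[OF alternating_scroll_form] R(1)] nz by blast
  moreover have "?S (p # q # ts) = 0" for ts
    using R(2) by (simp add: scroll_form_def)
  ultimately have ne: "?S (q # R) \<noteq> ?S (p # R)" by simp
  then have "?S (q # R) \<noteq> 0 \<or> ?S (p # R) \<noteq> 0" by auto
  then have "2 * (fst p + sum1 R) = int a * (int a + 1)"
    using scroll_form_nonzero(3)[of "q # R" a v, where 'a = 'k] scroll_form_nonzero(3)[of "p # R" a v, where 'a = 'k] g R(2) by auto
  then have "2 * (fst p + sum1 R) = 2 * w1" using w by simp
  then have "sum1 ts - w1 = fst p" using S R(2) by simp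
  \<comment> \<open>One of the lists is below the cut and the other is not; restoring the missing
    point then gives a height between \<open>v\<close> and \<open>v + a\<close>.\<close>
  moreover have "(snd p + sum2 R < v) \<noteq> (snd q + sum2 R < v)"
    using ne R(2) by (auto simp: scroll_form_def split: if_splits)
  then have "0 \<le> sum2 ts - v" "sum2 ts - v \<le> int a"
    using S(2) grid_bounds[OF g(1)] grid_bounds[OF g(2)] by auto
  ultimately show "length ts = a + 2 \<and> sum1 ts - w1 \<in> {0..int a} \<and> sum2 ts - v \<in> {0..int a}"
    using len grid_bounds[OF g(1)] by auto
qed

section \<open>Strip values of coboundaries and scrolls\<close>

lemma endpoints_edges_at:
  assumes "list_all2 endpoint ts (long_edge a 0 # edges_at a i j)"
  shows "sum1 ts = (\<Sum>l<a. i l) \<or> sum1 ts = int a + (\<Sum>l<a. i l)"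
proof -
  obtain p ts' where p: "ts = p # ts'" "endpoint p (long_edge a 0)"
    "list_all2 endpoint ts' (edges_at a i j)"
    using assms by (auto simp: list_all2_Cons2)
  have "sum1 ts' = (\<Sum>l<a. i l)"
    using endpoints_bounds(1,2)[OF p(3)] unfolding edges_at_bounds by simp
  then show ?thesis using p(1,2) by (auto simp: endpoint_def long_edge_def)
qed

text \<open>A list of endpoints has as first sum the column sum or that plus a, and admissibility
  puts \<open>w\<close> strictly between the two. Hence strip values are defined on
  homology.\<close>

lemma long_edge_form_0:
  assumes g: "\<And>ts. set ts \<subseteq> grid a \<Longrightarrow> g ts \<noteq> 0 \<Longrightarrow> sum1 ts = w"
    and i: "admissible a w i"
  shows "on_edges g (long_edge a 0 # edges_at a i int) = 0"
proof -
  have "on_edges g (long_edge a 0 # edges_at a i int) =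
      on_edges (\<lambda>_. 0) (long_edge a 0 # edges_at a i int)"
  proof (rule on_edges_cong, rule ccontr)
    fix ts assume ts: "list_all2 endpoint ts (long_edge a 0 # edges_at a i int)" and "g ts \<noteq> 0"
    have "set (long_edge a 0 # edges_at a i int) \<subseteq> grid a \<times> grid a"
      using edges_at_grid[OF i, of int] by (auto simp: long_edge_def)
    then have "sum1 ts = w" using endpoints_subset[OF ts] g \<open>g ts \<noteq> 0\<close> by blast
    then show False using endpoints_edges_at[OF ts] i by (auto simp: admissible_def)
  qed
  then show ?thesis by simp
qed

lemma scroll_long_edge_0:
  assumes "2 * w = int a * (int a + 1)" "admissible a w i"
  shows "edge_form (cobd (scroll_form a v)) (long_edge a 0 # edges_at a i int) = (0 :: 'k::field)"
  unfolding edge_form_cobd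
proof (rule long_edge_form_0[OF _ assms(2)])
  fix ts assume "set ts \<subseteq> grid a" "scroll_form a v ts \<noteq> (0 :: 'k)"
  then have "2 * sum1 ts = 2 * w"
    using scroll_form_nonzero(3)[of ts a v, where 'a = 'k] assms(1) by simp
  then show "sum1 ts = w" by simp
qed

text \<open>After the exchange the long edge stands in column 0 and the other edges are steps from
  column l to column l + 1. Distinct columns force the right end of every step, so only two lists
  count; their heights differ by a and lie on different sides of \<open>v\<close>.\<close>

lemma scroll_long_edge_swap:
  assumes i: "admissible a v i"
  shows "edge_form (\<lambda>ts. cobd (scroll_form a v) (map prod.swap ts))
    (long_edge a 0 # edges_at a i int) = (- 1 :: 'k::field)"
proof -
  define hs where "hs = map (\<lambda>l. ((int l, i l), (int l + 1, i l))) [0..<a]"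
  have forced: "ts = map snd hs"
    if ts: "list_all2 endpoint ts hs" and d: "distinct (map fst ((0, z) # ts))" for z :: int and ts
  proof -
    have len: "length ts = a" using ts by (simp add: hs_def list_all2_lengthD)
    have e: "ts ! l = (int l, i l) \<or> ts ! l = (int l + 1, i l)" if "l < a" for l
      using list_all2_nthD[OF ts, of l] that len by (auto simp: hs_def endpoint_def)
    have col: "fst (((0, z) # ts) ! l) = int l" if "l \<le> a" for l
      using that
    proof (induction l)
      case (Suc l)
      define L where "L = (0, z) # ts"
      have "map fst L ! Suc l \<noteq> map fst L ! l"
        using nth_eq_iff_index_eq[OF d, of "Suc l" l] Suc.prems len unfolding L_def by simp
      then have "fst (((0, z) # ts) ! Suc l) \<noteq> fst (((0, z) # ts) ! l)"
        using Suc.prems len nth_map[of "Suc l" L fst] nth_map[of l L fst] by (simp add: L_def)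
      then show ?case using e[of l] Suc by auto
    qed simp
    show ?thesis
    proof (rule nth_equalityI)
      show "length ts = length (map snd hs)" using len by (simp add: hs_def)
      fix l assume "l < length ts"
      then show "ts ! l = map snd hs ! l" using e[of l] col[of "Suc l"] len by (auto simp: hs_def)
    qed
  qed
  have single: "on_edges (\<lambda>ts. scroll_form a v ((0, z) # ts)) hs =
      (scroll_form a v ((0, z) # map snd hs) :: 'k)" for z
  proof (rule on_edges_single)
    show "scroll_form a v ((0, z) # ts) = (0 :: 'k)"
      if "list_all2 endpoint ts hs" "ts \<noteq> map snd hs" for ts
      using forced[OF that(1)] that(2) list_sign_not_distinct[of "map fst ((0, z) # ts)" "(<)"]
      unfolding scroll_form_def by metis
  qed (auto simp: hs_def)
  have "map fst ((0, z) # map snd hs) = map int [0..<Suc a]" for z :: int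
    by (simp only: upt_rec[of 0 "Suc a"]) (simp add: hs_def comp_def map_Suc_upt[symmetric] del: upt_Suc)
  moreover have "sorted_wrt (<) (map int [0..<Suc a])"
    unfolding sorted_wrt_map by (rule sorted_wrt_mono_rel[OF _ sorted_wrt_upt]) simp
  ultimately have sgn: "list_sign (<) (map fst ((0, z) # map snd hs)) = (1 :: 'k)" for z :: int
    using list_sign_sorted by metis
  have "sum2 (map snd hs) = (\<Sum>l<a. i l)"
    by (simp add: hs_def sum2_def comp_def interv_sum_list_conv_sum_set_nat atLeast0LessThan)
  then have val: "scroll_form a v ((0, z) # map snd hs) = (if z + (\<Sum>l<a. i l) < v then 1 else 0 :: 'k)" for z
    using sgn[of z] by (simp add: scroll_form_def hs_def)
  have "map (map_prod prod.swap prod.swap) (long_edge a 0 # edges_at a i int) = ((0, 0), (0, int a)) # hs"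
    by (simp add: long_edge_def edges_at_def hs_def)
  then have "edge_form (\<lambda>ts. cobd (scroll_form a v) (map prod.swap ts))
      (long_edge a 0 # edges_at a i int) = on_edges (scroll_form a v) (((0, 0), (0, int a)) # hs)"
    by (simp only: edge_form_swap edge_form_cobd)
  also have "\<dots> = (- 1 :: 'k)"
    unfolding on_edges_Cons single val using i by (auto simp: admissible_def)
  finally show ?thesis .
qed

lemma ex_admissible:
  assumes "0 < w" "w < int a * (int a + 1)" "a \<ge> 3"
  shows "\<exists>i. admissible a w i"
proof -
  have ex: "\<exists>i. (\<forall>l<n. 0 \<le> i l \<and> i l \<le> int a) \<and> (\<Sum>l<n. i l) = s"
    if "0 \<le> s" "s \<le> int n * int a" for s :: int and n
    using that
  proof (induction n arbitrary: s)
    case (Suc n)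
    define x where "x = min s (int a)"
    have "0 \<le> int n * int a" by simp
    then have "0 \<le> s - x" "s - x \<le> int n * int a"
      using Suc.prems unfolding x_def by (auto simp: algebra_simps min_def)
    then obtain i where "\<forall>l<n. 0 \<le> i l \<and> i l \<le> int a" "(\<Sum>l<n. i l) = s - x"
      using Suc.IH by blast
    then show ?case
      using Suc.prems by (intro exI[of _ "i(n := x)"]) (auto simp: x_def less_Suc_eq)
  qed simp
  obtain i where "(\<forall>l<a. 0 \<le> i l \<and> i l \<le> int a) \<and> (\<Sum>l<a. i l) = max 0 (w - int a + 1)"
    using ex[of "max 0 (w - int a + 1)" a] assms by (auto simp: algebra_simps)
  then show ?thesis using assms by (intro exI[of _ i]) (auto simp: admissible_def)
qed

section \<open>Translation of the Koszul complex\<close>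

definition lex_less :: "pt \<Rightarrow> pt \<Rightarrow> bool" where
  "lex_less p q \<longleftrightarrow> lex_le p q \<and> p \<noteq> q"

lemma total_order_lex_less: "total_order lex_less"
  by (auto simp: total_order_def lex_less_def lex_le_def)

lemma finite_grid [simp]: "finite (grid a)"
  by (simp add: grid_def)

lemma card_grid: "int (card (grid a)) = (int a + 1) ^ 2"
  by (simp add: grid_def power2_eq_square)

lemma R_basis_1: "R_basis (int a) (int a) 1 = grid a"
  by (simp add: R_basis_def grid_def)

lemma R_basis_0: "R_basis (int a) (int a) 0 = {(0, 0)}"
  by (auto simp: R_basis_def)

text \<open>
  The exterior power of \<open>V\<close> is replaced by the complementary one of the dual space: the basis
  element of \<open>S\<close> becomes the dual basis element of \<open>grid a - S\<close>, up to the sign that turns the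
  Koszul differential into the simplicial coboundary.
\<close>

definition grid_sign :: "nat \<Rightarrow> pt set \<Rightarrow> 'k::field" where
  "grid_sign a T = (\<Prod>t\<in>T. (- 1) ^ position (grid a) t)"

text \<open>The second component \<open>\<Sum>T - w\<close> is the only one that gives the bidegree
  \<open>grid_total a - w\<close>.\<close>

definition dual_coeff :: "nat \<Rightarrow> pt \<Rightarrow> (tensor \<Rightarrow>\<^sub>0 'k::field) \<Rightarrow> pt set \<Rightarrow> 'k" where
  "dual_coeff a w \<phi> T = grid_sign a T * Poly_Mapping.lookup \<phi> (grid a - T, \<Sum>T - w)"

definition dual_form :: "nat \<Rightarrow> pt \<Rightarrow> (tensor \<Rightarrow>\<^sub>0 'k::field) \<Rightarrow> pt list \<Rightarrow> 'k" where
  "dual_form a w \<phi> ts = list_sign lex_less ts * dual_coeff a w \<phi> (set ts)"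

lemma grid_sign_square: "grid_sign a T * grid_sign a T = (1 :: 'k::field)"
  unfolding grid_sign_def prod.distrib[symmetric] by (simp flip: power_add)

lemma sum_set_pts: "distinct ts \<Longrightarrow> \<Sum>(set ts) = (sum1 ts, sum2 ts)"
  by (induction ts) (auto simp: zero_prod_def plus_prod_def)

lemma alternating_dual_form: "alternating (dual_form a w \<phi> :: pt list \<Rightarrow> 'k::field)"
proof (rule alternatingI)
  fix xs ys x y
  show "dual_form a w \<phi> (xs @ x # x # ys) = 0"
    by (simp add: dual_form_def list_sign_not_distinct)
  have "set (xs @ y # x # ys) = set (xs @ x # y # ys)" by auto
  moreover have "list_sign lex_less (xs @ x # y # ys) = - (list_sign lex_less (xs @ y # x # ys) :: 'k)"
    by (rule alternating_swap[OF alternating_list_sign[OF total_order_lex_less]])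
  ultimately show "dual_form a w \<phi> (xs @ x # y # ys) = - dual_form a w \<phi> (xs @ y # x # ys)"
    unfolding dual_form_def by (metis mult_minus_left)
qed

lemma dual_form_add: "dual_form a w (\<phi> + \<psi>) ts = dual_form a w \<phi> ts + dual_form a w \<psi> ts"
  by (simp add: dual_form_def dual_coeff_def lookup_add algebra_simps)

lemma dual_form_scale: "dual_form a w (pm_scale r \<phi>) ts = r * dual_form a w \<phi> ts"
  by (simp add: dual_form_def dual_coeff_def)

text \<open>Removing a point from a set adds it to the complement, so the sets that contribute at
  the complement of \<open>T\<close> are the complements of \<open>T - {t}\<close>.\<close>

lemma lookup_koszul_diff:
  assumes keys: "\<And>S m. (S, m) \<in> Poly_Mapping.keys \<phi> \<Longrightarrow> S \<subseteq> grid a" and T: "T \<subseteq> grid a"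
  shows "Poly_Mapping.lookup (koszul_diff \<phi>) (grid a - T, m) =
    (\<Sum>t\<in>T. (- 1) ^ position (grid a - (T - {t})) t *
      Poly_Mapping.lookup \<phi> (grid a - (T - {t}), m - t))"
proof -
  have fT: "finite T" using T finite_grid finite_subset by blast
  define z where "z t = (grid a - (T - {t}), m - t)" for t
  define c :: "tensor \<Rightarrow> 'a" where "c x = Poly_Mapping.lookup (koszul_diff_basis x) (grid a - T, m)" for x
  let ?X = "Poly_Mapping.keys \<phi> \<union> z ` T"
  have c: "c (S, n) = (\<Sum>s\<in>S. if (S - {s}, s + n) = (grid a - T, m) then (- 1) ^ position S s else 0)" for S n
    unfolding c_def koszul_diff_basis_def by (simp add: lookup_sum lookup_single when_def)
  have c0: "c x = 0" if "x \<in> ?X - z ` T" for x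
  proof -
    obtain S n where x: "x = (S, n)" by (cases x)
    have S: "S \<subseteq> grid a" using that keys x by blast
    have "(S - {s}, s + n) \<noteq> (grid a - T, m)" if s: "s \<in> S" for s
    proof
      assume eq: "(S - {s}, s + n) = (grid a - T, m)"
      then have "s \<in> T" "S = grid a - (T - {s})" "n = m - s" using s S T by auto
      then show False using that x \<open>x \<in> ?X - z ` T\<close> by (auto simp: z_def)
    qed
    then show ?thesis unfolding x c by (intro sum.neutral) auto
  qed
  have cz: "c (z t) = (- 1) ^ position (grid a - (T - {t})) t" if t: "t \<in> T" for t
  proof -
    let ?S = "grid a - (T - {t})"
    have "c (z t) = (\<Sum>s\<in>?S. if s = t then (- 1) ^ position ?S t else 0)"
      unfolding z_def c
    proof (rule sum.cong[OF refl])
      fix s assume s: "s \<in> ?S"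
      have "(?S - {s}, s + (m - t)) = (grid a - T, m) \<longleftrightarrow> s = t" using t T s by auto
      then show "(if (?S - {s}, s + (m - t)) = (grid a - T, m) then (- 1) ^ position ?S s else 0) =
        (if s = t then (- 1) ^ position ?S t else (0 :: 'a))" by simp
    qed
    also have "\<dots> = (- 1) ^ position ?S t" using t T by (subst sum.delta) auto
    finally show ?thesis .
  qed
  have inj: "inj_on z T" by (rule inj_onI) (simp add: z_def)
  have "koszul_diff \<phi> = (\<Sum>x\<in>?X. pm_scale (Poly_Mapping.lookup \<phi> x) (koszul_diff_basis x))"
    by (rule koszul_diff_superset) (use fT in auto)
  then have "Poly_Mapping.lookup (koszul_diff \<phi>) (grid a - T, m) =
      (\<Sum>x\<in>?X. Poly_Mapping.lookup \<phi> x * c x)"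
    by (simp add: lookup_sum c_def)
  also have "\<dots> = (\<Sum>x\<in>z ` T. Poly_Mapping.lookup \<phi> x * c x)"
    by (rule sum.mono_neutral_right) (use fT c0 in auto)
  also have "\<dots> = (\<Sum>t\<in>T. Poly_Mapping.lookup \<phi> (z t) * c (z t))"
    by (simp add: sum.reindex[OF inj])
  also have "\<dots> = (\<Sum>t\<in>T. (- 1) ^ position (grid a - (T - {t})) t *
      Poly_Mapping.lookup \<phi> (grid a - (T - {t}), m - t))"
    by (rule sum.cong[OF refl]) (simp add: cz, simp add: z_def mult.commute)
  finally show ?thesis .
qed

text \<open>Modulo 2 this trades the Koszul sign, a position in the complement, for the rank in
  \<open>T\<close> that the coboundary uses; the position in the whole grid is absorbed by
  \<open>grid_sign\<close>.\<close>

lemma position_complement: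
  assumes "T \<subseteq> grid a" "t \<in> T"
  shows "position (grid a) t = position (grid a - (T - {t})) t + card {s \<in> T. lex_less s t}"
proof -
  have fT: "finite T" using assms(1) finite_grid finite_subset by blast
  have "{s \<in> grid a. lex_le s t} = {s \<in> grid a - (T - {t}). lex_le s t} \<union> {s \<in> T. lex_less s t}"
    using assms by (auto simp: lex_less_def)
  moreover have "{s \<in> grid a - (T - {t}). lex_le s t} \<inter> {s \<in> T. lex_less s t} = {}"
    by (auto simp: lex_less_def)
  ultimately show ?thesis unfolding position_def using fT by (simp add: card_Un_disjoint)
qed

lemma dual_form_koszul_diff:
  assumes keys: "\<And>S m. (S, m) \<in> Poly_Mapping.keys \<phi> \<Longrightarrow> S \<subseteq> grid a" and ts: "set ts \<subseteq> grid a"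
  shows "dual_form a w (koszul_diff \<phi>) ts = cobd (dual_form a w \<phi>) (ts :: pt list)"
proof (cases "distinct ts")
  case False
  then show ?thesis
    using alternating_not_distinct[OF alternating_dual_form]
      alternating_not_distinct[OF alternating_cobd[OF alternating_dual_form]] by metis
next
  case True
  let ?T = "set ts"
  have "Poly_Mapping.lookup (koszul_diff \<phi>) (grid a - ?T, \<Sum>?T - w) =
      (\<Sum>t\<in>?T. (- 1) ^ position (grid a - (?T - {t})) t *
        Poly_Mapping.lookup \<phi> (grid a - (?T - {t}), \<Sum>?T - w - t))"
    by (rule lookup_koszul_diff[OF keys ts])
  then have "dual_coeff a w (koszul_diff \<phi>) ?T =
      (\<Sum>t\<in>?T. grid_sign a ?T * ((- 1) ^ position (grid a - (?T - {t})) t *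
        Poly_Mapping.lookup \<phi> (grid a - (?T - {t}), \<Sum>?T - w - t)))"
    unfolding dual_coeff_def by (simp add: sum_distrib_left)
  also have "\<dots> = (\<Sum>t\<in>?T. (- 1) ^ card {s \<in> ?T. lex_less s t} * dual_coeff a w \<phi> (?T - {t}))"
  proof (rule sum.cong[OF refl])
    fix t assume t: "t \<in> ?T"
    let ?k = "position (grid a - (?T - {t})) t"
    have "grid_sign a ?T = (- 1 :: 'a) ^ position (grid a) t * grid_sign a (?T - {t})"
      unfolding grid_sign_def using t by (simp add: prod.remove)
    moreover have "position (grid a) t = ?k + card {s \<in> ?T. lex_less s t}"
      by (rule position_complement[OF ts t])
    moreover have "(- 1 :: 'a) ^ ?k * (- 1) ^ ?k = 1" by (simp flip: power_add)
    moreover have m: "\<Sum>?T - w - t = \<Sum>(?T - {t}) - w"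
      using t by (simp add: sum.remove[of ?T t])
    ultimately show "grid_sign a ?T * ((- 1) ^ ?k *
        Poly_Mapping.lookup \<phi> (grid a - (?T - {t}), \<Sum>?T - w - t)) =
      (- 1) ^ card {s \<in> ?T. lex_less s t} * dual_coeff a w \<phi> (?T - {t})"
      unfolding dual_coeff_def m by (simp add: power_add mult_ac)
  qed
  finally show ?thesis
    using cobd_list_sign[OF total_order_lex_less True, of "dual_coeff a w \<phi>"]
    by (simp add: dual_form_def[abs_def])
qed

section \<open>Chains as alternating functions\<close>

definition grid_total :: "nat \<Rightarrow> pt" where "grid_total a = \<Sum>(grid a)"

lemma grid_total: "2 * fst (grid_total a) = int a * (int a + 1)\<^sup>2" "snd (grid_total a) = fst (grid_total a)"
proof -
  have s: "2 * \<Sum>{0..int a} = int a * (int a + 1)"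
  proof -
    have "{0..int a} = int ` {..a}" by (simp add: image_int_atLeastAtMost flip: atLeast0AtMost)
    also have "2 * \<Sum>(int ` {..a}) = int a * (int a + 1)"
      by (simp add: sum.reindex) (induction a; simp add: algebra_simps)
    finally show ?thesis .
  qed
  have "(\<Sum>p\<in>A \<times> B. fst p) = (\<Sum>i\<in>A. \<Sum>j\<in>B. i)" "(\<Sum>p\<in>A \<times> B. snd p) = (\<Sum>i\<in>A. \<Sum>j\<in>B. j)"
    for A B :: "int set"
    unfolding sum.cartesian_product by (rule sum.cong; auto)+
  then have "fst (grid_total a) = (int a + 1) * \<Sum>{0..int a}"
    "snd (grid_total a) = (int a + 1) * \<Sum>{0..int a}"
    unfolding grid_total_def fst_sum snd_sum grid_def by (simp_all flip: sum_distrib_left)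
  then show "2 * fst (grid_total a) = int a * (int a + 1)\<^sup>2" "snd (grid_total a) = fst (grid_total a)"
    using s by (auto simp: power2_eq_square algebra_simps)
qed

lemma koszul_space_keys:
  assumes "\<phi> \<in> koszul_space (int a) (int a) p q u" "(S, m) \<in> Poly_Mapping.keys \<phi>"
  shows "S \<subseteq> grid a" "int (card S) = p" "m \<in> R_basis (int a) (int a) q" "\<Sum>S + m = u"
  using assms by (auto simp: koszul_space_def koszul_basis_def bidegree_def R_basis_1)

lemma dual_form_nonzero:
  assumes \<phi>: "\<phi> \<in> koszul_space (int a) (int a) p q (grid_total a - w)"
    and ts: "set ts \<subseteq> grid a" "dual_form a w \<phi> ts \<noteq> 0"
  shows "p + int (length ts) = (int a + 1)\<^sup>2" "(sum1 ts - fst w, sum2 ts - snd w) \<in> R_basis (int a) (int a) q"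
proof -
  have d: "distinct ts" using ts(2) list_sign_not_distinct by (auto simp: dual_form_def)
  have "(grid a - set ts, \<Sum>(set ts) - w) \<in> Poly_Mapping.keys \<phi>"
    using ts(2) by (auto simp: dual_form_def dual_coeff_def in_keys_iff)
  note k = koszul_space_keys[OF \<phi> this]
  have "card (grid a - set ts) + length ts = card (grid a)"
    using card_Diff_subset[of "set ts" "grid a"] ts(1) card_mono[OF finite_grid ts(1)]
    by (simp add: distinct_card[OF d])
  then show "p + int (length ts) = (int a + 1)\<^sup>2" using k(2) card_grid[of a] by linarith
  show "(sum1 ts - fst w, sum2 ts - snd w) \<in> R_basis (int a) (int a) q"
    using k(3) sum_set_pts[OF d] by (simp add: minus_prod_def)
qed

lemma dual_form_inj:
  assumes \<phi>: "\<phi> \<in> koszul_space (int a) (int a) p q (grid_total a - w)"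
    and \<psi>: "\<psi> \<in> koszul_space (int a) (int a) p q (grid_total a - w)"
    and eq: "\<And>ts. set ts \<subseteq> grid a \<Longrightarrow> dual_form a w \<phi> ts = dual_form a w \<psi> ts"
  shows "\<phi> = \<psi>"
proof (rule poly_mapping_eqI)
  fix x :: tensor
  obtain S m where x: "x = (S, m)" by (cases x)
  show "Poly_Mapping.lookup \<phi> x = Poly_Mapping.lookup \<psi> x"
  proof (cases "S \<subseteq> grid a \<and> \<Sum>S + m = grid_total a - w")
    case False
    then have "x \<notin> Poly_Mapping.keys \<phi>" "x \<notin> Poly_Mapping.keys \<psi>"
      using koszul_space_keys[OF \<phi>, of S m] koszul_space_keys[OF \<psi>, of S m] x by blast+
    then show ?thesis by (simp add: in_keys_iff)
  next
    case True
    define T where "T = grid a - S"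
    have "finite T" by (simp add: T_def)
    then obtain ts where ts: "set ts = T" "distinct ts" using finite_distinct_list by blast
    have "grid_total a = \<Sum>S + \<Sum>T"
      unfolding grid_total_def T_def using True
      by (metis add.commute finite_grid sum.subset_diff)
    then have m: "m = \<Sum>T - w" using True by (simp add: algebra_simps)
    have S: "S = grid a - T" using True by (auto simp: T_def)
    have "dual_form a w \<phi> ts = dual_form a w \<psi> ts" by (rule eq) (simp add: ts T_def)
    moreover have "list_sign lex_less ts * list_sign lex_less ts = (1 :: 'a)"
      by (rule list_sign_square[OF ts(2)])
    then have "list_sign lex_less ts \<noteq> (0 :: 'a)" by auto
    ultimately have "grid_sign a T * Poly_Mapping.lookup \<phi> x = grid_sign a T * Poly_Mapping.lookup \<psi> x"
      by (simp add: dual_form_def dual_coeff_def ts x m flip: S)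
    moreover have "grid_sign a T \<noteq> (0 :: 'a)" using grid_sign_square[of a T, where 'k = 'a] by auto
    ultimately show ?thesis by simp
  qed
qed

text \<open>Surjectivity of the translation. Each set is listed in an arbitrary order; the sign of
  that order enters twice and cancels.\<close>

lemma ex_dual_form:
  fixes g :: "pt list \<Rightarrow> 'k::field"
  assumes alt: "alternating g"
    and g: "\<And>ts. set ts \<subseteq> grid a \<Longrightarrow> g ts \<noteq> 0 \<Longrightarrow> p + int (length ts) = (int a + 1)\<^sup>2 \<and>
      (sum1 ts - fst w, sum2 ts - snd w) \<in> R_basis (int a) (int a) q"
  shows "\<exists>\<phi>\<in>koszul_space (int a) (int a) p q (grid_total a - w).
    \<forall>ts. set ts \<subseteq> grid a \<longrightarrow> dual_form a w \<phi> ts = g ts"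
proof -
  define enum where "enum T = (SOME ts. set ts = T \<and> distinct ts)" for T :: "pt set"
  have enum: "set (enum T) = T" "distinct (enum T)" if "T \<subseteq> grid a" for T
  proof -
    have "\<exists>ts. set ts = T \<and> distinct ts"
      using finite_distinct_list finite_subset[OF that finite_grid] by blast
    then have "set (enum T) = T \<and> distinct (enum T)" unfolding enum_def by (rule someI_ex)
    then show "set (enum T) = T" "distinct (enum T)" by auto
  qed
  define c where "c T = grid_sign a T * (list_sign lex_less (enum T) * g (enum T))" for T
  define \<phi> where "\<phi> = (\<Sum>T\<in>Pow (grid a). Poly_Mapping.single (grid a - T, \<Sum>T - w) (c T))"
  have lookup: "Poly_Mapping.lookup \<phi> (S, m) =
      (\<Sum>T\<in>Pow (grid a). if (grid a - T, \<Sum>T - w) = (S, m) then c T else 0)" for S m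
    unfolding \<phi>_def by (simp add: lookup_sum lookup_single when_def)
  have lookup': "Poly_Mapping.lookup \<phi> (grid a - T, \<Sum>T - w) = c T" if T: "T \<subseteq> grid a" for T
  proof -
    have "Poly_Mapping.lookup \<phi> (grid a - T, \<Sum>T - w) = (\<Sum>T'\<in>Pow (grid a). if T' = T then c T' else 0)"
      unfolding lookup by (rule sum.cong[OF refl]) (use T in auto)
    also have "\<dots> = c T" using T by (subst sum.delta) auto
    finally show ?thesis .
  qed
  have "\<phi> \<in> koszul_space (int a) (int a) p q (grid_total a - w)"
    unfolding koszul_space_def
  proof (intro CollectI subsetI)
    fix x assume x: "x \<in> Poly_Mapping.keys \<phi>"
    obtain S m where x': "x = (S, m)" by (cases x)
    have "\<exists>T\<in>Pow (grid a). (grid a - T, \<Sum>T - w) = (S, m) \<and> c T \<noteq> 0"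
      using x sum.neutral[of "Pow (grid a)"
          "\<lambda>T. if (grid a - T, \<Sum>T - w) = (S, m) then c T else 0"]
      unfolding x' in_keys_iff lookup by meson
    then obtain T where T: "T \<subseteq> grid a" "S = grid a - T" "m = \<Sum>T - w" "c T \<noteq> 0" by auto
    then have "g (enum T) \<noteq> 0" by (auto simp: c_def)
    then have b: "p + int (length (enum T)) = (int a + 1)\<^sup>2"
      "(sum1 (enum T) - fst w, sum2 (enum T) - snd w) \<in> R_basis (int a) (int a) q"
      using g[of "enum T"] enum[OF T(1)] T(1) by auto
    have "length (enum T) = card T" using enum[OF T(1)] distinct_card by metis
    moreover have "card S + card T = card (grid a)"
      using card_Diff_subset[of T "grid a"] T card_mono[OF finite_grid T(1)]
        finite_subset[OF T(1) finite_grid] by simp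
    ultimately have "int (card S) = p" using b(1) card_grid[of a] by linarith
    moreover have "m = (sum1 (enum T) - fst w, sum2 (enum T) - snd w)"
      using sum_set_pts[OF enum(2)[OF T(1)]] enum(1)[OF T(1)] T(3) by (simp add: minus_prod_def)
    moreover have "\<Sum>S + m = grid_total a - w"
      unfolding T(2,3) grid_total_def using T(1)
      by (simp add: sum.subset_diff[OF T(1) finite_grid] algebra_simps)
    ultimately show "x \<in> koszul_basis (int a) (int a) p q \<and> bidegree x = grid_total a - w"
      using b(2) T(1,2) by (simp add: x' koszul_basis_def bidegree_def R_basis_1)
  qed
  moreover have "dual_form a w \<phi> ts = g ts" if ts: "set ts \<subseteq> grid a" for ts
  proof (cases "distinct ts")
    case False
    then show ?thesis
      using alternating_not_distinct[OF alt] alternating_not_distinct[OF alternating_dual_form] by metis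
  next
    case True
    let ?e = "enum (set ts)"
    have "mset ts = mset ?e"
      using True enum[OF ts] by (metis set_eq_iff_mset_eq_distinct)
    then obtain s :: 'k where s: "\<And>f. alternating f \<Longrightarrow> f ts = s * f ?e"
      using alternating_permute[where 'k = 'k] by blast
    have l: "list_sign lex_less ts = s * list_sign lex_less ?e"
      by (rule s[OF alternating_list_sign[OF total_order_lex_less]])
    have sq: "list_sign lex_less ?e * list_sign lex_less ?e = (1 :: 'k)"
      by (rule list_sign_square[OF enum(2)[OF ts]])
    have "dual_form a w \<phi> ts = s * list_sign lex_less ?e * (grid_sign a (set ts) *
        (grid_sign a (set ts) * (list_sign lex_less ?e * g ?e)))"
      by (simp only: dual_form_def dual_coeff_def lookup'[OF ts] l c_def)
    also have "\<dots> = (grid_sign a (set ts) * grid_sign a (set ts)) *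
        (list_sign lex_less ?e * list_sign lex_less ?e) * (s * g ?e)" by (simp only: mult_ac)
    also have "\<dots> = g ts" using s[OF alt] grid_sign_square[of a "set ts", where 'k = 'k] sq by simp
    finally show ?thesis .
  qed
  ultimately show ?thesis by blast
qed

section \<open>Dimensions\<close>

context vector_space
begin

text \<open>The functionals embed the quotient into the functions on \<open>I\<close>, and the
  elements \<open>z i\<close> show that the image is everything. The common value \<open>c\<close>
  will be -1 for the scrolls.\<close>

lemma quotient_dim_functionals:
  fixes L :: "'i \<Rightarrow> 'b \<Rightarrow> 'a" and z :: "'i \<Rightarrow> 'b"
  assumes Z: "subspace Z" and B: "subspace B" and I: "finite I"
    and add: "\<And>i x y. L i (x + y) = L i x + L i y" and mult: "\<And>i r x. L i (scale r x) = r * L i x"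
    and LB: "\<And>i x. i \<in> I \<Longrightarrow> x \<in> B \<Longrightarrow> L i x = 0"
    and z: "\<And>i. i \<in> I \<Longrightarrow> z i \<in> Z" "\<And>i j. i \<in> I \<Longrightarrow> j \<in> I \<Longrightarrow> L i (z j) = (if i = j then c else 0)" "c \<noteq> 0"
    and ker: "\<And>x. x \<in> Z \<Longrightarrow> (\<And>i. i \<in> I \<Longrightarrow> L i x = 0) \<Longrightarrow> x \<in> B"
  shows "quotient_dim Z B = card I"
proof -
  have inj: "inj_on z I"
    by (rule inj_onI) (metis z(2,3))
  have L0: "L i 0 = 0" for i using mult[of i 0 0] by simp
  have Lsum: "L i (\<Sum>x\<in>A. g x) = (\<Sum>x\<in>A. L i (g x))" for i g and A :: "'x set"
    by (induction A rule: infinite_finite_induct) (simp_all add: L0 add)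
  have Lcomb: "L i (\<Sum>x\<in>z ` I. scale (r x) x) = r (z i) * c" if "i \<in> I" for i r
  proof -
    have "L i (\<Sum>x\<in>z ` I. scale (r x) x) = (\<Sum>j\<in>I. if j = i then r (z i) * c else 0)"
      unfolding Lsum sum.reindex[OF inj] comp_def
      by (rule sum.cong[OF refl]) (use z(2) that in \<open>auto simp: mult\<close>)
    also have "\<dots> = r (z i) * c" using I that by simp
    finally show ?thesis .
  qed
  have "quotient_basis Z B (z ` I)"
    unfolding quotient_basis_def
  proof (intro conjI allI impI ballI)
    show "finite (z ` I)" using I by simp
    show "z ` I \<subseteq> Z" using z(1) by auto
    show "r x = 0" if r: "(\<Sum>x\<in>z ` I. scale (r x) x) \<in> B" and x: "x \<in> z ` I" for r x
    proof -
      obtain i where "i \<in> I" "x = z i" using x by auto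
      then show ?thesis using Lcomb[of i r] LB[OF _ r, of i] z(3) by simp
    qed
    fix x assume x: "x \<in> Z"
    define r where "r y = L (inv_into I z y) x / c" for y
    let ?y = "\<Sum>y\<in>z ` I. scale (r y) y"
    have yZ: "?y \<in> Z" using z(1) by (intro subspace_sum[OF Z] subspace_scale[OF Z]) auto
    have "x - ?y \<in> B"
    proof (rule ker)
      show "x - ?y \<in> Z" by (rule subspace_diff[OF Z x yZ])
      fix i assume i: "i \<in> I"
      have "L i ?y = L i x" unfolding Lcomb[OF i] using inj i z(3) by (simp add: r_def)
      then show "L i (x - ?y) = 0" using add[of i "x - ?y" ?y] by simp
    qed
    then show "\<exists>r. x - (\<Sum>y\<in>z ` I. scale (r y) y) \<in> B" by blast
  qed
  from quotient_dim_eqI[OF B this] show ?thesis using card_image[OF inj] by simp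
qed

end

lemma subspace_syzygy_cycles: "pm.subspace (syzygy_cycles a b p q u)"
  using subspace_koszul_space[of a b p q u] unfolding pm.subspace_def syzygy_cycles_def
  by (auto simp: koszul_diff_add koszul_diff_scale)

lemma subspace_syzygy_boundaries:
  "pm.subspace (syzygy_boundaries a b p q u :: (tensor \<Rightarrow>\<^sub>0 'k::field) set)"
proof -
  note W = subspace_koszul_space[of a b "p + 1" "q - 1" u, where 'a = 'k]
  show ?thesis
    unfolding pm.subspace_def syzygy_boundaries_def
  proof (intro conjI ballI allI)
    show "(0 :: tensor \<Rightarrow>\<^sub>0 'k) \<in> koszul_diff ` koszul_space a b (p + 1) (q - 1) u"
      using pm.subspace_0[OF W] by (metis image_eqI koszul_diff_zero)
    fix x :: "tensor \<Rightarrow>\<^sub>0 'k" and r assume "x \<in> koszul_diff ` koszul_space a b (p + 1) (q - 1) u"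
    then obtain f where f: "f \<in> koszul_space a b (p + 1) (q - 1) u" "x = koszul_diff f" by blast
    show "pm_scale r x \<in> koszul_diff ` koszul_space a b (p + 1) (q - 1) u"
      using pm.subspace_scale[OF W f(1)] f(2) by (metis image_eqI koszul_diff_scale)
    fix y :: "tensor \<Rightarrow>\<^sub>0 'k" assume "y \<in> koszul_diff ` koszul_space a b (p + 1) (q - 1) u"
    then obtain g where g: "g \<in> koszul_space a b (p + 1) (q - 1) u" "y = koszul_diff g" by blast
    show "x + y \<in> koszul_diff ` koszul_space a b (p + 1) (q - 1) u"
      using pm.subspace_add[OF W f(1) g(1)] f(2) g(2) by (metis image_eqI koszul_diff_add)
  qed
qed

lemma edge_form_add: "edge_form (\<lambda>ts. f ts + g ts) es = edge_form f es + edge_form g es"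
  by (simp add: edge_form_def on_edges_add)

lemma edge_form_scale: "edge_form (\<lambda>ts. r * f ts) es = r * edge_form f es"
  by (simp add: edge_form_def on_edges_scale)

lemma edge_form_cong:
  assumes "set es \<subseteq> grid a \<times> grid a" "\<And>ts. set ts \<subseteq> grid a \<Longrightarrow> f ts = g ts"
  shows "edge_form f es = edge_form g es"
  unfolding edge_form_def
  by (rule on_edges_cong, rule assms(2)) (use endpoints_subset[OF _ assms(1)] in auto)

text \<open>The index \<open>True\<close> stands for exchanged coordinates.\<close>

definition direction :: "bool \<Rightarrow> pt list \<Rightarrow> pt list" where
  "direction s ts = (if s then map prod.swap ts else ts)"

definition coord :: "bool \<Rightarrow> pt \<Rightarrow> int" where
  "coord s w = (if s then snd w else fst w)"

text \<open>The equation fixes the line on which a long edge of this direction can be seen, and the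
  strict bounds are those under which admissible columns exist
  (\<open>ex_admissible\<close>).\<close>

definition on_strip :: "nat \<Rightarrow> pt \<Rightarrow> bool \<Rightarrow> bool" where
  "on_strip a w s \<longleftrightarrow> 2 * coord (\<not> s) w = int a * (int a + 1) \<and>
     0 < coord s w \<and> coord s w < int a * (int a + 1)"

definition strip_edges :: "nat \<Rightarrow> int \<Rightarrow> (pt \<times> pt) list" where
  "strip_edges a v = long_edge a 0 # edges_at a (SOME i. admissible a v i) int"

lemma direction_facts:
  "set ts \<subseteq> grid a \<Longrightarrow> set (direction s ts) \<subseteq> grid a"
  "direction s (direction s ts) = ts"
  by (cases s; simp add: direction_def swap_grid del: set_map)+

lemma strip_admissible:
  assumes "on_strip a w s" "a \<ge> 3"
  shows "admissible a (coord s w) (SOME i. admissible a (coord s w) i)"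
proof -
  have "\<exists>i. admissible a (coord s w) i"
    by (rule ex_admissible) (use assms in \<open>auto simp: on_strip_def\<close>)
  then show ?thesis by (rule someI_ex)
qed

lemma strip_edges_grid:
  assumes "on_strip a w s" "a \<ge> 3"
  shows "set (strip_edges a (coord s w)) \<subseteq> grid a \<times> grid a"
  using edges_at_grid[OF strip_admissible[OF assms], of int]
  by (auto simp: strip_edges_def long_edge_def)

theorem syzygy_dim_strip:
  fixes w :: pt
  assumes a: "a \<ge> 3"
  shows "syzygy_dim TYPE('k::field) (int a) (int a) ((int a)\<^sup>2 + int a - 1) 1 (grid_total a - w) =
    card {s. on_strip a w s}"
proof -
  define p where "p = (int a)\<^sup>2 + int a - 1"
  define u where "u = grid_total a - w"
  define D where "D = (dual_form a w :: _ \<Rightarrow> pt list \<Rightarrow> 'k)"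
  define Z where "Z = (syzygy_cycles (int a) (int a) p 1 u :: (tensor \<Rightarrow>\<^sub>0 'k) set)"
  define B where "B = (syzygy_boundaries (int a) (int a) p 1 u :: (tensor \<Rightarrow>\<^sub>0 'k) set)"
  define I where "I = {s. on_strip a w s}"
  define L where "L s \<phi> = edge_form (\<lambda>ts. D \<phi> (direction s ts)) (strip_edges a (coord s w))" for s \<phi>
  \<comment> \<open>This is the origin of the lengths: the complement of p points of the grid has a
    + 2 points, that of p + 1 points has a + 1.\<close>
  have N: "(int a + 1)\<^sup>2 = p + int a + 2" by (simp add: p_def power2_eq_square algebra_simps)
  have dual_diff: "D (koszul_diff \<phi>) ts = cobd (D \<phi>) ts"
    if "\<phi> \<in> koszul_space (int a) (int a) p' q' u'" "set ts \<subseteq> grid a" for \<phi> p' q' u' ts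
    unfolding D_def by (rule dual_form_koszul_diff) (use koszul_space_keys(1)[OF that(1)] that(2) in auto)
  have strand_of: "strand a (fst w) (snd w) (D \<phi>)" if "\<phi> \<in> Z" for \<phi>
  proof
    have \<phi>: "\<phi> \<in> koszul_space (int a) (int a) p 1 u" "koszul_diff \<phi> = 0"
      using that by (auto simp: Z_def syzygy_cycles_def)
    show "a \<ge> 3" by (rule a)
    show "alternating (D \<phi>)" unfolding D_def by (rule alternating_dual_form)
    fix ts assume ts: "set ts \<subseteq> grid a"
    show "cobd (D \<phi>) ts = 0"
      using dual_diff[OF \<phi>(1) ts] \<phi>(2) by (simp add: D_def dual_form_def dual_coeff_def)
    assume "D \<phi> ts \<noteq> 0"
    then show "length ts = a + 2 \<and> sum1 ts - fst w \<in> {0..int a} \<and> sum2 ts - snd w \<in> {0..int a}"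
      using dual_form_nonzero[of \<phi> a p 1 w ts] \<phi>(1) ts N by (auto simp: u_def D_def R_basis_1)
  qed
  have swapped: "strand a (coord s w) (coord (\<not> s) w) (\<lambda>ts. D \<phi> (direction s ts))" if "\<phi> \<in> Z" for s \<phi>
    using strand.strand_swap[OF strand_of[OF that]] strand_of[OF that]
    by (cases s) (simp_all add: direction_def coord_def)
  have exact_of: "\<phi> \<in> B"
    if g: "exact_form a (fst w) (snd w) g" "\<And>ts. set ts \<subseteq> grid a \<Longrightarrow> D \<phi> ts = cobd g ts"
      and \<phi>: "\<phi> \<in> Z" for \<phi> g
  proof -
    have "p + 1 + int (length ts) = (int a + 1)\<^sup>2 \<and>
        (sum1 ts - fst w, sum2 ts - snd w) \<in> R_basis (int a) (int a) 0"
      if "set ts \<subseteq> grid a" "g ts \<noteq> 0" for ts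
      using g(1) that N unfolding exact_form_def R_basis_0 by auto
    moreover have "alternating g" using g(1) by (simp add: exact_form_def)
    ultimately obtain \<gamma> where \<gamma>: "\<gamma> \<in> koszul_space (int a) (int a) (p + 1) 0 u"
      "\<And>ts. set ts \<subseteq> grid a \<Longrightarrow> D \<gamma> ts = g ts"
      using ex_dual_form[of g a "p + 1" w 0] unfolding u_def D_def by blast
    have "koszul_diff \<gamma> \<in> koszul_space (int a) (int a) p 1 u"
      using koszul_diff_space[OF \<gamma>(1)] by simp
    moreover have "D \<phi> ts = D (koszul_diff \<gamma>) ts" if ts: "set ts \<subseteq> grid a" for ts
      unfolding dual_diff[OF \<gamma>(1) ts] g(2)[OF ts]
      by (rule cobd_cong) (use \<gamma>(2) ts in auto)
    ultimately have "\<phi> = koszul_diff \<gamma>"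
      using \<phi> unfolding Z_def syzygy_cycles_def u_def D_def by (intro dual_form_inj) auto
    then show ?thesis using \<gamma>(1) by (simp add: B_def syzygy_boundaries_def)
  qed
  have ker: "\<phi> \<in> B" if \<phi>: "\<phi> \<in> Z" "\<And>s. s \<in> I \<Longrightarrow> L s \<phi> = 0" for \<phi>
  proof -
    have free: "long_edge_free a (coord s w) (\<lambda>ts. D \<phi> (direction s ts))" for s
    proof -
      interpret strand a "coord s w" "coord (\<not> s) w" "\<lambda>ts. D \<phi> (direction s ts)"
        by (rule swapped[OF \<phi>(1)])
      show ?thesis
      proof (cases "s \<in> I")
        case True
        then have s: "on_strip a w s" by (simp add: I_def)
        show ?thesis
          by (rule long_edge_free_if_strip_value_0[OF strip_admissible[OF s a]])
            (use \<phi>(2)[OF True] in \<open>simp add: strip_value_def L_def strip_edges_def\<close>)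
      next
        case False
        then show ?thesis by (intro long_edge_free_off_strip) (simp add: I_def on_strip_def)
      qed
    qed
    interpret strand a "fst w" "snd w" "D \<phi>" by (rule strand_of[OF \<phi>(1)])
    interpret balanced_strand a "fst w" "snd w" "D \<phi>"
      by unfold_locales (use free[of False] free[of True] in \<open>simp_all add: direction_def coord_def\<close>)
    from balanced_imp_coboundary show ?thesis using exact_of \<phi>(1) by blast
  qed
  have LB: "L s \<phi> = 0" if s: "s \<in> I" and \<phi>: "\<phi> \<in> B" for s \<phi>
  proof -
    have s': "on_strip a w s" using s by (simp add: I_def)
    obtain \<gamma> where \<gamma>: "\<gamma> \<in> koszul_space (int a) (int a) (p + 1) 0 u" "\<phi> = koszul_diff \<gamma>"
      using \<phi> by (auto simp: B_def syzygy_boundaries_def)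
    have "L s \<phi> = edge_form (cobd (\<lambda>ts. D \<gamma> (direction s ts))) (strip_edges a (coord s w))"
      unfolding L_def
    proof (rule edge_form_cong[OF strip_edges_grid[OF s' a]])
      fix ts assume ts: "set ts \<subseteq> grid a"
      have "cobd (\<lambda>ts. D \<gamma> (direction s ts)) ts = cobd (D \<gamma>) (direction s ts)"
        by (cases s) (simp_all add: direction_def cobd_map)
      then show "D \<phi> (direction s ts) = cobd (\<lambda>ts. D \<gamma> (direction s ts)) ts"
        unfolding \<gamma>(2) using dual_diff[OF \<gamma>(1) direction_facts(1)[OF ts]] by simp
    qed
    also have "\<dots> = 0"
      unfolding edge_form_cobd strip_edges_def
    proof (rule long_edge_form_0[OF _ strip_admissible[OF s' a]])
      fix ts assume ts: "set ts \<subseteq> grid a" "D \<gamma> (direction s ts) \<noteq> 0"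
      then have "(sum1 (direction s ts) - fst w, sum2 (direction s ts) - snd w) \<in> R_basis (int a) (int a) 0"
        using dual_form_nonzero(2)[of \<gamma> a "p + 1" 0 w] \<gamma>(1) direction_facts(1)[of ts a s]
        by (simp add: u_def D_def)
      then show "sum1 ts = coord s w"
        by (cases s) (simp_all add: R_basis_0 direction_def coord_def sum_swap)
    qed
    finally show ?thesis .
  qed
  have "\<exists>\<phi>\<in>Z. \<forall>t\<in>I. L t \<phi> = (if t = s then - 1 else 0)" if s: "s \<in> I" for s
  proof -
    have s': "on_strip a w s" using s by (simp add: I_def)
    define v where "v = coord s w"
    \<comment> \<open>The scroll is taken in the direction other than \<open>s\<close>, since a
      scroll is detected exactly by the strip with exchanged coordinates.\<close>
    define g :: "pt list \<Rightarrow> 'k" where "g ts = cobd (scroll_form a v) (direction (\<not> s) ts)" for ts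
    have S: "strand a (coord (\<not> s) w) v (cobd (scroll_form a v :: pt list \<Rightarrow> 'k))"
      using s' a by (intro strand_scroll) (auto simp: on_strip_def)
    have G: "strand a (fst w) (snd w) g"
      using S strand.strand_swap[OF S]
      by (cases s) (simp_all add: direction_def coord_def v_def g_def[abs_def])
    then interpret G: strand a "fst w" "snd w" g .
    have "p + int (length ts) = (int a + 1)\<^sup>2 \<and>
        (sum1 ts - fst w, sum2 ts - snd w) \<in> R_basis (int a) (int a) 1"
      if "set ts \<subseteq> grid a" "g ts \<noteq> 0" for ts
      using G.window[OF that] N by (auto simp: R_basis_1)
    from ex_dual_form[OF G.alt this] obtain \<phi> where
      \<phi>: "\<phi> \<in> koszul_space (int a) (int a) p 1 u" "\<And>ts. set ts \<subseteq> grid a \<Longrightarrow> D \<phi> ts = g ts"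
      unfolding u_def D_def by blast
    have "koszul_diff \<phi> = 0"
    proof (rule dual_form_inj[of _ a "p - 1" 2 w])
      show "koszul_diff \<phi> \<in> koszul_space (int a) (int a) (p - 1) 2 (grid_total a - w)"
        using koszul_diff_space[OF \<phi>(1)] by (simp add: u_def)
      show "0 \<in> koszul_space (int a) (int a) (p - 1) 2 (grid_total a - w)"
        by (simp add: koszul_space_def)
      fix ts assume ts: "set ts \<subseteq> grid a"
      have "D (koszul_diff \<phi>) ts = cobd g ts"
        unfolding dual_diff[OF \<phi>(1) ts] by (rule cobd_cong) (use \<phi>(2) ts in auto)
      also have "\<dots> = 0" by (rule G.closed[OF ts])
      finally show "dual_form a w (koszul_diff \<phi>) ts = dual_form a w 0 ts"
        by (simp add: D_def dual_form_def dual_coeff_def)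
    qed
    then have "\<phi> \<in> Z" using \<phi>(1) by (simp add: Z_def syzygy_cycles_def)
    moreover have "L t \<phi> = (if t = s then - 1 else 0)" if t: "t \<in> I" for t
    proof -
      have t': "on_strip a w t" using t by (simp add: I_def)
      have "L t \<phi> = edge_form (\<lambda>ts. g (direction t ts)) (strip_edges a (coord t w))"
        unfolding L_def
        by (rule edge_form_cong[OF strip_edges_grid[OF t' a]]) (simp add: \<phi>(2) direction_facts(1))
      also have "\<dots> = (if t = s then - 1 else 0)"
      proof (cases "t = s")
        case True
        have "g (direction t ts) = cobd (scroll_form a v) (map prod.swap ts)" for ts
          unfolding g_def True direction_def by (cases s) (simp_all add: comp_def)
        then show ?thesis
          using scroll_long_edge_swap[OF strip_admissible[OF t' a], where 'k = 'k] True
          by (simp add: strip_edges_def v_def)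
      next
        case False
        then have ts: "t = (\<not> s)" by auto
        have "g (direction t ts) = cobd (scroll_form a v) ts" for ts
          unfolding g_def ts direction_facts(2) ..
        moreover have "2 * coord t w = int a * (int a + 1)" using s' ts by (simp add: on_strip_def)
        ultimately show ?thesis
          using scroll_long_edge_0[OF _ strip_admissible[OF t' a], where 'k = 'k] False
          by (simp add: strip_edges_def)
      qed
      finally show ?thesis .
    qed
    ultimately show ?thesis by blast
  qed
  then obtain z where z: "\<And>s. s \<in> I \<Longrightarrow> z s \<in> Z"
    "\<And>s t. s \<in> I \<Longrightarrow> t \<in> I \<Longrightarrow> L t (z s) = (if t = s then - 1 else 0)" by metis
  have "pm.quotient_dim Z B = card I"
  proof (rule pm.quotient_dim_functionals[of Z B I L z "- 1"])
    show "pm.subspace Z" unfolding Z_def by (rule subspace_syzygy_cycles)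
    show "pm.subspace B" unfolding B_def by (rule subspace_syzygy_boundaries)
    show "finite I" by simp
    show "L i (x + y) = L i x + L i y" for i x y
      by (simp add: L_def D_def dual_form_add edge_form_add)
    show "L i (pm_scale r x) = r * L i x" for i r x
      by (simp add: L_def D_def dual_form_scale edge_form_scale)
  qed (use LB z ker in auto)
  then show ?thesis by (simp add: syzygy_dim_def Z_def B_def I_def p_def u_def)
qed

theorem proposition8:
  fixes a p c :: int
  assumes "a \<ge> 3"
    and "p = a^2 + a - 1"
    and "c = a^2 * (a + 1) div 2"
  shows "syzygy_dim TYPE('k::field) a a p 1 (c, c) = 2 \<and>
    (\<forall>d. d \<noteq> c \<and> \<bar>d - c\<bar> < a * (a + 1) div 2 \<longrightarrow>
       syzygy_dim TYPE('k) a a p 1 (c, d) = 1 \<and> syzygy_dim TYPE('k) a a p 1 (d, c) = 1) \<and>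
    (\<forall>u. u \<noteq> (c, c) \<and>
       \<not> (\<exists>d. d \<noteq> c \<and> \<bar>d - c\<bar> < a * (a + 1) div 2 \<and> (u = (c, d) \<or> u = (d, c))) \<longrightarrow>
       syzygy_dim TYPE('k) a a p 1 u = 0)"
proof -
  define n where "n = nat a"
  have n: "a = int n" "n \<ge> 3" using assms(1) by (auto simp: n_def)
  define e where "e = a * (a + 1) div 2"
  have e2: "2 * e = a * (a + 1)" unfolding e_def by simp
  have c2: "2 * c = a * (2 * e)"
  proof -
    have "a^2 * (a + 1) = 2 * (a * e)" using e2 by (simp add: power2_eq_square algebra_simps)
    then show ?thesis using assms(3) by simp
  qed
  define \<sigma> where "\<sigma> = fst (grid_total n)"
  have \<sigma>: "grid_total n = (\<sigma>, \<sigma>)" using grid_total(2)[of n] by (simp add: \<sigma>_def prod_eq_iff)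
  have "2 * \<sigma> = (a + 1) * (2 * e)"
    using grid_total(1)[of n] unfolding e2 \<sigma>_def n(1) by (simp add: power2_eq_square algebra_simps)
  then have \<sigma>c: "\<sigma> = c + e" using c2 by (simp add: algebra_simps)
  have e0: "e > 0" using assms(1) e2 by (metis mult_pos_pos zero_less_mult_pos zero_less_numeral add_pos_pos zero_less_one less_le_trans)
  \<comment> \<open>Since \<open>\<sigma> = c + e\<close>, the substitution turns a coordinate equal
    to e into one equal to c, and the open interval from 0 to 2 e into the one of radius e around
    c.\<close>
  have strip: "on_strip n (\<sigma> - x, \<sigma> - y) s \<longleftrightarrow>
      (if s then x = c \<and> \<bar>y - c\<bar> < e else y = c \<and> \<bar>x - c\<bar> < e)" for x y s
    unfolding on_strip_def n(1)[symmetric] e2[symmetric] coord_def using \<sigma>c by auto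
  have dim: "syzygy_dim TYPE('k) a a p 1 (x, y) =
      card {s. if s then x = c \<and> \<bar>y - c\<bar> < e else y = c \<and> \<bar>x - c\<bar> < e}" for x y
  proof -
    have "(x, y) = grid_total n - (\<sigma> - x, \<sigma> - y)" by (simp add: \<sigma> minus_prod_def)
    then show ?thesis
      using syzygy_dim_strip[OF n(2), of "(\<sigma> - x, \<sigma> - y)", where 'k = 'k] assms(2)
      unfolding strip n(1)[symmetric] by simp
  qed
  have card: "card {s. if s then P else Q} = (if P then 1 else 0) + (if Q then 1 else 0)" for P Q
  proof -
    have "{s. if s then P else Q} = (if P then {True} else {}) \<union> (if Q then {False} else {})" by auto
    then show ?thesis by simp
  qed
  show ?thesis
    unfolding e_def[symmetric]
  proof (intro conjI allI impI)
    show "syzygy_dim TYPE('k) a a p 1 (c, c) = 2" unfolding dim card using e0 by simp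
    fix d assume "d \<noteq> c \<and> \<bar>d - c\<bar> < e"
    then show "syzygy_dim TYPE('k) a a p 1 (c, d) = 1" "syzygy_dim TYPE('k) a a p 1 (d, c) = 1"
      unfolding dim card by simp_all
  next
    fix u :: pt
    assume u: "u \<noteq> (c, c) \<and> \<not> (\<exists>d. d \<noteq> c \<and> \<bar>d - c\<bar> < e \<and> (u = (c, d) \<or> u = (d, c)))"
    obtain x y where xy: "u = (x, y)" by (cases u)
    show "syzygy_dim TYPE('k) a a p 1 u = 0" using u unfolding xy dim card by auto
  qed
qed

end
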